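(* Let $\Gamma$ be a group of orientation preserving diffeomorphisms of $S^1=\mathbb{R}/\mathbb{Z}$, let $\mathcal{A}=C^\infty(S^1)\rtimes\Gamma$ be the algebraic crossed product, represented by $\pi$ on $\mathfrak{H}=L^2(S^1)$ via $$(\pi(g\,U^*_\phi)\xi)(x)=g(x)\,\phi'(x)^{1/2}\,\xi(\phi(x)),\qquad g\in C^\infty(S^1),\ \phi\in\Gamma,\ \xi\in\mathfrak{H},\ x\in\mathbb{R}/\mathbb{Z}.$$ Let $D=\frac{1}{i}\frac{d}{dx}$ (self-adjoint on $L^2(S^1)$), and let $\sigma$ be the automorphism of $\mathcal{A}$ determined by $\sigma(g\,U^*_\phi)=\phi'\,g\,U^*_\phi$. Then for every $a\in\mathcal{A}$ the twisted commutators $$D\circ\pi(a)-\pi(\sigma(a))\circ D\qquad\text{and}\qquad |D|\circ\pi(a)-\pi(\sigma(a))\circ|D|$$ are bounded.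
   Context: Elements of the algebraic crossed product $C^\infty(S^1)\rtimes\Gamma$ are finite sums $\sum_{\phi\in\Gamma}a_\phi U^*_\phi$ with $a_\phi\in C^\infty(S^1)$; the product is determined by $U^*_\phi f=(f\circ\phi)\,U^*_\phi$ and $U^*_\phi U^*_\psi=U^*_{\psi\phi}$ (where $\psi\phi=\psi\circ\phi$), and the involution by $\left(\sum a_\phi U^*_\phi\right)^*=\sum U_\phi\,\overline{a_\phi}$ with $U_\phi=(U_\phi^* )^{-1}$. $\phi'=d\phi/dx>0$ denotes the derivative of $\phi$ with respect to the coordinate $x\in\mathbb{R}/\mathbb{Z}$. "Bounded" means: defined on the domain of $D$ and extending to a bounded operator on $\mathfrak{H}$. *)

theory Defs
  imports "HOL-Analysis.Analysis" "HOL-Algebra.Bij" "HOL-Algebra.Module"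
begin

section \<open>The circle \<open>\<real>/\<int>\<close>\<close>

quotient_type circle = real / "\<lambda>x y. x - y \<in> \<int>"
  morphisms rep_circle to_circle
proof (rule equivpI)
  show "reflp (\<lambda>x y::real. x - y \<in> \<int>)" by (simp add: reflp_def)
  show "symp (\<lambda>x y::real. x - y \<in> \<int>)"
    by (metis (mono_tags, lifting) Ints_minus minus_diff_eq sympI)
  show "transp (\<lambda>x y::real. x - y \<in> \<int>)"
  proof (rule transpI)
    fix x y z :: real
    assume "x - y \<in> \<int>" "y - z \<in> \<int>"
    from Ints_add[OF this] show "x - z \<in> \<int>" by simp
  qed
qed

lemma to_circle_eq_iff: "to_circle x = to_circle y \<longleftrightarrow> x - y \<in> \<int>"
  by (rule circle.abs_eq_iff)

lemma to_circle_rep [simp]: "to_circle (rep_circle p) = p"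
  by (rule Quotient3_abs_rep[OF Quotient3_circle])

text \<open>The quotient topology; its Borel sets carry the measure \<open>dx\<close> of total mass one.\<close>

instantiation circle :: topological_space
begin

definition open_circle :: "circle set \<Rightarrow> bool"
  where "open_circle U \<longleftrightarrow> open (to_circle -` U)"

instance
proof
  show "open (UNIV :: circle set)" by (simp add: open_circle_def)
next
  fix S T :: "circle set"
  assume "open S" "open T"
  then show "open (S \<inter> T)" by (simp add: open_circle_def open_Int)
next
  fix K :: "circle set set"
  assume "\<forall>S\<in>K. open S"
  then show "open (\<Union>K)" by (auto simp: open_circle_def vimage_Union)
qed

end

lemma continuous_to_circle: "continuous_on UNIV to_circle"
  by (auto simp: continuous_on_open_vimage open_circle_def)

lemma measurable_to_circle [measurable]: "to_circle \<in> borel_measurable borel"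
  by (rule borel_measurable_continuous_onI[OF continuous_to_circle])

definition circle_measure :: "circle measure"
  where "circle_measure = distr (restrict_space lborel {0..<1}) borel to_circle"

lemma sets_circle_measure [simp, measurable_cong]: "sets circle_measure = sets borel"
  by (simp add: circle_measure_def)

lemma space_circle_measure [simp]: "space circle_measure = UNIV"
  by (simp add: circle_measure_def)


section \<open>The Hilbert space \<open>L\<^sup>2(\<real>/\<int>)\<close>\<close>

definition square_integrable :: "(circle \<Rightarrow> complex) \<Rightarrow> bool"
  where "square_integrable f \<longleftrightarrow>
    f \<in> borel_measurable circle_measure \<and> integrable circle_measure (\<lambda>x. (cmod (f x))\<^sup>2)"

lemma square_integrable_mult:
  assumes "square_integrable f" "square_integrable g"
  shows "integrable circle_measure (\<lambda>x. f x * cnj (g x))"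
proof (rule Bochner_Integration.integrable_bound)
  show "integrable circle_measure (\<lambda>x. (cmod (f x))\<^sup>2 + (cmod (g x))\<^sup>2)"
    using assms by (simp add: square_integrable_def)
  have [measurable]: "f \<in> borel_measurable circle_measure" "g \<in> borel_measurable circle_measure"
    using assms by (auto simp: square_integrable_def)
  have "cnj \<in> borel_measurable borel"
    by (intro borel_measurable_continuous_onI continuous_intros)
  then have [measurable]: "(\<lambda>x. cnj (g x)) \<in> borel_measurable circle_measure"
    by measurable
  show "(\<lambda>x. f x * cnj (g x)) \<in> borel_measurable circle_measure"
    by measurable
  show "AE x in circle_measure.
      norm (f x * cnj (g x)) \<le> norm ((cmod (f x))\<^sup>2 + (cmod (g x))\<^sup>2)"
  proof (intro AE_I2)
    fix x
    have "2 * (cmod (f x) * cmod (g x)) \<le> (cmod (f x))\<^sup>2 + (cmod (g x))\<^sup>2"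
      using sum_squares_bound[of "cmod (f x)" "cmod (g x)"] by (simp add: mult.assoc)
    moreover have "0 \<le> cmod (f x) * cmod (g x)"
      by simp
    ultimately show "norm (f x * cnj (g x)) \<le> norm ((cmod (f x))\<^sup>2 + (cmod (g x))\<^sup>2)"
      unfolding norm_mult complex_mod_cnj real_norm_def by linarith
  qed
qed

lemma square_integrable_scale:
  assumes "square_integrable f"
  shows "square_integrable (\<lambda>x. c * f x)"
  using assms by (auto simp: square_integrable_def norm_mult power_mult_distrib)

lemma square_integrable_add:
  assumes "square_integrable f" "square_integrable g"
  shows "square_integrable (\<lambda>x. f x + g x)"
proof -
  have [measurable]: "f \<in> borel_measurable circle_measure" "g \<in> borel_measurable circle_measure"
    using assms by (auto simp: square_integrable_def)
  have "integrable circle_measure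
      (\<lambda>x. (cmod (f x))\<^sup>2 + (cmod (g x))\<^sup>2 + 2 * Re (f x * cnj (g x)))"
    using assms square_integrable_mult[OF assms]
    by (intro Bochner_Integration.integrable_add integrable_mult_right integrable_Re)
       (auto simp: square_integrable_def)
  also have "(\<lambda>x. (cmod (f x))\<^sup>2 + (cmod (g x))\<^sup>2 + 2 * Re (f x * cnj (g x)))
      = (\<lambda>x. (cmod (f x + g x))\<^sup>2)"
    unfolding cmod_power2 by (auto simp: fun_eq_iff power2_eq_square algebra_simps)
  finally show ?thesis
    by (simp add: square_integrable_def)
qed

lemma square_integrable_zero: "square_integrable (\<lambda>_. 0)"
  by (simp add: square_integrable_def)

quotient_type L2_circle = "circle \<Rightarrow> complex" / partial:
  "\<lambda>f g. square_integrable f \<and> square_integrable g \<and> (AE x in circle_measure. f x = g x)"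
  morphisms rep_L2 to_L2
proof (rule part_equivpI)
  show "\<exists>f. square_integrable f \<and> square_integrable f \<and> (AE x in circle_measure. f x = f x)"
    using square_integrable_zero by auto
  show "symp (\<lambda>f g. square_integrable f \<and> square_integrable g \<and>
      (AE x in circle_measure. f x = g x))"
    by (rule sympI) (auto elim: eventually_mono)
  show "transp (\<lambda>f g. square_integrable f \<and> square_integrable g \<and>
      (AE x in circle_measure. f x = g x))"
    by (rule transpI) (auto elim: eventually_elim2)
qed

lemma to_L2_eq_iff:
  "square_integrable f \<Longrightarrow> square_integrable g \<Longrightarrow>
    to_L2 f = to_L2 g \<longleftrightarrow> (AE x in circle_measure. f x = g x)"
  using Quotient3_rel[OF Quotient3_L2_circle, of f g] by auto

lemma square_integrable_rep: "square_integrable (rep_L2 \<xi>)"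
  using Quotient3_rep_reflp[OF Quotient3_L2_circle, of \<xi>] by auto

lemma to_L2_rep [simp]: "to_L2 (rep_L2 \<xi>) = \<xi>"
  by (rule Quotient3_abs_rep[OF Quotient3_L2_circle])

lemma rep_to_L2: "square_integrable f \<Longrightarrow> AE x in circle_measure. rep_L2 (to_L2 f) x = f x"
  using to_L2_eq_iff[OF square_integrable_rep, of f "to_L2 f"] by simp

lift_definition scaleC :: "complex \<Rightarrow> L2_circle \<Rightarrow> L2_circle" (infixr "*\<^sub>C" 75)
  is "\<lambda>c f x. c * f x"
  by (auto intro: square_integrable_scale elim: eventually_mono)

lift_definition cinner :: "L2_circle \<Rightarrow> L2_circle \<Rightarrow> complex"
  is "\<lambda>f g. \<integral>x. f x * cnj (g x) \<partial>circle_measure"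
proof -
  fix f f' g g' :: "circle \<Rightarrow> complex"
  assume *: "square_integrable f \<and> square_integrable f' \<and> (AE x in circle_measure. f x = f' x)"
    "square_integrable g \<and> square_integrable g' \<and> (AE x in circle_measure. g x = g' x)"
  then have "AE x in circle_measure. f x * cnj (g x) = f' x * cnj (g' x)"
    by (auto elim: eventually_elim2)
  then show "(\<integral>x. f x * cnj (g x) \<partial>circle_measure) = (\<integral>x. f' x * cnj (g' x) \<partial>circle_measure)"
    using * by (intro integral_cong_AE borel_measurable_integrable square_integrable_mult) auto
qed

text \<open>The underlying real inner product space, with the norm of \<open>L\<^sup>2\<close>; it makes the library's
  \<open>bounded_linear\<close> and \<open>closure\<close> available.\<close>

instantiation L2_circle :: real_inner
begin

lift_definition zero_L2_circle :: L2_circle is "\<lambda>_. 0"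
  by (simp add: square_integrable_zero)

lift_definition plus_L2_circle :: "L2_circle \<Rightarrow> L2_circle \<Rightarrow> L2_circle" is "\<lambda>f g x. f x + g x"
  by (auto intro: square_integrable_add elim: eventually_elim2)

definition uminus_L2_circle :: "L2_circle \<Rightarrow> L2_circle"
  where "uminus_L2_circle \<xi> = (-1) *\<^sub>C \<xi>"

definition minus_L2_circle :: "L2_circle \<Rightarrow> L2_circle \<Rightarrow> L2_circle"
  where "minus_L2_circle \<xi> \<eta> = \<xi> + (-1) *\<^sub>C \<eta>"

definition scaleR_L2_circle :: "real \<Rightarrow> L2_circle \<Rightarrow> L2_circle"
  where "scaleR_L2_circle r \<xi> = complex_of_real r *\<^sub>C \<xi>"

definition inner_L2_circle :: "L2_circle \<Rightarrow> L2_circle \<Rightarrow> real"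
  where "inner_L2_circle \<xi> \<eta> = Re (cinner \<xi> \<eta>)"

definition norm_L2_circle :: "L2_circle \<Rightarrow> real"
  where "norm_L2_circle \<xi> = sqrt (inner \<xi> \<xi>)"

definition sgn_L2_circle :: "L2_circle \<Rightarrow> L2_circle"
  where "sgn_L2_circle \<xi> = complex_of_real (inverse (norm \<xi>)) *\<^sub>C \<xi>"

definition dist_L2_circle :: "L2_circle \<Rightarrow> L2_circle \<Rightarrow> real"
  where "dist_L2_circle \<xi> \<eta> = norm (\<xi> - \<eta>)"

definition uniformity_L2_circle :: "(L2_circle \<times> L2_circle) filter"
  where "uniformity_L2_circle = (INF e\<in>{0 <..}. principal {(\<xi>, \<eta>). dist \<xi> \<eta> < e})"

definition open_L2_circle :: "L2_circle set \<Rightarrow> bool"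
  where "open_L2_circle U \<longleftrightarrow>
    (\<forall>\<xi>\<in>U. eventually (\<lambda>(\<xi>', \<eta>). \<xi>' = \<xi> \<longrightarrow> \<eta> \<in> U) uniformity)"

lemma cinner_add_left: "cinner (\<xi> + \<eta>) \<zeta> = cinner \<xi> \<zeta> + cinner \<eta> \<zeta>"
  by transfer (simp add: distrib_right square_integrable_mult)

lemma cinner_scaleC_left: "cinner (c *\<^sub>C \<xi>) \<eta> = c * cinner \<xi> \<eta>"
  by transfer (simp add: mult.assoc)

lemma cinner_commute: "cinner \<xi> \<eta> = cnj (cinner \<eta> \<xi>)"
proof transfer
  fix f g :: "circle \<Rightarrow> complex"
  assume "square_integrable f \<and> square_integrable f \<and> (AE x in circle_measure. f x = f x)"
    "square_integrable g \<and> square_integrable g \<and> (AE x in circle_measure. g x = g x)"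
  have "cnj (\<integral>x. g x * cnj (f x) \<partial>circle_measure)
      = (\<integral>x. cnj (g x * cnj (f x)) \<partial>circle_measure)"
    by (rule Bochner_Integration.integral_cnj[symmetric])
  then show "(\<integral>x. f x * cnj (g x) \<partial>circle_measure) = cnj (\<integral>x. g x * cnj (f x) \<partial>circle_measure)"
    by (simp add: mult.commute)
qed

lemma cinner_self: "cinner \<xi> \<xi> = complex_of_real (\<integral>x. (cmod (rep_L2 \<xi> x))\<^sup>2 \<partial>circle_measure)"
  unfolding cinner.rep_eq integral_complex_of_real[symmetric]
  by (simp only: complex_norm_square)

instance
proof
  fix \<xi> \<eta> \<zeta> :: L2_circle and r s :: real
  show "\<xi> + \<eta> + \<zeta> = \<xi> + (\<eta> + \<zeta>)"
    by transfer (simp add: add.assoc square_integrable_add)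
  show "\<xi> + \<eta> = \<eta> + \<xi>"
    by transfer (simp add: add.commute square_integrable_add)
  show "0 + \<xi> = \<xi>"
    by transfer auto
  show "- \<xi> + \<xi> = 0"
    unfolding uminus_L2_circle_def
    by transfer (auto intro: square_integrable_zero)
  show "\<xi> - \<eta> = \<xi> + - \<eta>"
    by (simp add: uminus_L2_circle_def minus_L2_circle_def)
  show "r *\<^sub>R (\<xi> + \<eta>) = r *\<^sub>R \<xi> + r *\<^sub>R \<eta>"
    unfolding scaleR_L2_circle_def
    by transfer
       (simp add: distrib_left distrib_right square_integrable_add square_integrable_scale)
  show "(r + s) *\<^sub>R \<xi> = r *\<^sub>R \<xi> + s *\<^sub>R \<xi>"
    unfolding scaleR_L2_circle_def
    by transfer
       (simp add: distrib_left distrib_right square_integrable_add square_integrable_scale)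
  show "r *\<^sub>R s *\<^sub>R \<xi> = (r * s) *\<^sub>R \<xi>"
    unfolding scaleR_L2_circle_def
    by transfer (simp add: mult.assoc square_integrable_scale)
  show "1 *\<^sub>R \<xi> = \<xi>"
    unfolding scaleR_L2_circle_def by transfer auto
  show "sgn \<xi> = inverse (norm \<xi>) *\<^sub>R \<xi>"
    by (simp only: sgn_L2_circle_def scaleR_L2_circle_def)
  show "dist \<xi> \<eta> = norm (\<xi> - \<eta>)"
    by (rule dist_L2_circle_def)
  show "uniformity = (INF e\<in>{0 <..}. principal {(\<xi>::L2_circle, \<eta>). dist \<xi> \<eta> < e})"
    by (rule uniformity_L2_circle_def)
  show "open U \<longleftrightarrow> (\<forall>\<xi>\<in>U. eventually (\<lambda>(\<xi>', \<eta>). \<xi>' = \<xi> \<longrightarrow> \<eta> \<in> U) uniformity)"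
    for U :: "L2_circle set"
    by (rule open_L2_circle_def)
  show "inner \<xi> \<eta> = inner \<eta> \<xi>"
    unfolding inner_L2_circle_def by (subst cinner_commute) simp
  show "inner (\<xi> + \<eta>) \<zeta> = inner \<xi> \<zeta> + inner \<eta> \<zeta>"
    by (simp add: inner_L2_circle_def cinner_add_left)
  show "inner (r *\<^sub>R \<xi>) \<eta> = r * inner \<xi> \<eta>"
    by (simp add: inner_L2_circle_def scaleR_L2_circle_def cinner_scaleC_left)
  show "0 \<le> inner \<xi> \<xi>"
    by (simp add: inner_L2_circle_def cinner_self)
  show "norm \<xi> = sqrt (inner \<xi> \<xi>)"
    by (rule norm_L2_circle_def)
  have "inner \<xi> \<xi> = 0 \<longleftrightarrow> (\<integral>x. (cmod (rep_L2 \<xi> x))\<^sup>2 \<partial>circle_measure) = 0"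
    by (simp add: inner_L2_circle_def cinner_self)
  also have "\<dots> \<longleftrightarrow> (AE x in circle_measure. (cmod (rep_L2 \<xi> x))\<^sup>2 = 0)"
    using square_integrable_rep[of \<xi>]
    by (intro integral_nonneg_eq_0_iff_AE) (auto simp: square_integrable_def)
  also have "\<dots> \<longleftrightarrow> (AE x in circle_measure. rep_L2 \<xi> x = 0)"
    by simp
  also have "\<dots> \<longleftrightarrow> to_L2 (rep_L2 \<xi>) = to_L2 (\<lambda>_. 0)"
    by (subst to_L2_eq_iff) (simp_all add: square_integrable_rep square_integrable_zero)
  also have "\<dots> \<longleftrightarrow> \<xi> = 0"
    by (simp add: zero_L2_circle_def)
  finally show "inner \<xi> \<xi> = 0 \<longleftrightarrow> \<xi> = 0" .
qed

end


section \<open>Orientation preserving diffeomorphisms\<close>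

definition smooth :: "(real \<Rightarrow> 'a::real_normed_vector) \<Rightarrow> bool"
  where "smooth f \<longleftrightarrow>
    (\<exists>F. F 0 = f \<and> (\<forall>n::nat. \<forall>x. (F n has_vector_derivative F (Suc n) x) (at x)))"

definition smooth_circle :: "(circle \<Rightarrow> complex) set"
  where "smooth_circle = {g. smooth (\<lambda>x. g (to_circle x))}"

definition smooth_lift :: "(circle \<Rightarrow> circle) \<Rightarrow> (real \<Rightarrow> real) \<Rightarrow> bool"
  where "smooth_lift \<phi> \<Phi> \<longleftrightarrow> smooth \<Phi> \<and> (\<forall>x. \<phi> (to_circle x) = to_circle (\<Phi> x))"

definition circle_deriv :: "(circle \<Rightarrow> circle) \<Rightarrow> circle \<Rightarrow> real"
  where "circle_deriv \<phi> p =
    (THE d. \<exists>\<Phi> x. smooth_lift \<phi> \<Phi> \<and> to_circle x = p \<and> (\<Phi> has_real_derivative d) (at x))"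

lemma smooth_imp_deriv:
  fixes \<Phi> :: "real \<Rightarrow> real"
  assumes "smooth \<Phi>"
  shows "(\<Phi> has_real_derivative deriv \<Phi> x) (at x)"
proof -
  obtain F where "F 0 = \<Phi>" "(F 0 has_vector_derivative F (Suc 0) x) (at x)"
    using assms by (auto simp: smooth_def)
  then have "(\<Phi> has_real_derivative F (Suc 0) x) (at x)"
    by (simp add: has_real_derivative_iff_has_vector_derivative)
  then show ?thesis
    using DERIV_imp_deriv by force
qed

lemma smooth_imp_continuous:
  fixes \<Phi> :: "real \<Rightarrow> real"
  shows "smooth \<Phi> \<Longrightarrow> continuous_on S \<Phi>"
  by (metis DERIV_isCont continuous_at_imp_continuous_on smooth_imp_deriv)

lemma continuous_Ints_constant:
  fixes f :: "real \<Rightarrow> real"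
  assumes "continuous_on UNIV f" "\<And>x. f x \<in> \<int>"
  obtains k where "k \<in> \<int>" "\<And>x. f x = k"
proof -
  have "f constant_on UNIV"
  proof (rule continuous_discrete_range_constant[OF connected_UNIV assms(1)])
    fix x
    have "norm (f y - f x) \<ge> 1" if "f y \<noteq> f x" for y
      using Ints_nonzero_abs_ge1[OF Ints_diff[OF assms(2)[of y] assms(2)[of x]]] that by simp
    then show "\<exists>e>0. \<forall>y. y \<in> UNIV \<and> f y \<noteq> f x \<longrightarrow> e \<le> norm (f y - f x)"
      by (intro exI[of _ 1]) auto
  qed
  then show ?thesis
    using that assms(2) by (auto simp: constant_on_def)
qed

lemma circle_deriv_lift:
  assumes "smooth_lift \<phi> \<Phi>"
  shows "circle_deriv \<phi> (to_circle x) = deriv \<Phi> x"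
  unfolding circle_deriv_def
proof (rule the_equality)
  have "(\<Phi> has_real_derivative deriv \<Phi> x) (at x)"
    using assms by (simp add: smooth_lift_def smooth_imp_deriv)
  with assms show "\<exists>\<Psi> y. smooth_lift \<phi> \<Psi> \<and> to_circle y = to_circle x \<and>
      (\<Psi> has_real_derivative deriv \<Phi> x) (at y)"
    by blast
next
  fix d
  assume "\<exists>\<Psi> y. smooth_lift \<phi> \<Psi> \<and> to_circle y = to_circle x \<and> (\<Psi> has_real_derivative d) (at y)"
  then obtain \<Psi> y where \<Psi>: "smooth_lift \<phi> \<Psi>" and y: "to_circle y = to_circle x"
    and d: "(\<Psi> has_real_derivative d) (at y)"
    by blast
  define m where "m = y - x"
  have m: "m \<in> \<int>"
    using y by (simp add: m_def to_circle_eq_iff)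
  have *: "\<Psi> (t + m) - \<Phi> t \<in> \<int>" for t
  proof -
    have "to_circle (t + m) = to_circle t"
      using m by (simp add: to_circle_eq_iff)
    then have "to_circle (\<Psi> (t + m)) = to_circle (\<Phi> t)"
      using assms \<Psi> by (metis smooth_lift_def)
    then show ?thesis
      by (simp add: to_circle_eq_iff)
  qed
  have cont: "continuous_on UNIV (\<lambda>t. \<Psi> (t + m) - \<Phi> t)"
  proof (rule continuous_on_diff)
    have "continuous_on UNIV \<Psi>"
      using \<Psi> by (simp add: smooth_lift_def smooth_imp_continuous)
    then show "continuous_on UNIV (\<lambda>t. \<Psi> (t + m))"
      by (rule continuous_on_compose2) (auto intro: continuous_intros)
    show "continuous_on UNIV \<Phi>"
      using assms by (simp add: smooth_lift_def smooth_imp_continuous)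
  qed
  obtain k where k: "\<And>t. \<Psi> (t + m) - \<Phi> t = k"
    using continuous_Ints_constant[OF cont *] by blast
  have "((\<lambda>t. \<Psi> (t + m) - k) has_real_derivative d) (at x)"
    using d DERIV_shift[of \<Psi> d x m] by (auto simp: m_def intro!: derivative_eq_intros)
  moreover have "(\<lambda>t. \<Psi> (t + m) - k) = \<Phi>"
    using k by (auto simp: fun_eq_iff algebra_simps)
  ultimately show "d = deriv \<Phi> x"
    by (simp add: DERIV_imp_deriv)
qed

definition diff_plus :: "(circle \<Rightarrow> circle) set"
  where "diff_plus = {\<phi>. bij \<phi> \<and> (\<exists>\<Phi>. smooth_lift \<phi> \<Phi>) \<and> (\<exists>\<Psi>. smooth_lift (inv_into UNIV \<phi>) \<Psi>) \<and>
    (\<forall>p. circle_deriv \<phi> p > 0)}"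

lemma circle_deriv_compose:
  assumes "\<phi> \<in> diff_plus" "\<psi> \<in> diff_plus" "\<psi> \<circ> \<phi> \<in> diff_plus"
  shows "circle_deriv (\<psi> \<circ> \<phi>) p = circle_deriv \<psi> (\<phi> p) * circle_deriv \<phi> p"
proof -
  obtain \<Phi> \<Psi> \<Theta> where lifts: "smooth_lift \<phi> \<Phi>" "smooth_lift \<psi> \<Psi>" "smooth_lift (\<psi> \<circ> \<phi>) \<Theta>"
    using assms by (auto simp: diff_plus_def)
  have "to_circle (\<Theta> t) = to_circle (\<Psi> (\<Phi> t))" for t
    using lifts unfolding smooth_lift_def by (metis comp_apply)
  then have *: "\<Theta> t - \<Psi> (\<Phi> t) \<in> \<int>" for t
    by (simp add: to_circle_eq_iff)
  have cont: "continuous_on UNIV (\<lambda>t. \<Theta> t - \<Psi> (\<Phi> t))"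
  proof (rule continuous_on_diff)
    have cont: "continuous_on UNIV \<Phi>" "continuous_on UNIV \<Psi>" "continuous_on UNIV \<Theta>"
      using lifts by (simp_all add: smooth_lift_def smooth_imp_continuous)
    show "continuous_on UNIV (\<lambda>t. \<Psi> (\<Phi> t))"
      by (rule continuous_on_compose2[OF cont(2,1)]) simp
    show "continuous_on UNIV \<Theta>"
      by (rule cont(3))
  qed
  obtain k where k: "\<And>t. \<Theta> t - \<Psi> (\<Phi> t) = k"
    using continuous_Ints_constant[OF cont *] by blast
  define x where "x = rep_circle p"
  have p: "p = to_circle x"
    by (simp add: x_def)
  have "((\<lambda>t. \<Psi> (\<Phi> t)) has_real_derivative deriv \<Psi> (\<Phi> x) * deriv \<Phi> x) (at x)"
    using lifts by (intro DERIV_chain2 smooth_imp_deriv) (auto simp: smooth_lift_def)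
  then have "((\<lambda>t. \<Psi> (\<Phi> t) + k) has_real_derivative deriv \<Psi> (\<Phi> x) * deriv \<Phi> x) (at x)"
    by (auto intro!: derivative_eq_intros)
  moreover have "(\<lambda>t. \<Psi> (\<Phi> t) + k) = \<Theta>"
    using k by (auto simp: fun_eq_iff algebra_simps)
  ultimately have "deriv \<Theta> x = deriv \<Psi> (\<Phi> x) * deriv \<Phi> x"
    by (simp add: DERIV_imp_deriv)
  moreover have "\<phi> p = to_circle (\<Phi> x)"
    using lifts p by (simp add: smooth_lift_def)
  ultimately show ?thesis
    using lifts p by (simp add: circle_deriv_lift)
qed


section \<open>The algebraic crossed product\<close>

text \<open>A finite sum \<open>\<Sum>\<phi>. a \<phi> U\<^sup>*\<^sub>\<phi>\<close> is the finitely supported function \<open>a\<close>.\<close>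

type_synonym crossed = "(circle \<Rightarrow> circle) \<Rightarrow> circle \<Rightarrow> complex"

definition supp :: "crossed \<Rightarrow> (circle \<Rightarrow> circle) set"
  where "supp a = {\<phi>. a \<phi> \<noteq> (\<lambda>_. 0)}"

definition monomial :: "(circle \<Rightarrow> complex) \<Rightarrow> (circle \<Rightarrow> circle) \<Rightarrow> crossed"
  where "monomial g \<phi> = (\<lambda>\<psi>. if \<psi> = \<phi> then g else (\<lambda>_. 0))"

record star_algebra = "(complex, crossed) module" +
  star :: "crossed \<Rightarrow> crossed"

text \<open>The product is the bilinear extension of
  \<open>g U\<^sup>*\<^sub>\<phi> h U\<^sup>*\<^sub>\<psi> = g (h \<circ> \<phi>) U\<^sup>*\<^bsub>\<psi> \<circ> \<phi>\<^esub>\<close>, and the involution the conjugate linear extension of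
  \<open>(g U\<^sup>*\<^sub>\<phi>)\<^sup>* = U\<^sub>\<phi> (cnj \<circ> g) = (cnj \<circ> g \<circ> \<phi>\<^sup>-\<^sup>1) U\<^sup>*\<^bsub>\<phi>\<^sup>-\<^sup>1\<^esub>\<close>.\<close>

definition crossed_product :: "(circle \<Rightarrow> circle) set \<Rightarrow> star_algebra"
  where "crossed_product \<Gamma> =
    \<lparr>carrier = {a. finite (supp a) \<and> supp a \<subseteq> \<Gamma> \<and> (\<forall>\<phi>. a \<phi> \<in> smooth_circle)},
     mult = (\<lambda>a b \<theta> x. \<Sum>(\<phi>, \<psi>)\<in>{(\<phi>, \<psi>) \<in> supp a \<times> supp b. \<psi> \<circ> \<phi> = \<theta>}. a \<phi> x * b \<psi> (\<phi> x)),
     one = monomial (\<lambda>_. 1) id,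
     zero = (\<lambda>_ _. 0),
     add = (\<lambda>a b \<phi> x. a \<phi> x + b \<phi> x),
     smult = (\<lambda>c a \<phi> x. c * a \<phi> x),
     star = (\<lambda>a \<theta> x. \<Sum>\<phi>\<in>{\<phi> \<in> supp a. inv_into UNIV \<phi> = \<theta>}. cnj (a \<phi> (\<theta> x)))\<rparr>"

lemma supp_monomial: "supp (monomial g \<phi>) = (if g = (\<lambda>_. 0) then {} else {\<phi>})"
  by (auto simp: supp_def monomial_def)

lemma monomial_mult:
  "monomial g \<phi> \<otimes>\<^bsub>crossed_product \<Gamma>\<^esub> monomial h \<psi> = monomial (\<lambda>x. g x * h (\<phi> x)) (\<psi> \<circ> \<phi>)"
proof -
  have I: "{(\<phi>', \<psi>') \<in> supp (monomial g \<phi>) \<times> supp (monomial h \<psi>). \<psi>' \<circ> \<phi>' = \<theta>}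
      = (if g = (\<lambda>_. 0) \<or> h = (\<lambda>_. 0) \<or> \<psi> \<circ> \<phi> \<noteq> \<theta> then {} else {(\<phi>, \<psi>)})" for \<theta>
    by (auto simp: supp_monomial)
  show ?thesis
    by (intro ext, simp only: crossed_product_def monoid.simps I) (simp add: monomial_def)
qed

lemma monomial_star:
  "star (crossed_product \<Gamma>) (monomial g \<phi>)
    = monomial (\<lambda>x. cnj (g (inv_into UNIV \<phi> x))) (inv_into UNIV \<phi>)"
proof -
  have I: "{\<phi>' \<in> supp (monomial g \<phi>). inv_into UNIV \<phi>' = \<theta>}
      = (if g = (\<lambda>_. 0) \<or> inv_into UNIV \<phi> \<noteq> \<theta> then {} else {\<phi>})" for \<theta>
    by (auto simp: supp_monomial)
  show ?thesis
    by (intro ext) (auto simp add: crossed_product_def I, auto simp: monomial_def)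
qed

definition twist :: "crossed \<Rightarrow> crossed"
  where "twist a = (\<lambda>\<phi> x. complex_of_real (circle_deriv \<phi> x) * a \<phi> x)"

lemma twist_monomial:
  "twist (monomial g \<phi>) = monomial (\<lambda>x. complex_of_real (circle_deriv \<phi> x) * g x) \<phi>"
  by (intro ext) (simp add: twist_def monomial_def)

lemma supp_twist:
  assumes "supp a \<subseteq> diff_plus"
  shows "supp (twist a) = supp a"
proof -
  have "a \<phi> = (\<lambda>_. 0)" if "\<And>x. circle_deriv \<phi> x = 0 \<or> a \<phi> x = 0" for \<phi>
  proof (rule ccontr)
    assume *: "a \<phi> \<noteq> (\<lambda>_. 0)"
    with assms have "circle_deriv \<phi> x > 0" for x
      by (auto simp: supp_def diff_plus_def)
    with that * show False
      by (metis less_irrefl)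
  qed
  then show ?thesis
    by (auto simp: supp_def twist_def fun_eq_iff)
qed

lemma twist_mult:
  assumes "subgroup \<Gamma> (BijGroup UNIV)" "\<Gamma> \<subseteq> diff_plus"
    and "a \<in> carrier (crossed_product \<Gamma>)" "b \<in> carrier (crossed_product \<Gamma>)"
  shows "twist (a \<otimes>\<^bsub>crossed_product \<Gamma>\<^esub> b) = twist a \<otimes>\<^bsub>crossed_product \<Gamma>\<^esub> twist b"
proof -
  have sub: "supp a \<subseteq> \<Gamma>" "supp b \<subseteq> \<Gamma>"
    using assms by (auto simp: crossed_product_def)
  then have supp: "supp (twist a) = supp a" "supp (twist b) = supp b"
    using assms(2) by (auto intro!: supp_twist)
  have chain: "circle_deriv (\<psi> \<circ> \<phi>) x = circle_deriv \<psi> (\<phi> x) * circle_deriv \<phi> x"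
    if "\<phi> \<in> \<Gamma>" "\<psi> \<in> \<Gamma>" for \<phi> \<psi> x
  proof -
    have bij: "\<phi> \<in> Bij UNIV" "\<psi> \<in> Bij UNIV"
      using subgroup.subset[OF assms(1)] that by (auto simp: BijGroup_def)
    have "\<psi> \<otimes>\<^bsub>BijGroup UNIV\<^esub> \<phi> = \<psi> \<circ> \<phi>"
      using bij by (simp add: BijGroup_def compose_def fun_eq_iff)
    then have "\<psi> \<circ> \<phi> \<in> \<Gamma>"
      using subgroup.m_closed[OF assms(1) that(2,1)] by simp
    then show ?thesis
      using that assms(2) by (intro circle_deriv_compose) auto
  qed
  show ?thesis
  proof (intro ext)
    fix \<theta> x
    let ?I = "{(\<phi>, \<psi>) \<in> supp a \<times> supp b. \<psi> \<circ> \<phi> = \<theta>}"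
    have "twist (a \<otimes>\<^bsub>crossed_product \<Gamma>\<^esub> b) \<theta> x
        = (\<Sum>(\<phi>, \<psi>)\<in>?I. complex_of_real (circle_deriv \<theta> x) * (a \<phi> x * b \<psi> (\<phi> x)))"
      by (simp add: twist_def crossed_product_def sum_distrib_left case_prod_unfold)
    also have "\<dots> = (\<Sum>(\<phi>, \<psi>)\<in>?I. twist a \<phi> x * twist b \<psi> (\<phi> x))"
    proof (rule sum.cong[OF refl])
      fix z
      assume z: "z \<in> ?I"
      obtain \<phi> \<psi> where z': "z = (\<phi>, \<psi>)"
        by (cases z)
      with z have "\<phi> \<in> \<Gamma>" "\<psi> \<in> \<Gamma>" "\<theta> = \<psi> \<circ> \<phi>"
        using sub by auto
      then show "(case z of (\<phi>, \<psi>) \<Rightarrow> complex_of_real (circle_deriv \<theta> x) * (a \<phi> x * b \<psi> (\<phi> x)))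
          = (case z of (\<phi>, \<psi>) \<Rightarrow> twist a \<phi> x * twist b \<psi> (\<phi> x))"
        using chain[of \<phi> \<psi> x] by (simp add: z' twist_def)
    qed
    also have "\<dots> = (twist a \<otimes>\<^bsub>crossed_product \<Gamma>\<^esub> twist b) \<theta> x"
      by (simp add: crossed_product_def supp)
    finally show "twist (a \<otimes>\<^bsub>crossed_product \<Gamma>\<^esub> b) \<theta> x
        = (twist a \<otimes>\<^bsub>crossed_product \<Gamma>\<^esub> twist b) \<theta> x" .
  qed
qed

text \<open>Choosing a representative of \<open>\<xi>\<close> is harmless: diffeomorphisms preserve null sets.\<close>

definition rep_pi :: "crossed \<Rightarrow> L2_circle \<Rightarrow> L2_circle"
  where "rep_pi a \<xi> =
    to_L2 (\<lambda>x. \<Sum>\<phi>\<in>supp a. a \<phi> x * complex_of_real (sqrt (circle_deriv \<phi> x)) * rep_L2 \<xi> (\<phi> x))"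


section \<open>Unbounded operators\<close>

text \<open>An unbounded operator on \<open>L\<^sup>2\<close> is given by its graph.  Relation composition applies the left
  factor first.\<close>

type_synonym unbounded_op = "(L2_circle \<times> L2_circle) set"

definition adjoint_op :: "unbounded_op \<Rightarrow> unbounded_op"
  where "adjoint_op T = {(\<eta>, \<zeta>). \<forall>(\<xi>, \<theta>)\<in>T. cinner \<theta> \<eta> = cinner \<xi> \<zeta>}"

definition self_adjoint_op :: "unbounded_op \<Rightarrow> bool"
  where "self_adjoint_op T \<longleftrightarrow> single_valued T \<and> closure (Domain T) = UNIV \<and> adjoint_op T = T"

definition positive_op :: "unbounded_op \<Rightarrow> bool"
  where "positive_op T \<longleftrightarrow> (\<forall>(\<xi>, \<eta>)\<in>T. cinner \<eta> \<xi> \<in> \<real> \<and> 0 \<le> Re (cinner \<eta> \<xi>))"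

text \<open>\<open>|T|\<close> is the positive square root of \<open>T\<^sup>*T\<close>, which exists uniquely if \<open>T\<close> is closed and
  densely defined.\<close>

definition abs_op :: "unbounded_op \<Rightarrow> unbounded_op"
  where "abs_op T = (THE P. self_adjoint_op P \<and> positive_op P \<and> P O P = T O adjoint_op T)"

text \<open>\<open>D = -i d/dx\<close> on the periodic absolutely continuous functions \<open>f\<close> with derivative \<open>h\<close> in \<open>L\<^sup>2\<close>.
  Absolute continuity is expressed by the fundamental theorem of calculus.\<close>

definition dirac :: unbounded_op
  where "dirac = {(to_L2 f, to_L2 (\<lambda>p. h p / \<i>)) | f h.
    square_integrable f \<and> square_integrable h \<and>
    (\<forall>x y. x \<le> y \<longrightarrow>
      ((\<lambda>t. h (to_circle t)) has_integral (f (to_circle y) - f (to_circle x))) {x..y})}"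

text \<open>\<open>T \<circ> A - B \<circ> T\<close> with its maximal domain.\<close>

definition twisted_commutator ::
    "unbounded_op \<Rightarrow> (L2_circle \<Rightarrow> L2_circle) \<Rightarrow> (L2_circle \<Rightarrow> L2_circle) \<Rightarrow> unbounded_op"
  where "twisted_commutator T A B = {(\<xi>, \<eta> - B \<zeta>) | \<xi> \<eta> \<zeta>. (A \<xi>, \<eta>) \<in> T \<and> (\<xi>, \<zeta>) \<in> T}"

definition bounded_from :: "L2_circle set \<Rightarrow> unbounded_op \<Rightarrow> bool"
  where "bounded_from V T \<longleftrightarrow> V \<subseteq> Domain T \<and>
    (\<exists>B. bounded_linear B \<and> (\<forall>c \<xi>. B (c *\<^sub>C \<xi>) = c *\<^sub>C B \<xi>) \<and> (\<forall>(\<xi>, \<eta>)\<in>T. B \<xi> = \<eta>))"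

end

theory Submission
  imports Defs "HOL-Probability.Distribution_Functions"
begin

text \<open>In the Fourier basis \<open>D\<close> is multiplication by \<open>2\<pi>n\<close>.  A positive self-adjoint root of \<open>D\<^sup>2\<close>
  must act on each \<open>exp (2\<pi>inx)\<close> as \<open>2\<pi>\<bar>n\<bar>\<close>, so \<open>|D|\<close> is multiplication by \<open>2\<pi>\<bar>n\<bar>\<close>.  Let
  \<open>a = g U\<^sup>*\<^sub>\<phi>\<close>, \<open>w = g \<phi>'\<^sup>1\<^sup>/\<^sup>2\<close> and \<open>C \<xi> = \<xi> \<circ> \<phi>\<close>, so that \<open>\<pi>(a) = w C\<close> and
  \<open>\<pi>(\<sigma>(a)) = w \<phi>' C\<close>.  By the Leibniz rule the twisted commutator with \<open>D\<close> is the bounded operator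
  \<open>-i w' C\<close>.  For \<open>|D|\<close> it is \<open>[|D|, w] C + w (|D| C - \<phi>' C |D|)\<close>.  The matrix
  \<open>2\<pi>(\<bar>m\<bar> - \<bar>n\<bar>) w\<^sub>m\<^sub>-\<^sub>n\<close> of \<open>[|D|, w]\<close> is dominated by a convolution with the summable sequence
  \<open>2\<pi>\<bar>k\<bar> \<bar>w\<^sub>k\<bar>\<close>.  The second term is controlled by the quadratic form
  \<open>\<langle>|D|\<xi>, \<eta>\<rangle> = \<pi>/2 \<integral>\<integral> (\<xi>(x) - \<xi>(y)) cnj (\<eta>(x) - \<eta>(y)) / sin\<^sup>2 \<pi>(x - y)\<close>: substituting \<open>\<phi>\<close> in it
  changes the kernel by \<open>\<phi>'(x) \<phi>'(y) / sin\<^sup>2 \<pi>(\<phi>(x) - \<phi>(y)) - 1 / sin\<^sup>2 \<pi>(x - y)\<close>, which is bounded.\<close>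

section \<open>Integration over one period\<close>

text \<open>The quadratic form is evaluated only on functions that are Lipschitz for the chord
  distance, where the product of two differences absorbs the singularity of the kernel. The estimate
  for |D| is therefore proved on trigonometric polynomials. Passing to the whole domain takes
  approximation in the graph norm, and the control comes from the Leibniz rule for D: the
  coefficients of |D|\<xi> and D\<xi> have equal moduli, so both operators have the same domain and
  the same graph norm, and \<pi>(a) acts continuously in that norm. The weight \<phi>' is forced by
  substitution: \<phi>' C is the adjoint of composition with the inverse of \<phi>. Hence the
  pairing of \<phi>' C |D|\<xi> with \<eta> is the pairing of |D|\<xi> with \<eta> \<circ>
  \<phi>^-1, a value of the form at the pair whose pullback by \<phi> is (C \<xi>, \<eta>). The
  constant \<pi>/2 comes from the Fejer kernel: the integral of |exp(2\<pi>imt) - 1|^2 / sin^2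
  \<pi>t over a period is 4|m|, while the eigenvalue of |D| is 2\<pi>|m|.\<close>

definition unit_measure :: "real measure"
  where "unit_measure = density lborel (indicator {0..<1})"

lemma sets_unit_measure [simp, measurable_cong]: "sets unit_measure = sets borel"
  by (simp add: unit_measure_def)

lemma space_unit_measure [simp]: "space unit_measure = UNIV"
  by (simp add: unit_measure_def)

lemma emeasure_unit_measure:
  "A \<in> sets borel \<Longrightarrow> emeasure unit_measure A = emeasure lborel (A \<inter> {0..<1})"
  unfolding unit_measure_def
  by (subst emeasure_density)
     (auto simp: nn_integral_indicator[symmetric] indicator_inter_arith mult.commute simp del: nn_integral_indicator)

lemma emeasure_unit_UNIV [simp]: "emeasure unit_measure UNIV = 1"
  by (simp add: emeasure_unit_measure)

interpretation unit: finite_measure unit_measure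
  by (rule finite_measureI) simp

lemma measure_unit_UNIV [simp]: "measure unit_measure UNIV = 1"
  by (simp add: measure_def)

lemma nn_integral_unit:
  "f \<in> borel_measurable borel \<Longrightarrow>
    (\<integral>\<^sup>+x. f x \<partial>unit_measure) = (\<integral>\<^sup>+x. f x * indicator {0..<1} x \<partial>lborel)"
  unfolding unit_measure_def by (subst nn_integral_density) (auto simp: mult.commute)

text \<open>Both sides come from Lebesgue measure on one period, but the space of
  \<open>restrict_space\<close> is only the interval, while \<open>unit_measure\<close> lives on the
  whole line. There, functions on the circle become 1-periodic functions that can be translated,
  differentiated and composed with lifts without leaving the space.\<close>

lemma circle_measure_eq_distr: "circle_measure = distr unit_measure borel to_circle"
proof (rule measure_eqI)
  fix A :: "circle set"
  assume "A \<in> sets circle_measure"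
  then have [measurable]: "A \<in> sets borel" by simp
  have m: "to_circle -` A \<in> sets borel"
    using measurable_sets[OF measurable_to_circle, of A] by simp
  have r: "to_circle \<in> borel_measurable (restrict_space lborel {0..<1})"
    by (simp add: measurable_restrict_space1)
  show "emeasure circle_measure A = emeasure (distr unit_measure borel to_circle) A"
    unfolding circle_measure_def using m
    by (simp add: emeasure_distr r emeasure_unit_measure emeasure_restrict_space space_restrict_space Int_commute)
qed simp

lemma circle_integral:
  fixes f :: "circle \<Rightarrow> 'a::{banach, second_countable_topology}"
  assumes [measurable]: "f \<in> borel_measurable borel"
  shows "(\<integral>p. f p \<partial>circle_measure) = (\<integral>t. f (to_circle t) \<partial>unit_measure)"
  unfolding circle_measure_eq_distr by (rule integral_distr) simp_all

lemma circle_integrable: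
  fixes f :: "circle \<Rightarrow> 'a::{banach, second_countable_topology}"
  assumes [measurable]: "f \<in> borel_measurable borel"
  shows "integrable circle_measure f \<longleftrightarrow> integrable unit_measure (\<lambda>t. f (to_circle t))"
  unfolding circle_measure_eq_distr by (rule integrable_distr_eq) simp_all

lemma circle_nn_integral:
  assumes [measurable]: "f \<in> borel_measurable borel"
  shows "(\<integral>\<^sup>+p. f p \<partial>circle_measure) = (\<integral>\<^sup>+t. f (to_circle t) \<partial>unit_measure)"
  unfolding circle_measure_eq_distr by (rule nn_integral_distr) simp_all

lemma emeasure_circle_UNIV [simp]: "emeasure circle_measure UNIV = 1"
  unfolding circle_measure_eq_distr by (simp add: emeasure_distr)

interpretation circ: finite_measure circle_measure
  by (rule finite_measureI) simp

lemma measure_circle_UNIV [simp]: "measure circle_measure UNIV = 1"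
  by (simp add: measure_def)

section \<open>Periodic functions on the line and their descent to the circle\<close>

lemma periodic_int:
  fixes f :: "real \<Rightarrow> 'a"
  assumes "\<And>x. f (x + 1) = f x"
  shows "f (x + of_int k) = f x"
proof (induction k rule: int_induct[where k=0])
  case (step1 i)
  then show ?case using assms[of "x + of_int i"] by (simp add: algebra_simps)
next
  case (step2 i)
  then show ?case using assms[of "x + of_int (i - 1)"] by (simp add: algebra_simps)
qed simp

lemma periodic_frac:
  fixes f :: "real \<Rightarrow> 'a"
  assumes "\<And>x. f (x + 1) = f x"
  shows "f (frac x) = f x"
  using periodic_int[of f x "- \<lfloor>x\<rfloor>"] assms by (simp add: frac_def)

lemma to_circle_add_int [simp]: "to_circle (t + 1) = to_circle t"
  by (simp add: to_circle_eq_iff)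

lemma to_circle_frac [simp]: "to_circle (frac t) = to_circle t"
  by (rule periodic_frac) simp

text \<open>\<open>rep_circle\<close> picks an unspecified real number in each class, so a function
  on the circle can be defined through it once the function on the line is 1-periodic. The
  characters \<open>ce\<close> and the derivatives of functions on the circle are obtained in this
  way.\<close>

lemma periodic_rep:
  fixes f :: "real \<Rightarrow> 'a"
  assumes "\<And>x. f (x + 1) = f x"
  shows "f (rep_circle (to_circle t)) = f t"
proof -
  have "rep_circle (to_circle t) - t \<in> \<int>"
    by (simp add: to_circle_eq_iff[symmetric])
  then obtain k where "rep_circle (to_circle t) = t + of_int k"
    by (auto simp: Ints_def algebra_simps)
  then show ?thesis
    using periodic_int[of f, OF assms] by simp
qed

lemma borel_integrable_unit: "integrable unit_measure g \<Longrightarrow> g \<in> borel_measurable borel"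
  using borel_measurable_integrable[of unit_measure g] by (simp add: measurable_cong_sets[OF sets_unit_measure refl])

lemma nn_integral_shift:
  fixes f :: "real \<Rightarrow> ennreal"
  assumes [measurable]: "f \<in> borel_measurable borel"
  shows "(\<integral>\<^sup>+x. f (x + c) \<partial>lborel) = (\<integral>\<^sup>+x. f x \<partial>lborel)"
  using nn_integral_real_affine[of f 1 c] by (simp add: add.commute)

text \<open>With k the floor of a, the window is cut at k + 1. The part beyond k + 1, moved back by
  one, fills the gap from k to a, and a last translation by the integer k leads to [0, 1).\<close>

lemma nn_integral_periodic:
  fixes f :: "real \<Rightarrow> ennreal"
  assumes [measurable]: "f \<in> borel_measurable borel" and per: "\<And>x. f (x + 1) = f x"
  shows "(\<integral>\<^sup>+x. f x * indicator {a..<a+1} x \<partial>lborel) = (\<integral>\<^sup>+x. f x \<partial>unit_measure)"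
proof -
  define k where "k = real_of_int \<lfloor>a\<rfloor>"
  have k: "k \<le> a" "a < k + 1" unfolding k_def by linarith+
  have "(\<integral>\<^sup>+x. f x * indicator {a..<a+1} x \<partial>lborel)
    = (\<integral>\<^sup>+x. f x * indicator {a..<k+1} x + f x * indicator {k+1..<a+1} x \<partial>lborel)"
    using k by (intro nn_integral_cong) (auto simp: indicator_def)
  also have "\<dots> = (\<integral>\<^sup>+x. f x * indicator {a..<k+1} x \<partial>lborel) + (\<integral>\<^sup>+x. f x * indicator {k+1..<a+1} x \<partial>lborel)"
    by (rule nn_integral_add) simp_all
  also have "(\<integral>\<^sup>+x. f x * indicator {k+1..<a+1} x \<partial>lborel) = (\<integral>\<^sup>+x. f (x + 1) * indicator {k+1..<a+1} (x + 1) \<partial>lborel)"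
    by (rule nn_integral_shift[symmetric]) simp
  also have "\<dots> = (\<integral>\<^sup>+x. f x * indicator {k..<a} x \<partial>lborel)"
    by (intro nn_integral_cong) (auto simp: indicator_def per)
  also have "(\<integral>\<^sup>+x. f x * indicator {a..<k+1} x \<partial>lborel) + \<dots>
    = (\<integral>\<^sup>+x. f x * indicator {a..<k+1} x + f x * indicator {k..<a} x \<partial>lborel)"
    by (rule nn_integral_add[symmetric]) simp_all
  also have "\<dots> = (\<integral>\<^sup>+x. f x * indicator {k..<k+1} x \<partial>lborel)"
    using k by (intro nn_integral_cong) (auto simp: indicator_def)
  also have "\<dots> = (\<integral>\<^sup>+x. f (x + k) * indicator {k..<k+1} (x + k) \<partial>lborel)"
    by (rule nn_integral_shift[symmetric]) simp
  also have "\<dots> = (\<integral>\<^sup>+x. f x * indicator {0..<1} x \<partial>lborel)"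
    using periodic_int[of f, OF per] by (intro nn_integral_cong) (auto simp: indicator_def k_def)
  also have "\<dots> = (\<integral>\<^sup>+x. f x \<partial>unit_measure)"
    by (simp add: nn_integral_unit)
  finally show ?thesis .
qed

section \<open>Substitution of lifts of degree one\<close>

definition circle_lift :: "(real \<Rightarrow> real) \<Rightarrow> (real \<Rightarrow> real) \<Rightarrow> bool"
  where "circle_lift \<Phi> \<Phi>' \<longleftrightarrow> (\<forall>x. (\<Phi> has_real_derivative \<Phi>' x) (at x)) \<and>
    continuous_on UNIV \<Phi>' \<and> (\<forall>x. \<Phi>' x > 0) \<and> (\<forall>x. \<Phi> (x + 1) = \<Phi> x + 1)"

lemma circle_liftD:
  assumes "circle_lift \<Phi> \<Phi>'"
  shows "(\<Phi> has_real_derivative \<Phi>' x) (at x)" "continuous_on UNIV \<Phi>'" "\<Phi>' x > 0"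
    "\<Phi> (x + 1) = \<Phi> x + 1" "continuous_on UNIV \<Phi>" "\<Phi> \<in> borel_measurable borel"
    "\<Phi>' \<in> borel_measurable borel" "\<Phi>' (x + 1) = \<Phi>' x"
proof -
  show d: "(\<Phi> has_real_derivative \<Phi>' x) (at x)" for x
    using assms by (simp add: circle_lift_def)
  show c: "continuous_on UNIV \<Phi>'" and p: "\<Phi> (x + 1) = \<Phi> x + 1" and "\<Phi>' x > 0" for x
    using assms by (simp_all add: circle_lift_def)
  show c': "continuous_on UNIV \<Phi>"
    by (meson DERIV_isCont continuous_at_imp_continuous_on d)
  show "\<Phi> \<in> borel_measurable borel" "\<Phi>' \<in> borel_measurable borel"
    using c c' by (auto intro: borel_measurable_continuous_onI)
  have "((\<lambda>x. \<Phi> (x + 1) - 1) has_real_derivative \<Phi>' (x + 1)) (at x)"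
    using d[of "x+1"] DERIV_shift[of \<Phi> "\<Phi>' (x+1)" x 1] by (auto intro!: derivative_eq_intros)
  then show "\<Phi>' (x + 1) = \<Phi>' x"
    using d[of x] p by (auto intro: DERIV_unique)
qed

text \<open>A lift of degree one carries one period onto the interval from \<Phi> 0 to \<Phi> 0 + 1,
  which is again one period; half-open and closed intervals differ by a null set. Translations are
  lifts in this sense, so the rule also yields the translation invariance of integrals over a
  period.\<close>

lemma nn_integral_circle_lift:
  assumes L: "circle_lift \<Phi> \<Phi>'"
    and [measurable]: "f \<in> borel_measurable borel" and per: "\<And>x. f (x + 1) = f x"
  shows "(\<integral>\<^sup>+x. f (\<Phi> x) * ennreal (\<Phi>' x) \<partial>unit_measure) = (\<integral>\<^sup>+x. f x \<partial>unit_measure)"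
proof -
  note [measurable] = circle_liftD(6,7)[OF L]
  have "(\<integral>\<^sup>+x. f (\<Phi> x) * ennreal (\<Phi>' x) \<partial>unit_measure)
      = (\<integral>\<^sup>+x. f (\<Phi> x) * ennreal (\<Phi>' x) * indicator {0..<1} x \<partial>lborel)"
    by (simp add: nn_integral_unit)
  also have "\<dots> = (\<integral>\<^sup>+x. f (\<Phi> x) * ennreal (\<Phi>' x) * indicator {0..1} x \<partial>lborel)"
  proof (rule nn_integral_cong_AE)
    show "AE x in lborel. f (\<Phi> x) * ennreal (\<Phi>' x) * indicator {0..<1} x = f (\<Phi> x) * ennreal (\<Phi>' x) * indicator {0..1} x"
      using AE_lborel_singleton[of "1::real"] by eventually_elim (auto simp: indicator_def)
  qed
  also have "\<dots> = (\<integral>\<^sup>+x. f x * indicator {\<Phi> 0..\<Phi> 1} x \<partial>lborel)"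
    using circle_liftD[OF L]
    by (intro nn_integral_substitution_aux[symmetric]) (auto intro: continuous_on_subset less_imp_le)
  also have "\<dots> = (\<integral>\<^sup>+x. f x * indicator {\<Phi> 0..<\<Phi> 0 + 1} x \<partial>lborel)"
  proof (rule nn_integral_cong_AE)
    show "AE x in lborel. f x * indicator {\<Phi> 0..\<Phi> 1} x = f x * indicator {\<Phi> 0..<\<Phi> 0 + 1} x"
      using AE_lborel_singleton[of "\<Phi> 1"] by eventually_elim (use circle_liftD(4)[OF L, of 0] in \<open>auto simp: indicator_def\<close>)
  qed
  finally show ?thesis
    by (simp add: nn_integral_periodic per)
qed

text \<open>Stated as an identity of measures, the substitution passes from nonnegative functions to
  Bochner integrals of all measurable functions, integrable or not. Taking \<open>frac\<close> makes
  \<Phi> a map of the period into itself.\<close>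

lemma distr_frac_circle_lift:
  assumes L: "circle_lift \<Phi> \<Phi>'"
  shows "distr (density unit_measure (\<lambda>x. ennreal (\<Phi>' x))) unit_measure (\<lambda>x. frac (\<Phi> x)) = unit_measure"
proof (rule measure_eqI)
  note [measurable] = circle_liftD(6,7)[OF L]
  have [measurable]: "frac \<in> borel_measurable (borel :: real measure)"
    unfolding frac_def by measurable
  fix A :: "real set"
  assume "A \<in> sets (distr (density unit_measure (\<lambda>x. ennreal (\<Phi>' x))) unit_measure (\<lambda>x. frac (\<Phi> x)))"
  then have A[measurable]: "A \<in> sets borel" by simp
  have "emeasure (distr (density unit_measure (\<lambda>x. ennreal (\<Phi>' x))) unit_measure (\<lambda>x. frac (\<Phi> x))) A
    = (\<integral>\<^sup>+x. indicator A x \<partial>distr (density unit_measure (\<lambda>x. ennreal (\<Phi>' x))) unit_measure (\<lambda>x. frac (\<Phi> x)))"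
    by simp
  also have "\<dots> = (\<integral>\<^sup>+x. indicator A (frac (\<Phi> x)) * ennreal (\<Phi>' x) \<partial>unit_measure)"
    by (subst nn_integral_distr, simp, simp, subst nn_integral_density) (simp_all add: mult.commute)
  also have "\<dots> = (\<integral>\<^sup>+x. indicator A (frac x) \<partial>unit_measure)"
    by (rule nn_integral_circle_lift[OF L]) (auto simp: frac_1_eq)
  also have "\<dots> = (\<integral>\<^sup>+x. indicator A x \<partial>unit_measure)"
    by (auto simp: nn_integral_unit indicator_def frac_eq intro!: nn_integral_cong)
  finally show "emeasure (distr (density unit_measure (\<lambda>x. ennreal (\<Phi>' x))) unit_measure (\<lambda>x. frac (\<Phi> x))) A
    = emeasure unit_measure A"
    by simp
qed simp

lemma integral_circle_lift:
  fixes f :: "real \<Rightarrow> 'a::{banach, second_countable_topology}"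
  assumes L: "circle_lift \<Phi> \<Phi>'" and [measurable]: "f \<in> borel_measurable borel"
    and per: "\<And>x. f (x + 1) = f x"
  shows "(\<integral>x. \<Phi>' x *\<^sub>R f (\<Phi> x) \<partial>unit_measure) = (\<integral>x. f x \<partial>unit_measure)"
proof -
  note [measurable] = circle_liftD(6,7)[OF L]
  have [measurable]: "frac \<in> borel_measurable (borel :: real measure)"
    unfolding frac_def by measurable
  note fr = periodic_frac[of f, OF per]
  show "(\<integral>x. \<Phi>' x *\<^sub>R f (\<Phi> x) \<partial>unit_measure) = (\<integral>x. f x \<partial>unit_measure)"
    by (subst (2) distr_frac_circle_lift[OF L, symmetric])
       (use circle_liftD(3)[OF L] in \<open>simp add: integral_distr integral_density fr less_imp_le\<close>)
qed

lemma circle_lift_translation: "circle_lift (\<lambda>x. x + c) (\<lambda>_. 1)"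
  by (auto simp: circle_lift_def intro!: derivative_eq_intros)

section \<open>Completeness of \<open>L\<^sup>2(\<real>/\<int>)\<close>\<close>

lemma square_integrableD [measurable_dest]:
  "square_integrable f \<Longrightarrow> f \<in> borel_measurable borel"
  by (simp add: square_integrable_def measurable_cong_sets[OF sets_circle_measure refl])

lemma square_integrable_rep_measurable [measurable]: "rep_L2 \<xi> \<in> borel_measurable borel"
  by (rule square_integrableD[OF square_integrable_rep])

lemma cinner_rep: "cinner \<xi> \<eta> = (\<integral>x. rep_L2 \<xi> x * cnj (rep_L2 \<eta> x) \<partial>circle_measure)"
  by (rule cinner.rep_eq)

lemma measurable_cnj [measurable]: "cnj \<in> borel_measurable borel"
  by (intro borel_measurable_continuous_onI continuous_intros)

lemma cinner_to_L2:
  assumes "square_integrable f" "square_integrable g"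
  shows "cinner (to_L2 f) (to_L2 g) = (\<integral>x. f x * cnj (g x) \<partial>circle_measure)"
  unfolding cinner_rep
proof (rule integral_cong_AE)
  note [measurable] = square_integrableD[OF assms(1)] square_integrableD[OF assms(2)]
  show "(\<lambda>x. f x * cnj (g x)) \<in> borel_measurable circle_measure" by measurable
  show "AE x in circle_measure. rep_L2 (to_L2 f) x * cnj (rep_L2 (to_L2 g) x) = f x * cnj (g x)"
    using rep_to_L2[OF assms(1)] rep_to_L2[OF assms(2)] by eventually_elim simp
qed measurable

section \<open>Linear structure, inner product and norm on classes of functions\<close>

lemma to_L2_cong_AE:
  "square_integrable f \<Longrightarrow> square_integrable g \<Longrightarrow> (AE x in circle_measure. f x = g x) \<Longrightarrow> to_L2 f = to_L2 g"
  by (simp add: to_L2_eq_iff)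

lemma to_L2_add:
  assumes "square_integrable f" "square_integrable g"
  shows "to_L2 f + to_L2 g = to_L2 (\<lambda>x. f x + g x)"
proof -
  have "to_L2 f + to_L2 g = to_L2 (\<lambda>x. rep_L2 (to_L2 f) x + rep_L2 (to_L2 g) x)"
    by (simp add: plus_L2_circle_def)
  also have "\<dots> = to_L2 (\<lambda>x. f x + g x)"
    using eventually_conj[OF rep_to_L2[OF assms(1)] rep_to_L2[OF assms(2)]]
    by (intro to_L2_cong_AE square_integrable_add assms square_integrable_rep) (auto elim: eventually_mono)
  finally show ?thesis .
qed

lemma to_L2_scale:
  assumes "square_integrable f"
  shows "c *\<^sub>C to_L2 f = to_L2 (\<lambda>x. c * f x)"
proof -
  have "c *\<^sub>C to_L2 f = to_L2 (\<lambda>x. c * rep_L2 (to_L2 f) x)"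
    by (simp add: scaleC_def)
  also have "\<dots> = to_L2 (\<lambda>x. c * f x)"
    using rep_to_L2[OF assms(1)]
    by (intro to_L2_cong_AE square_integrable_scale assms square_integrable_rep) (auto elim: eventually_mono)
  finally show ?thesis .
qed

lemma zero_eq_to_L2: "0 = to_L2 (\<lambda>_. 0)"
  by (simp add: zero_L2_circle_def)

lemma scaleC_add_right: "c *\<^sub>C (\<xi> + \<eta>) = c *\<^sub>C \<xi> + c *\<^sub>C \<eta>"
  by transfer (simp add: distrib_left square_integrable_add square_integrable_scale)

lemma scaleC_add_left: "(c + d) *\<^sub>C \<xi> = c *\<^sub>C \<xi> + d *\<^sub>C \<xi>"
  by transfer (simp add: distrib_right square_integrable_add square_integrable_scale)

lemma scaleC_scaleC [simp]: "c *\<^sub>C d *\<^sub>C \<xi> = (c * d) *\<^sub>C \<xi>"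
  by transfer (simp add: mult.assoc square_integrable_scale)

lemma scaleC_one [simp]: "1 *\<^sub>C \<xi> = \<xi>"
  by transfer auto

lemma scaleC_zero_left [simp]: "0 *\<^sub>C \<xi> = 0"
  by transfer (auto simp: square_integrable_zero)

lemma scaleC_zero_right [simp]: "c *\<^sub>C 0 = 0"
  by transfer (auto simp: square_integrable_zero)

lemma uminus_eq_scaleC: "- \<xi> = (-1) *\<^sub>C \<xi>"
  by (simp add: uminus_L2_circle_def)

lemma minus_eq_scaleC: "\<xi> - \<eta> = \<xi> + (-1) *\<^sub>C \<eta>"
  by (simp add: minus_L2_circle_def)

lemma scaleR_eq_scaleC: "r *\<^sub>R \<xi> = complex_of_real r *\<^sub>C \<xi>"
  by (simp add: scaleR_L2_circle_def)

lemma scaleC_diff_right: "c *\<^sub>C (\<xi> - \<eta>) = c *\<^sub>C \<xi> - c *\<^sub>C \<eta>"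
  by (simp add: minus_eq_scaleC scaleC_add_right mult.commute)

lemma scaleC_sum: "c *\<^sub>C (\<Sum>i\<in>A. f i) = (\<Sum>i\<in>A. c *\<^sub>C f i)"
  by (induction A rule: infinite_finite_induct) (auto simp: scaleC_add_right)

lemma to_L2_diff:
  assumes "square_integrable f" "square_integrable g"
  shows "to_L2 f - to_L2 g = to_L2 (\<lambda>x. f x - g x)" "square_integrable (\<lambda>x. f x - g x)"
proof -
  show "to_L2 f - to_L2 g = to_L2 (\<lambda>x. f x - g x)"
    unfolding minus_eq_scaleC using square_integrable_scale[OF assms(2), of "-1"] assms
    by (simp add: to_L2_scale to_L2_add)
  show "square_integrable (\<lambda>x. f x - g x)"
    using square_integrable_add[OF assms(1) square_integrable_scale[OF assms(2), of "-1"]] by simp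
qed

lemma square_integrable_sum:
  assumes "\<And>i. i \<in> A \<Longrightarrow> square_integrable (f i)"
  shows "square_integrable (\<lambda>x. \<Sum>i\<in>A. f i x)"
  using assms by (induction A rule: infinite_finite_induct) (auto simp: square_integrable_zero square_integrable_add)

lemma to_L2_sum:
  assumes "\<And>i. i \<in> A \<Longrightarrow> square_integrable (f i)"
  shows "to_L2 (\<lambda>x. \<Sum>i\<in>A. f i x) = (\<Sum>i\<in>A. to_L2 (f i))"
  using assms
proof (induction A rule: infinite_finite_induct)
  case (insert x F)
  then show ?case
    using to_L2_add[of "f x" "\<lambda>y. \<Sum>i\<in>F. f i y"] by (simp add: square_integrable_sum)
qed (auto simp: zero_eq_to_L2)

lemma cinner_add_right: "cinner \<zeta> (\<xi> + \<eta>) = cinner \<zeta> \<xi> + cinner \<zeta> \<eta>"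
  using cinner_add_left[of \<xi> \<eta> \<zeta>] by (subst (1 2 3) cinner_commute) simp

lemma cinner_scaleC_right: "cinner \<xi> (c *\<^sub>C \<eta>) = cnj c * cinner \<xi> \<eta>"
  using cinner_scaleC_left[of c \<eta> \<xi>] by (subst (1 2) cinner_commute) simp

lemma cinner_zero_left [simp]: "cinner 0 \<xi> = 0"
  using cinner_scaleC_left[of 0 0 \<xi>] by simp

lemma cinner_zero_right [simp]: "cinner \<xi> 0 = 0"
  using cinner_scaleC_right[of \<xi> 0 0] by simp

lemma cinner_diff_left: "cinner (\<xi> - \<eta>) \<zeta> = cinner \<xi> \<zeta> - cinner \<eta> \<zeta>"
  by (simp add: minus_eq_scaleC cinner_add_left cinner_scaleC_left)

lemma cinner_sum_left: "cinner (\<Sum>i\<in>A. f i) \<xi> = (\<Sum>i\<in>A. cinner (f i) \<xi>)"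
  by (induction A rule: infinite_finite_induct) (auto simp: cinner_add_left)

lemma cinner_sum_right: "cinner \<xi> (\<Sum>i\<in>A. f i) = (\<Sum>i\<in>A. cinner \<xi> (f i))"
  by (induction A rule: infinite_finite_induct) (auto simp: cinner_add_right)

lemma cinner_self_norm: "cinner \<xi> \<xi> = complex_of_real ((norm \<xi>)\<^sup>2)"
proof -
  have "(norm \<xi>)\<^sup>2 = Re (cinner \<xi> \<xi>)"
    using power2_norm_eq_inner[of \<xi>] by (simp add: inner_L2_circle_def)
  then show ?thesis by (simp add: cinner_self)
qed

lemma norm_scaleC [simp]: "norm (c *\<^sub>C \<xi>) = cmod c * norm \<xi>"
proof -
  have "complex_of_real ((norm (c *\<^sub>C \<xi>))\<^sup>2) = (c * cnj c) * complex_of_real ((norm \<xi>)\<^sup>2)"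
    unfolding cinner_self_norm[symmetric] by (simp add: cinner_scaleC_left cinner_scaleC_right mult_ac)
  also have "\<dots> = complex_of_real ((cmod c * norm \<xi>)\<^sup>2)"
    by (simp add: complex_norm_square[symmetric] power_mult_distrib)
  finally have "(norm (c *\<^sub>C \<xi>))\<^sup>2 = (cmod c * norm \<xi>)\<^sup>2"
    by (simp only: of_real_eq_iff)
  then show ?thesis
    by (simp add: power2_eq_iff_nonneg)
qed

text \<open>The Cauchy-Schwarz inequality for \<open>inner\<close> bounds only the real part of
  \<open>cinner\<close>. Multiplying \<xi> by the conjugate of the value turns the inner product
  into its squared modulus, which is real.\<close>

lemma cmod_cinner_le: "cmod (cinner \<xi> \<eta>) \<le> norm \<xi> * norm \<eta>"
proof (cases "cinner \<xi> \<eta> = 0")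
  case False
  define z where "z = cinner \<xi> \<eta>"
  have "cinner (cnj z *\<^sub>C \<xi>) \<eta> = complex_of_real ((cmod z)\<^sup>2)"
    unfolding cinner_scaleC_left complex_norm_square by (simp add: z_def mult.commute)
  then have "(cmod z)\<^sup>2 = inner (cnj z *\<^sub>C \<xi>) \<eta>"
    by (simp add: inner_L2_circle_def)
  also have "\<dots> \<le> cmod z * (norm \<xi> * norm \<eta>)"
    using norm_cauchy_schwarz[of "cnj z *\<^sub>C \<xi>" \<eta>] by simp
  finally show ?thesis
    using False by (simp add: power2_eq_square z_def)
qed simp

lemma norm_to_L2:
  assumes "square_integrable f"
  shows "(norm (to_L2 f))\<^sup>2 = (\<integral>x. (cmod (f x))\<^sup>2 \<partial>circle_measure)"
proof -
  have "complex_of_real ((norm (to_L2 f))\<^sup>2) = (\<integral>x. complex_of_real ((cmod (f x))\<^sup>2) \<partial>circle_measure)"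
    unfolding cinner_self_norm[symmetric] cinner_to_L2[OF assms assms]
    by (simp only: complex_norm_square)
  also have "\<dots> = complex_of_real (\<integral>x. (cmod (f x))\<^sup>2 \<partial>circle_measure)"
    by (rule integral_complex_of_real)
  finally show ?thesis
    by (simp only: of_real_eq_iff)
qed

lemma square_integrable_cmod:
  "square_integrable f \<Longrightarrow> square_integrable (\<lambda>x. complex_of_real (cmod (f x)))"
  by (auto simp: square_integrable_def)

lemma square_integrable_bounded:
  assumes [measurable]: "f \<in> borel_measurable borel" and "\<And>x. cmod (f x) \<le> C"
  shows "square_integrable f"
  unfolding square_integrable_def
proof
  show "integrable circle_measure (\<lambda>x. (cmod (f x))\<^sup>2)"
    by (rule circ.integrable_const_bound[of _ "C\<^sup>2"]) (auto intro!: power_mono assms)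
qed simp

lemma square_integrable_bounded_mult:
  assumes [measurable]: "w \<in> borel_measurable borel" and w: "\<And>x. cmod (w x) \<le> C"
    and f: "square_integrable f"
  shows "square_integrable (\<lambda>x. w x * f x)" "norm (to_L2 (\<lambda>x. w x * f x)) \<le> C * norm (to_L2 f)"
proof -
  note [measurable] = square_integrableD[OF f]
  have i: "integrable circle_measure (\<lambda>x. C\<^sup>2 * (cmod (f x))\<^sup>2)"
    using f by (auto simp: square_integrable_def)
  have C: "C \<ge> 0"
    using order_trans[OF norm_ge_zero w] .
  have le: "(cmod (w x * f x))\<^sup>2 \<le> C\<^sup>2 * (cmod (f x))\<^sup>2" for x
    unfolding norm_mult power_mult_distrib by (intro mult_right_mono power_mono w) auto
  show s: "square_integrable (\<lambda>x. w x * f x)"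
    unfolding square_integrable_def
  proof
    show "integrable circle_measure (\<lambda>x. (cmod (w x * f x))\<^sup>2)"
      by (rule Bochner_Integration.integrable_bound[OF i]) (use le in auto)
  qed measurable
  have "(norm (to_L2 (\<lambda>x. w x * f x)))\<^sup>2 \<le> (\<integral>x. C\<^sup>2 * (cmod (f x))\<^sup>2 \<partial>circle_measure)"
    unfolding norm_to_L2[OF s]
    by (rule integral_mono) (use s i le in \<open>auto simp: square_integrable_def\<close>)
  also have "\<dots> = (C * norm (to_L2 f))\<^sup>2"
    by (simp add: norm_to_L2[OF f] power_mult_distrib)
  finally show "norm (to_L2 (\<lambda>x. w x * f x)) \<le> C * norm (to_L2 f)"
    using C by (simp add: power2_le_iff_abs_le)
qed

text \<open>Cauchy-Schwarz against the constant 1, whose norm is 1 because the circle has mass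
  one.\<close>

lemma integral_cmod_le_norm:
  assumes f: "square_integrable f"
  shows "integrable circle_measure f" "(\<integral>x. cmod (f x) \<partial>circle_measure) \<le> norm (to_L2 f)"
proof -
  have one: "square_integrable (\<lambda>_. 1)"
    by (rule square_integrable_bounded[of _ 1]) auto
  show "integrable circle_measure f"
    using square_integrable_mult[OF f one] by simp
  have "norm (to_L2 (\<lambda>_. 1::complex))^2 = 1"
    by (simp add: norm_to_L2[OF one])
  then have n1: "norm (to_L2 (\<lambda>_. 1::complex)) = 1"
    by (subst power2_eq_iff_nonneg[symmetric]) auto
  have nf: "norm (to_L2 (\<lambda>x. complex_of_real (cmod (f x)))) = norm (to_L2 f)"
    using norm_to_L2[OF square_integrable_cmod[OF f]] norm_to_L2[OF f]
    by (subst power2_eq_iff_nonneg[symmetric]) auto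
  have "complex_of_real (\<integral>x. cmod (f x) \<partial>circle_measure)
      = cinner (to_L2 (\<lambda>x. complex_of_real (cmod (f x)))) (to_L2 (\<lambda>_. 1))"
    by (simp add: cinner_to_L2[OF square_integrable_cmod[OF f] one])
  then have "cmod (complex_of_real (\<integral>x. cmod (f x) \<partial>circle_measure)) \<le> norm (to_L2 f)"
    using cmod_cinner_le[of "to_L2 (\<lambda>x. complex_of_real (cmod (f x)))" "to_L2 (\<lambda>_. 1)"] by (simp add: n1 nf)
  then show "(\<integral>x. cmod (f x) \<partial>circle_measure) \<le> norm (to_L2 f)"
    by simp
qed

lemma integral_cmod_mult_le:
  assumes f: "square_integrable f" and g: "square_integrable g"
  shows "(\<integral>x. cmod (f x) * cmod (g x) \<partial>circle_measure) \<le> norm (to_L2 f) * norm (to_L2 g)"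
proof -
  have nf: "norm (to_L2 (\<lambda>x. complex_of_real (cmod (f x)))) = norm (to_L2 f)" if "square_integrable f" for f
    using norm_to_L2[OF square_integrable_cmod[OF that]] norm_to_L2[OF that]
    by (subst power2_eq_iff_nonneg[symmetric]) auto
  have "complex_of_real (\<integral>x. cmod (f x) * cmod (g x) \<partial>circle_measure)
      = cinner (to_L2 (\<lambda>x. complex_of_real (cmod (f x)))) (to_L2 (\<lambda>x. complex_of_real (cmod (g x))))"
    unfolding cinner_to_L2[OF square_integrable_cmod[OF f] square_integrable_cmod[OF g]]
    by (simp flip: of_real_mult)
  then have "cmod (complex_of_real (\<integral>x. cmod (f x) * cmod (g x) \<partial>circle_measure)) \<le> norm (to_L2 f) * norm (to_L2 g)"
    using cmod_cinner_le[of "to_L2 (\<lambda>x. complex_of_real (cmod (f x)))" "to_L2 (\<lambda>x. complex_of_real (cmod (g x)))"]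
    by (simp add: nf f g)
  then show ?thesis
    unfolding norm_of_real by linarith
qed

lemma dist_to_L2:
  "dist \<xi> \<eta> = norm (to_L2 (\<lambda>x. rep_L2 \<xi> x - rep_L2 \<eta> x))"
  using to_L2_diff(1)[OF square_integrable_rep square_integrable_rep, of \<xi> \<eta>]
  by (simp add: dist_norm)

text \<open>The Riesz-Fischer argument. A subsequence \<open>Y\<close> whose distances decay
  geometrically has increments with summable L^1 norms, since on a space of mass one these are at
  most the L^2 norms; hence it converges almost everywhere, and the Cauchy sequence follows it.
  Completeness later produces vectors from prescribed Fourier coefficients, and the limits that
  define the bounded extension of a commutator.\<close>

instance L2_circle :: complete_space
proof
  fix X :: "nat \<Rightarrow> L2_circle"
  assume "Cauchy X"
  then have "\<exists>N. \<forall>m\<ge>N. \<forall>n\<ge>N. dist (X m) (X n) < (1/2)^k" for k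
    by (auto simp: Cauchy_def)
  then obtain N where N: "\<And>k m n. m \<ge> N k \<Longrightarrow> n \<ge> N k \<Longrightarrow> dist (X m) (X n) < (1/2)^k"
    by metis
  define Y where "Y k = X (N k)" for k
  define f where "f k = rep_L2 (Y k)" for k
  have [measurable]: "f k \<in> borel_measurable borel" for k
    by (simp add: f_def)
  have sq: "square_integrable (\<lambda>x. f j x - f k x)" for j k
    unfolding f_def by (rule to_L2_diff(2)[OF square_integrable_rep square_integrable_rep])
  have Y: "dist (Y j) (Y k) \<le> 2 * (1/2)^k" if "k \<le> j" for j k
  proof -
    define m where "m = max (N j) (N k)"
    have "dist (Y j) (X m) < (1/2)^j" "dist (X m) (Y k) < (1/2)^k"
      by (auto simp: Y_def m_def intro!: N)
    moreover have "(1/2::real)^j \<le> (1/2)^k"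
      using that by (intro power_decreasing) auto
    ultimately show ?thesis
      using dist_triangle[of "Y j" "Y k" "X m"] by linarith
  qed
  have norm_sq: "norm (to_L2 (\<lambda>x. f j x - f k x)) \<le> 2 * (1/2)^k" if "k \<le> j" for j k
    using Y[OF that] by (simp add: dist_to_L2 f_def)
  have "(\<integral>\<^sup>+x. (\<Sum>k. ennreal (cmod (f (Suc k) x - f k x))) \<partial>circle_measure)
      = (\<Sum>k. \<integral>\<^sup>+x. ennreal (cmod (f (Suc k) x - f k x)) \<partial>circle_measure)"
    by (rule nn_integral_suminf) measurable
  also have "\<dots> \<le> (\<Sum>k. ennreal (2 * (1/2)^k))"
  proof (intro suminf_le summableI)
    fix k
    have "(\<integral>\<^sup>+x. ennreal (cmod (f (Suc k) x - f k x)) \<partial>circle_measure)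
        = ennreal (\<integral>x. cmod (f (Suc k) x - f k x) \<partial>circle_measure)"
      by (intro nn_integral_eq_integral integrable_norm integral_cmod_le_norm(1)[OF sq]) simp
    then show "(\<integral>\<^sup>+x. ennreal (cmod (f (Suc k) x - f k x)) \<partial>circle_measure) \<le> ennreal (2 * (1/2)^k)"
      using order_trans[OF integral_cmod_le_norm(2)[OF sq] norm_sq[of k "Suc k"]] by (simp add: ennreal_leI)
  qed
  also have "\<dots> = ennreal (\<Sum>k. 2 * (1/2)^k)"
    by (rule suminf_ennreal2) (auto intro!: summable_mult summable_geometric)
  also have "\<dots> < \<infinity>" by simp
  finally have fin: "(\<integral>\<^sup>+x. (\<Sum>k. ennreal (cmod (f (Suc k) x - f k x))) \<partial>circle_measure) \<noteq> \<infinity>"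
    by simp
  have "AE x in circle_measure. (\<Sum>k. ennreal (cmod (f (Suc k) x - f k x))) \<noteq> \<infinity>"
    by (rule nn_integral_noteq_infinite[OF _ fin]) measurable
  \<comment> \<open>Where the sequence diverges, \<open>lim\<close> has an unspecified value; this
    happens only on a null set, and \<open>F\<close> is measurable on the whole circle.\<close>
  define F where "F x = lim (\<lambda>k. f k x)" for x
  have [measurable]: "F \<in> borel_measurable borel"
    unfolding F_def by (rule borel_measurable_lim_metric) simp
  have AEF: "AE x in circle_measure. (\<lambda>k. f k x) \<longlonglongrightarrow> F x"
    using \<open>AE x in circle_measure. (\<Sum>k. ennreal (cmod (f (Suc k) x - f k x))) \<noteq> \<infinity>\<close>
  proof eventually_elim
    case (elim x)
    then have "summable (\<lambda>k. cmod (f (Suc k) x - f k x))"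
      by (intro summable_suminf_not_top) auto
    then have "summable (\<lambda>k. f (Suc k) x - f k x)"
      by (rule summable_norm_cancel)
    then have "(\<lambda>n. \<Sum>k<n. (f (Suc k) x - f k x)) \<longlonglongrightarrow> (\<Sum>k. (f (Suc k) x - f k x))"
      by (rule summable_LIMSEQ)
    then have "(\<lambda>n. f n x - f 0 x) \<longlonglongrightarrow> (\<Sum>k. (f (Suc k) x - f k x))"
      by (simp only: sum_lessThan_telescope[of "\<lambda>k. f k x" for x])
    then have "(\<lambda>n. (f n x - f 0 x) + f 0 x) \<longlonglongrightarrow> (\<Sum>k. (f (Suc k) x - f k x)) + f 0 x"
      by (intro tendsto_intros)
    then show ?case
      unfolding F_def by (auto intro: convergentI simp: convergent_LIMSEQ_iff[symmetric])
  qed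
  \<comment> \<open>Fatou's lemma for j tending to infinity with k fixed: the bound on the distance
    from \<open>f j\<close> to \<open>f k\<close> survives in the pointwise limit.\<close>
  have bound: "(\<integral>\<^sup>+x. ennreal ((cmod (F x - f k x))\<^sup>2) \<partial>circle_measure) \<le> ennreal ((2 * (1/2)^k)\<^sup>2)" for k
  proof -
    have "(\<integral>\<^sup>+x. ennreal ((cmod (F x - f k x))\<^sup>2) \<partial>circle_measure)
        = (\<integral>\<^sup>+x. liminf (\<lambda>j. ennreal ((cmod (f j x - f k x))\<^sup>2)) \<partial>circle_measure)"
      using AEF
    proof (intro nn_integral_cong_AE, eventually_elim)
      case (elim x)
      have "(\<lambda>j. ennreal ((cmod (f j x - f k x))\<^sup>2)) \<longlonglongrightarrow> ennreal ((cmod (F x - f k x))\<^sup>2)"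
        by (intro tendsto_intros elim)
      from lim_imp_Liminf[OF _ this] show ?case by simp
    qed
    also have "\<dots> \<le> liminf (\<lambda>j. \<integral>\<^sup>+x. ennreal ((cmod (f j x - f k x))\<^sup>2) \<partial>circle_measure)"
      by (rule nn_integral_liminf) measurable
    also have "\<dots> \<le> limsup (\<lambda>j. \<integral>\<^sup>+x. ennreal ((cmod (f j x - f k x))\<^sup>2) \<partial>circle_measure)"
      by (rule Liminf_le_Limsup) simp
    also have "\<dots> \<le> ennreal ((2 * (1/2)^k)\<^sup>2)"
    proof (rule Limsup_bounded, rule eventually_sequentiallyI[of k])
      fix j assume "k \<le> j"
      have "(\<integral>\<^sup>+x. ennreal ((cmod (f j x - f k x))\<^sup>2) \<partial>circle_measure)
          = ennreal (\<integral>x. (cmod (f j x - f k x))\<^sup>2 \<partial>circle_measure)"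
        using sq[of j k] by (intro nn_integral_eq_integral) (auto simp: square_integrable_def)
      also have "\<dots> = ennreal ((norm (to_L2 (\<lambda>x. f j x - f k x)))\<^sup>2)"
        by (simp add: norm_to_L2[OF sq])
      also have "\<dots> \<le> ennreal ((2 * (1/2)^k)\<^sup>2)"
        by (intro ennreal_leI power_mono norm_sq \<open>k \<le> j\<close>) auto
      finally show "(\<integral>\<^sup>+x. ennreal ((cmod (f j x - f k x))\<^sup>2) \<partial>circle_measure) \<le> ennreal ((2 * (1/2)^k)\<^sup>2)" .
    qed
    finally show ?thesis .
  qed
  have sqF: "square_integrable (\<lambda>x. F x - f k x)" for k
    unfolding square_integrable_def
  proof
    show "integrable circle_measure (\<lambda>x. (cmod (F x - f k x))\<^sup>2)"
      using le_less_trans[OF bound[of k]] by (intro integrableI_bounded) auto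
  qed measurable
  then have "square_integrable (\<lambda>x. (F x - f 0 x) + f 0 x)"
    by (intro square_integrable_add) (auto simp: f_def square_integrable_rep)
  then have F: "square_integrable F" by simp
  define \<xi> where "\<xi> = to_L2 F"
  have dist: "dist (Y k) \<xi> \<le> 2 * (1/2)^k" for k
  proof -
    have "ennreal ((norm (to_L2 (\<lambda>x. F x - f k x)))\<^sup>2) = (\<integral>\<^sup>+x. ennreal ((cmod (F x - f k x))\<^sup>2) \<partial>circle_measure)"
      unfolding norm_to_L2[OF sqF] using sqF[of k]
      by (intro nn_integral_eq_integral[symmetric]) (auto simp: square_integrable_def)
    with bound[of k] have "ennreal ((norm (to_L2 (\<lambda>x. F x - f k x)))\<^sup>2) \<le> ennreal ((2 * (1/2)^k)\<^sup>2)"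
      by (simp only:)
    then have "(norm (to_L2 (\<lambda>x. F x - f k x)))\<^sup>2 \<le> (2 * (1/2)^k)\<^sup>2"
      by (subst (asm) ennreal_le_iff) auto
    then have "norm (to_L2 (\<lambda>x. F x - f k x)) \<le> 2 * (1/2)^k"
      by (rule power2_le_imp_le) simp
    moreover have "\<xi> - Y k = to_L2 (\<lambda>x. F x - f k x)"
      using to_L2_diff(1)[OF F square_integrable_rep[of "Y k"]] by (simp add: \<xi>_def f_def)
    ultimately show ?thesis
      by (simp add: dist_commute dist_norm)
  qed
  have "X \<longlonglongrightarrow> \<xi>"
    unfolding LIMSEQ_def
  proof (intro allI impI)
    fix e :: real assume "e > 0"
    then obtain k where k: "(1/2::real)^k < e/3"
      using real_arch_pow_inv[of "e/3" "1/2"] by auto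
    have "dist (X n) \<xi> < e" if "n \<ge> N k" for n
      using dist_triangle[of "X n" \<xi> "Y k"] dist[of k] N[of k n "N k"] that k by (simp add: Y_def)
    then show "\<exists>no. \<forall>n\<ge>no. dist (X n) \<xi> < e" by blast
  qed
  then show "convergent X" by (rule convergentI)
qed

section \<open>Uniqueness of Fourier coefficients\<close>

definition fexp :: "int \<Rightarrow> real \<Rightarrow> complex"
  where "fexp n t = cis (2 * pi * of_int n * t)"

lemma norm_fexp [simp]: "cmod (fexp n t) = 1"
  by (simp add: fexp_def)

lemma fexp_0 [simp]: "fexp 0 t = 1" "fexp n 0 = 1"
  by (simp_all add: fexp_def)

lemma fexp_add: "fexp (m + n) t = fexp m t * fexp n t"
  by (simp add: fexp_def cis_mult algebra_simps)

lemma fexp_add_right: "fexp n (s + t) = fexp n s * fexp n t"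
  by (simp add: fexp_def cis_mult algebra_simps)

lemma fexp_int [simp]: "fexp n (of_int k) = 1"
  using cis_multiple_2pi[of "of_int (n * k)"] by (simp add: fexp_def mult_ac)

lemma fexp_1 [simp]: "fexp n 1 = 1"
  using fexp_int[of n 1] by simp

lemma fexp_periodic: "fexp n (t + 1) = fexp n t"
  by (simp add: fexp_add_right)

lemma cnj_fexp: "cnj (fexp n t) = fexp (- n) t"
  by (simp add: fexp_def cis_cnj)

lemma continuous_fexp [continuous_intros]:
  "continuous_on S f \<Longrightarrow> continuous_on S (\<lambda>x. fexp n (f x))"
  unfolding fexp_def cis_conv_exp by (intro continuous_intros)

lemma measurable_fexp [measurable]: "fexp n \<in> borel_measurable borel"
  by (intro borel_measurable_continuous_onI continuous_intros)

lemma fexp_has_vector_derivative: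
  "(fexp n has_vector_derivative 2 * pi * \<i> * of_int n * fexp n t) (at t within S)"
proof -
  have "((\<lambda>t. exp (2 * pi * \<i> * of_int n * of_real t)) has_vector_derivative
      2 * pi * \<i> * of_int n * exp (2 * pi * \<i> * of_int n * of_real t)) (at t within S)"
  proof -
    have "((\<lambda>z. exp (2 * pi * \<i> * of_int n * z)) has_field_derivative
      2 * pi * \<i> * of_int n * exp (2 * pi * \<i> * of_int n * of_real t)) (at (of_real t))"
      by (auto intro!: derivative_eq_intros)
    from has_vector_derivative_real_field[OF this] show ?thesis .
  qed
  moreover have "fexp n = (\<lambda>t. exp (2 * pi * \<i> * of_int n * of_real t))"
    by (auto simp: fexp_def cis_conv_exp mult_ac)
  ultimately show ?thesis by simp
qed

lemma AE_unit: "AE t in unit_measure. 0 \<le> t \<and> t < 1"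
  unfolding unit_measure_def by (subst AE_density) (auto simp: indicator_def)

lemma AE_unit_not_eq: "AE t in unit_measure. t \<noteq> c"
  unfolding unit_measure_def using AE_lborel_singleton[of c]
  by (subst AE_density) (auto elim: eventually_mono)

lemma integrable_unit_bounded:
  fixes f :: "real \<Rightarrow> 'a::{banach, second_countable_topology}"
  assumes [measurable]: "f \<in> borel_measurable borel" and "\<And>t. 0 \<le> t \<Longrightarrow> t < 1 \<Longrightarrow> norm (f t) \<le> C"
  shows "integrable unit_measure f"
proof (rule unit.integrable_const_bound[of _ C])
  show "AE t in unit_measure. norm (f t) \<le> C"
    using AE_unit by (rule eventually_mono) (simp add: assms)
qed simp

lemma integrable_unit_mult_bounded:
  fixes f :: "real \<Rightarrow> complex"
  assumes "integrable unit_measure f" and [measurable]: "g \<in> borel_measurable borel" and "\<And>t. cmod (g t) \<le> C"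
  shows "integrable unit_measure (\<lambda>t. f t * g t)"
proof (rule Bochner_Integration.integrable_bound)
  show "integrable unit_measure (\<lambda>t. C * cmod (f t))"
    using assms by auto
  have [measurable]: "f \<in> borel_measurable unit_measure"
    using assms by simp
  show "(\<lambda>t. f t * g t) \<in> borel_measurable unit_measure" by measurable
  have "cmod (f t * g t) \<le> \<bar>C * cmod (f t)\<bar>" for t
  proof -
    have "cmod (f t * g t) \<le> cmod (f t) * C"
      unfolding norm_mult by (intro mult_left_mono assms) auto
    then show ?thesis by (simp add: mult.commute)
  qed
  then show "AE t in unit_measure. cmod (f t * g t) \<le> norm (C * cmod (f t))"
    by simp
qed

lemma integrable_unit_continuous:
  fixes f :: "real \<Rightarrow> complex"
  assumes "continuous_on UNIV f"
  shows "integrable unit_measure f"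
proof -
  have "compact (f ` {0..1})"
    by (intro compact_continuous_image continuous_on_subset[OF assms]) auto
  then obtain C where "\<And>t. t \<in> {0..1} \<Longrightarrow> cmod (f t) \<le> C"
    by (metis bounded_iff compact_imp_bounded imageI)
  then show ?thesis
    by (intro integrable_unit_bounded[of _ C] borel_measurable_continuous_onI assms) auto
qed

lemma integral_fexp: "(\<integral>t. fexp n t \<partial>unit_measure) = (if n = 0 then 1 else 0)"
proof (cases "n = 0")
  case False
  \<comment> \<open>Half a wavelength of \<open>fexp n\<close>: translating by it changes the sign
    of the character, so the integral equals its own negative.\<close>
  define c where "c = 1 / (2 * real_of_int n)"
  have "fexp n c = -1"
    using False by (simp add: fexp_def c_def)
  have "(\<integral>t. fexp n t \<partial>unit_measure) = (\<integral>t. fexp n (t + c) \<partial>unit_measure)"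
    using integral_circle_lift[OF circle_lift_translation[of c], of "fexp n"] by (simp add: fexp_periodic)
  also have "\<dots> = - (\<integral>t. fexp n t \<partial>unit_measure)"
    by (simp add: fexp_add_right \<open>fexp n c = -1\<close>)
  finally show ?thesis using False by simp
qed simp

text \<open>\<open>dirac\<close> is defined with the gauge integral, Fourier coefficients with the
  Lebesgue integral over \<open>unit_measure\<close>. The two agree up to and including b = 1, since
  the endpoint left out by \<open>unit_measure\<close> is a null set.\<close>

lemma unit_integral_has_integral:
  fixes g :: "real \<Rightarrow> complex"
  assumes g: "integrable unit_measure g" and ab: "0 \<le> a" "b \<le> 1"
  shows "(g has_integral (\<integral>t. indicator {a..b} t *\<^sub>R g t \<partial>unit_measure)) {a..b}"
proof -
  note [measurable] = borel_integrable_unit[OF g]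
  have i0: "integrable unit_measure (\<lambda>t. indicator {a..b} t *\<^sub>R g t)"
    using g by (intro integrable_mult_indicator) auto
  have u: "unit_measure = density lborel (\<lambda>t. ennreal (indicator {0..<1} t))"
    by (simp add: unit_measure_def ennreal_indicator)
  have eq: "(\<integral>t. indicator {a..b} t *\<^sub>R g t \<partial>unit_measure)
     = (\<integral>t. indicator {0..<1} t *\<^sub>R indicator {a..b} t *\<^sub>R g t \<partial>lborel)"
    unfolding u by (rule integral_density) auto
  have int: "integrable lborel (\<lambda>t. indicator {0..<1} t *\<^sub>R indicator {a..b} t *\<^sub>R g t)"
    using i0 unfolding u by (subst (asm) integrable_density) auto
  have ae: "AE t in lborel. indicator {0..<1} t *\<^sub>R indicator {a..b} t *\<^sub>R g t = indicator {a..b} t *\<^sub>R g t"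
    using AE_lborel_singleton[of "1::real"] by eventually_elim (use ab in \<open>auto simp: indicator_def\<close>)
  have int': "integrable lborel (\<lambda>t. indicator {a..b} t *\<^sub>R g t)"
    using int ae by (subst (asm) integrable_cong_AE) auto
  have eq': "(\<integral>t. indicator {0..<1} t *\<^sub>R indicator {a..b} t *\<^sub>R g t \<partial>lborel) = (\<integral>t. indicator {a..b} t *\<^sub>R g t \<partial>lborel)"
    using ae by (intro integral_cong_AE) auto
  have "((\<lambda>t. indicator {a..b} t *\<^sub>R g t) has_integral (\<integral>t. indicator {a..b} t *\<^sub>R g t \<partial>lborel)) UNIV"
    by (rule has_integral_integral_lborel[OF int'])
  moreover have "(\<lambda>t. indicator {a..b} t *\<^sub>R g t) = (\<lambda>t. if t \<in> {a..b} then g t else 0)"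
    by (auto simp: indicator_def)
  ultimately show ?thesis
    unfolding eq eq' by (simp only: has_integral_restrict_UNIV)
qed

lemma fexp_integral_from:
  assumes "n \<noteq> 0" "0 \<le> t" "t < 1"
  shows "(\<integral>x. indicator {t..} x *\<^sub>R fexp n x \<partial>unit_measure) = (1 - fexp n t) / (2 * pi * \<i> * of_int n)"
proof -
  have "(\<integral>x. indicator {t..} x *\<^sub>R fexp n x \<partial>unit_measure) = (\<integral>x. indicator {t..1} x *\<^sub>R fexp n x \<partial>unit_measure)"
    by (intro integral_cong_AE eventually_mono[OF AE_unit]) (auto simp: indicator_def)
  moreover have "(fexp n has_integral (\<integral>x. indicator {t..1} x *\<^sub>R fexp n x \<partial>unit_measure)) {t..1}"
    using assms by (intro unit_integral_has_integral integrable_unit_continuous continuous_intros) auto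
  moreover have "((\<lambda>x. (2 * pi * \<i> * of_int n * fexp n x) / (2 * pi * \<i> * of_int n)) has_integral
      fexp n 1 / (2 * pi * \<i> * of_int n) - fexp n t / (2 * pi * \<i> * of_int n)) {t..1}"
    using assms by (intro fundamental_theorem_of_calculus has_vector_derivative_divide fexp_has_vector_derivative) auto
  then have "(fexp n has_integral (1 - fexp n t) / (2 * pi * \<i> * of_int n)) {t..1}"
    using assms by (simp add: diff_divide_distrib)
  ultimately show ?thesis
    using has_integral_unique by metis
qed

interpretation unit_pair: pair_sigma_finite unit_measure unit_measure ..

text \<open>Dominated convergence: as the upper limit tends to x, the indicators converge at every t
  except t = x, which is a null set.\<close>

lemma continuous_antiderivative:
  fixes h :: "real \<Rightarrow> complex"
  assumes h: "integrable unit_measure h"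
  shows "continuous_on UNIV (\<lambda>x. \<integral>t. indicator {..x} t *\<^sub>R h t \<partial>unit_measure)"
proof (rule continuous_at_imp_continuous_on, rule ballI)
  note [measurable] = borel_integrable_unit[OF h]
  fix x :: real
  show "isCont (\<lambda>x. \<integral>t. indicator {..x} t *\<^sub>R h t \<partial>unit_measure) x"
    unfolding continuous_at_sequentially o_def
  proof (intro allI impI)
    fix u :: "nat \<Rightarrow> real" assume u: "u \<longlonglongrightarrow> x"
    show "(\<lambda>n. \<integral>t. indicator {..u n} t *\<^sub>R h t \<partial>unit_measure) \<longlonglongrightarrow> (\<integral>t. indicator {..x} t *\<^sub>R h t \<partial>unit_measure)"
    proof (rule integral_dominated_convergence[where w="\<lambda>t. norm (h t)"])
      show "AE t in unit_measure. (\<lambda>n. indicator {..u n} t *\<^sub>R h t) \<longlonglongrightarrow> indicator {..x} t *\<^sub>R h t"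
        using AE_unit_not_eq[of x]
      proof eventually_elim
        case (elim t)
        have "eventually (\<lambda>n. indicator {..u n} t *\<^sub>R h t = indicator {..x} t *\<^sub>R h t) sequentially"
        proof (cases "t < x")
          case True
          then show ?thesis
            using order_tendstoD(1)[OF u True] by (auto elim!: eventually_mono)
        next
          case False
          then have "x < t" using elim by simp
          from order_tendstoD(2)[OF u this] this show ?thesis
            by (auto elim!: eventually_mono)
        qed
        then show ?case by (rule tendsto_eventually)
      qed
    qed (use h in \<open>auto simp: indicator_def\<close>)
  qed
qed

text \<open>Fubini's theorem replaces integration by parts, as the antiderivative is differentiable only
  almost everywhere.\<close>

lemma integral_antiderivative_fexp:
  fixes h :: "real \<Rightarrow> complex"
  assumes h: "integrable unit_measure h" and n: "n \<noteq> 0"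
  shows "(\<integral>x. (\<integral>t. indicator {..x} t *\<^sub>R h t \<partial>unit_measure) * fexp n x \<partial>unit_measure)
    = ((\<integral>t. h t \<partial>unit_measure) - (\<integral>t. h t * fexp n t \<partial>unit_measure)) / (2 * pi * \<i> * of_int n)"
proof -
  note [measurable] = borel_integrable_unit[OF h]
  \<comment> \<open>The integrand on the triangle t \<le> x. Integrating over t first gives the
    left-hand side, over x first the elementary integral of the character from t to 1.\<close>
  define K where "K = (\<lambda>t x. h t * (indicator {t..} x *\<^sub>R fexp n x))"
  have ind: "indicator {..x} t = (indicator {t..} x :: real)" for x t :: real
    by (auto simp: indicator_def)
  have Kle: "cmod (K t x) \<le> cmod (h t)" for t x
    by (simp add: K_def norm_mult indicator_def)
  have indK: "indicator {t..} x = (if t \<le> x then 1 else 0 :: real)" for t x :: real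
    by (auto simp: indicator_def)
  have [measurable]: "case_prod K \<in> borel_measurable (unit_measure \<Otimes>\<^sub>M unit_measure)"
    unfolding K_def indK case_prod_unfold by measurable
  have i1: "integrable unit_measure (K t)" for t
    by (rule unit.integrable_const_bound[of _ "cmod (h t)"]) (use Kle in auto)
  have "integrable (unit_measure \<Otimes>\<^sub>M unit_measure) (case_prod K)"
  proof (rule unit_pair.Fubini_integrable)
    show "integrable unit_measure (\<lambda>t. \<integral>x. norm (case_prod K (t, x)) \<partial>unit_measure)"
    proof (rule Bochner_Integration.integrable_bound[OF integrable_norm[OF h]])
      show "(\<lambda>t. \<integral>x. norm (case_prod K (t, x)) \<partial>unit_measure) \<in> borel_measurable unit_measure"
        by measurable
      have "(\<integral>x. cmod (K t x) \<partial>unit_measure) \<le> (\<integral>x. cmod (h t) \<partial>unit_measure)" for t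
        by (intro integral_mono integrable_norm i1) (use Kle in auto)
      then show "AE t in unit_measure. norm (\<integral>x. norm (case_prod K (t, x)) \<partial>unit_measure) \<le> norm (cmod (h t))"
        by simp
    qed
  qed (use i1 in auto)
  from unit_pair.Fubini_integral[OF this]
  have "(\<integral>x. \<integral>t. K t x \<partial>unit_measure \<partial>unit_measure) = (\<integral>t. \<integral>x. K t x \<partial>unit_measure \<partial>unit_measure)" .
  also have "(\<lambda>x. \<integral>t. K t x \<partial>unit_measure) = (\<lambda>x. (\<integral>t. indicator {..x} t *\<^sub>R h t \<partial>unit_measure) * fexp n x)"
  proof
    fix x
    have "(\<integral>t. K t x \<partial>unit_measure) = (\<integral>t. (indicator {..x} t *\<^sub>R h t) * fexp n x \<partial>unit_measure)"
      unfolding K_def ind by (intro Bochner_Integration.integral_cong) auto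
    also have "\<dots> = (\<integral>t. indicator {..x} t *\<^sub>R h t \<partial>unit_measure) * fexp n x"
      by (rule integral_mult_left_zero)
    finally show "(\<integral>t. K t x \<partial>unit_measure) = (\<integral>t. indicator {..x} t *\<^sub>R h t \<partial>unit_measure) * fexp n x" .
  qed
  also have "(\<integral>t. \<integral>x. K t x \<partial>unit_measure \<partial>unit_measure)
      = (\<integral>t. (h t - h t * fexp n t) / (2 * pi * \<i> * of_int n) \<partial>unit_measure)"
  proof (rule integral_cong_AE)
    show "AE t in unit_measure. (\<integral>x. K t x \<partial>unit_measure) = (h t - h t * fexp n t) / (2 * pi * \<i> * of_int n)"
      using AE_unit
    proof eventually_elim
      case (elim t)
      have "(\<integral>x. K t x \<partial>unit_measure) = h t * (\<integral>x. indicator {t..} x *\<^sub>R fexp n x \<partial>unit_measure)"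
        unfolding K_def by (rule integral_mult_right_zero)
      then show ?case
        using fexp_integral_from[OF n, of t] elim by (simp add: algebra_simps)
    qed
    show "(\<lambda>t. \<integral>x. K t x \<partial>unit_measure) \<in> borel_measurable unit_measure"
      by measurable
  qed measurable
  also have "\<dots> = ((\<integral>t. h t \<partial>unit_measure) - (\<integral>t. h t * fexp n t \<partial>unit_measure)) / (2 * pi * \<i> * of_int n)"
    using h integrable_unit_mult_bounded[OF h measurable_fexp, of n 1] by simp
  finally show ?thesis .
qed

text \<open>The finite measures with densities u^+ and u^- have equal distribution functions, hence
  are equal, hence their densities agree almost everywhere. But u^+ = u^- forces u = 0.\<close>

lemma real_integral_initial_zero_imp_AE:
  fixes u :: "real \<Rightarrow> real"
  assumes u: "integrable unit_measure u"
    and z: "\<And>x. (\<integral>t. indicator {..x} t *\<^sub>R u t \<partial>unit_measure) = 0"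
  shows "AE t in unit_measure. u t = 0"
proof -
  note [measurable] = borel_integrable_unit[OF u]
  define M where "M v = density unit_measure (\<lambda>t. ennreal (max (v t) 0))" for v :: "real \<Rightarrow> real"
  have em: "emeasure (M v) A = ennreal (\<integral>t. indicator A t *\<^sub>R max (v t) 0 \<partial>unit_measure)"
    if "integrable unit_measure v" and [measurable]: "A \<in> sets borel" for v A
  proof -
    note [measurable] = borel_integrable_unit[OF that(1)]
    have i: "integrable unit_measure (\<lambda>t. indicator A t *\<^sub>R max (v t) 0)"
      using that by (intro integrable_mult_indicator integrable_max) auto
    have "emeasure (M v) A = (\<integral>\<^sup>+t. ennreal (max (v t) 0) * indicator A t \<partial>unit_measure)"
      unfolding M_def by (rule emeasure_density) auto
    also have "\<dots> = (\<integral>\<^sup>+t. ennreal (indicator A t *\<^sub>R max (v t) 0) \<partial>unit_measure)"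
      by (intro nn_integral_cong) (auto simp: indicator_def)
    also have "\<dots> = ennreal (\<integral>t. indicator A t *\<^sub>R max (v t) 0 \<partial>unit_measure)"
      by (rule nn_integral_eq_integral[OF i]) auto
    finally show ?thesis .
  qed
  have u': "integrable unit_measure (\<lambda>t. - u t)" using u by simp
  have fin: "finite_borel_measure (M v)" if "integrable unit_measure v" for v
  proof (intro finite_borel_measure.intro finite_borel_measure_axioms.intro finite_measureI)
    show "emeasure (M v) (space (M v)) \<noteq> \<infinity>"
      using em[OF that, of UNIV] by (simp add: M_def)
    show "sets (M v) = sets borel" by (simp add: M_def)
  qed
  have "M u = M (\<lambda>t. - u t)"
  proof (rule cdf_unique'[OF fin[OF u] fin[OF u']], rule ext)
    fix x
    have "(\<integral>t. indicator {..x} t *\<^sub>R max (u t) 0 \<partial>unit_measure) - (\<integral>t. indicator {..x} t *\<^sub>R max (- u t) 0 \<partial>unit_measure)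
      = (\<integral>t. indicator {..x} t *\<^sub>R max (u t) 0 - indicator {..x} t *\<^sub>R max (- u t) 0 \<partial>unit_measure)"
      using u u' by (intro Bochner_Integration.integral_diff[symmetric] integrable_mult_indicator integrable_max) auto
    also have "\<dots> = (\<integral>t. indicator {..x} t *\<^sub>R u t \<partial>unit_measure)"
      by (intro Bochner_Integration.integral_cong) (auto simp: indicator_def)
    finally show "cdf (M u) x = cdf (M (\<lambda>t. - u t)) x"
      unfolding cdf_def measure_def using z em[OF u, of "{..x}"] em[OF u', of "{..x}"] by simp
  qed
  then have "AE t in unit_measure. ennreal (max (u t) 0) = ennreal (max (- u t) 0)"
    unfolding M_def by (intro unit.density_unique) auto
  then show ?thesis
  proof eventually_elim
    case (elim t)
    then have "max (u t) 0 = max (- u t) 0"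
      by (subst (asm) ennreal_inj) auto
    then show ?case by linarith
  qed
qed

lemma integral_initial_zero_imp_AE:
  fixes h :: "real \<Rightarrow> complex"
  assumes h: "integrable unit_measure h"
    and z: "\<And>x. (\<integral>t. indicator {..x} t *\<^sub>R h t \<partial>unit_measure) = 0"
  shows "AE t in unit_measure. h t = 0"
proof -
  have i: "integrable unit_measure (\<lambda>t. indicator {..x} t *\<^sub>R h t)" for x
    using h by (intro integrable_mult_indicator) auto
  have "AE t in unit_measure. Re (h t) = 0"
    using h z integral_Re[OF i, symmetric]
    by (intro real_integral_initial_zero_imp_AE) (auto simp: scaleR_conv_of_real)
  moreover have "AE t in unit_measure. Im (h t) = 0"
    using h z integral_Im[OF i, symmetric]
    by (intro real_integral_initial_zero_imp_AE) (auto simp: scaleR_conv_of_real)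
  ultimately show ?thesis
    by eventually_elim (simp add: complex_eq_iff)
qed

section \<open>Continuous functions orthogonal to all characters\<close>

definition no_coeffs :: "(real \<Rightarrow> complex) \<Rightarrow> bool"
  where "no_coeffs G \<longleftrightarrow> continuous_on UNIV G \<and> (\<forall>n. (\<integral>t. G t * fexp n t \<partial>unit_measure) = 0)"

lemma no_coeffs_add:
  assumes "no_coeffs F" "no_coeffs G"
  shows "no_coeffs (\<lambda>t. F t + G t)"
proof -
  have "integrable unit_measure (\<lambda>t. F t * fexp n t)" "integrable unit_measure (\<lambda>t. G t * fexp n t)" for n
    using assms by (auto simp: no_coeffs_def intro!: integrable_unit_continuous continuous_intros)
  then show ?thesis
    using assms by (auto simp: no_coeffs_def distrib_right intro!: continuous_intros)
qed

text \<open>On the unit circle a real linear function of z is a combination of z and its conjugate,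
  and multiplying by either only shifts the Fourier coefficients by one place. \<open>G\<close> is
  kept arbitrary in the induction so that a product is handled by multiplying with its factors one
  after the other.\<close>

lemma no_coeffs_mult_polynomial:
  assumes "real_polynomial_function p"
  shows "no_coeffs G \<Longrightarrow> no_coeffs (\<lambda>t. G t * of_real (p (fexp 1 t)))"
  using assms
proof (induction p arbitrary: G rule: real_polynomial_function.induct)
  case (linear f)
  then interpret f: bounded_linear f by simp
  have cont: "continuous_on UNIV G" and z: "(\<integral>t. G t * fexp n t \<partial>unit_measure) = 0" for n
    using linear by (auto simp: no_coeffs_def)
  \<comment> \<open>From f(x + iy) = x f(1) + y f(i), with x = (z + cnj z)/2 and y = (z - cnj
    z)/(2i); the conjugate of \<open>fexp 1 t\<close> is \<open>fexp (-1) t\<close>.\<close>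
  define \<alpha> where "\<alpha> = (of_real (f 1) - \<i> * of_real (f \<i>)) / 2"
  define \<beta> where "\<beta> = (of_real (f 1) + \<i> * of_real (f \<i>)) / 2"
  have eq: "of_real (f (fexp 1 t)) = \<alpha> * fexp 1 t + \<beta> * fexp (-1) t" for t
  proof -
    have "fexp 1 t = cos (2*pi*t) *\<^sub>R 1 + sin (2*pi*t) *\<^sub>R \<i>"
      by (auto simp: fexp_def complex_eq_iff)
    then have "f (fexp 1 t) = cos (2*pi*t) * f 1 + sin (2*pi*t) * f \<i>"
      by (metis f.add f.scaleR real_scaleR_def)
    then show ?thesis
      by (simp add: \<alpha>_def \<beta>_def fexp_def complex_eq_iff field_simps)
  qed
  have "G t * of_real (f (fexp 1 t)) * fexp n t = \<alpha> * (G t * fexp (n+1) t) + \<beta> * (G t * fexp (n-1) t)" for t n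
    unfolding eq using fexp_add[of n 1 t] fexp_add[of n "-1" t] by (simp add: algebra_simps)
  moreover have "integrable unit_measure (\<lambda>t. G t * fexp n t)" for n
    by (intro integrable_unit_continuous continuous_intros cont)
  ultimately have "(\<integral>t. G t * of_real (f (fexp 1 t)) * fexp n t \<partial>unit_measure) = 0" for n
    by (simp add: z)
  moreover have "continuous_on UNIV (\<lambda>t. f (fexp 1 t))"
    by (intro f.continuous_on continuous_intros)
  ultimately show ?case
    using cont by (auto simp: no_coeffs_def intro!: continuous_intros)
next
  case (const c)
  have "(\<integral>t. G t * of_real c * fexp n t \<partial>unit_measure) = of_real c * (\<integral>t. G t * fexp n t \<partial>unit_measure)" for n
    by (subst integral_mult_right_zero[symmetric]) (simp add: mult_ac)
  with const show ?case
    by (auto simp: no_coeffs_def intro!: continuous_intros)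
next
  case (add f g)
  then have *: "no_coeffs (\<lambda>t. G t * of_real (f (fexp 1 t)))" "no_coeffs (\<lambda>t. G t * of_real (g (fexp 1 t)))"
    by auto
  from no_coeffs_add[OF this] show ?case
    by (simp add: distrib_left)
next
  case (mult f g)
  then have "no_coeffs (\<lambda>t. G t * of_real (f (fexp 1 t)) * of_real (g (fexp 1 t)))"
    by blast
  then show ?case by (simp add: mult_ac)
qed

text \<open>A continuous surjection from a compact space onto a Hausdorff space is a quotient map.
  Applied to the interval wrapped around the circle, this makes \<open>g\<close> continuous,
  including at 1, where \<open>Arg2pi\<close> jumps.\<close>

lemma continuous_fexp_factor:
  fixes G :: "real \<Rightarrow> complex"
  assumes cont: "continuous_on UNIV G" and G01: "G 0 = G 1"
  obtains g where "continuous_on (sphere 0 1) g" "\<And>t. 0 \<le> t \<Longrightarrow> t \<le> 1 \<Longrightarrow> g (fexp 1 t) = G t"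
proof
  define g where "g z = G (Arg2pi z / (2 * pi))" for z
  have geq: "g (fexp 1 t) = G t" if "0 \<le> t" "t \<le> 1" for t
  proof (cases "t = 1")
    case True
    then show ?thesis
      using G01 Arg2pi_of_real[of 1] by (simp add: g_def)
  next
    case False
    then have "Arg2pi (fexp 1 t) = 2 * pi * t"
      using that by (intro Arg2pi_unique[of 1]) (auto simp: fexp_def cis_conv_exp)
    then show ?thesis by (simp add: g_def)
  qed
  then show "\<And>t. 0 \<le> t \<Longrightarrow> t \<le> 1 \<Longrightarrow> g (fexp 1 t) = G t" .
  have im: "fexp 1 ` {0..1} = sphere 0 1"
  proof
    show "fexp 1 ` {0..1} \<subseteq> sphere 0 1" by auto
    show "sphere 0 1 \<subseteq> fexp 1 ` {0..1}"
    proof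
      fix z :: complex assume "z \<in> sphere 0 1"
      then have "z = fexp 1 (Arg2pi z / (2*pi))"
        using Arg2pi_eq[of z] by (simp add: fexp_def cis_conv_exp)
      moreover have "Arg2pi z / (2*pi) \<in> {0..1}"
        using Arg2pi[of z] by (auto simp: field_simps)
      ultimately show "z \<in> fexp 1 ` {0..1}" by blast
    qed
  qed
  have q: "quotient_map (top_of_set {0..1::real}) (top_of_set (sphere 0 1)) (fexp 1)"
    by (rule continuous_imp_quotient_map)
       (use im in \<open>auto simp: compact_space_subtopology Hausdorff_space_subtopology intro!: continuous_intros\<close>)
  have "continuous_map (top_of_set (sphere 0 1)) euclidean g"
  proof (rule continuous_compose_quotient_map[OF q])
    have "continuous_on {0..1} (g \<circ> fexp 1)"
      by (rule continuous_on_eq[OF continuous_on_subset[OF cont]]) (use geq in auto)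
    then show "continuous_map (top_of_set {0..1}) euclidean (g \<circ> fexp 1)"
      by simp
  qed
  then show "continuous_on (sphere 0 1) g" by simp
qed

text \<open>By the Stone-Weierstrass theorem, G is uniformly within e of a polynomial P in z and its
  conjugate. G is orthogonal to P, so the integral of |G|^2 equals that of G times the conjugate of
  G - P, which is at most e times the integral of |G|.\<close>

lemma no_coeffs_imp_zero:
  assumes G: "no_coeffs G" and G01: "G 0 = G 1" and t: "0 \<le> t" "t \<le> 1"
  shows "G t = 0"
proof -
  have cont: "continuous_on UNIV G" using G by (simp add: no_coeffs_def)
  obtain g where g: "continuous_on (sphere 0 1) g" "\<And>t. 0 \<le> t \<Longrightarrow> t \<le> 1 \<Longrightarrow> g (fexp 1 t) = G t"
    using continuous_fexp_factor[OF cont G01] by blast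
  define I where "I = (\<integral>t. (cmod (G t))\<^sup>2 \<partial>unit_measure)"
  define J where "J = (\<integral>t. cmod (G t) \<partial>unit_measure)"
  have iG: "integrable unit_measure (\<lambda>t. cmod (G t))"
    by (intro integrable_norm integrable_unit_continuous cont)
  have le: "I \<le> e * J" if "e > 0" for e
  proof -
    obtain p where p: "polynomial_function p" "\<And>x. x \<in> sphere 0 1 \<Longrightarrow> cmod (g x - p x) < e"
      using Stone_Weierstrass_polynomial_function[OF _ g(1) \<open>e > 0\<close>] by auto
    define P where "P t = p (fexp 1 t)" for t
    have Pclose: "cmod (G t - P t) < e" if "0 \<le> t" "t \<le> 1" for t
      using p(2)[of "fexp 1 t"] g(2)[OF that] by (simp add: P_def)
    have "real_polynomial_function (Re \<circ> p)" "real_polynomial_function (Im \<circ> p)"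
      using p(1) bounded_linear_Re bounded_linear_Im by (auto simp: polynomial_function_def)
    from this[THEN no_coeffs_mult_polynomial, OF G]
    have nc: "no_coeffs (\<lambda>t. G t * of_real (Re (P t)))" "no_coeffs (\<lambda>t. G t * of_real (Im (P t)))"
      by (simp_all add: P_def)
    then have z: "(\<integral>t. G t * of_real (Re (P t)) \<partial>unit_measure) = 0" "(\<integral>t. G t * of_real (Im (P t)) \<partial>unit_measure) = 0"
      and i: "integrable unit_measure (\<lambda>t. G t * of_real (Re (P t)))" "integrable unit_measure (\<lambda>t. G t * of_real (Im (P t)))"
      unfolding no_coeffs_def by (auto intro: integrable_unit_continuous dest: spec[of _ 0])
    have cnjP: "G t * cnj (P t) = G t * of_real (Re (P t)) - \<i> * (G t * of_real (Im (P t)))" for t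
      by (simp add: complex_eq_iff algebra_simps)
    have iP: "integrable unit_measure (\<lambda>t. G t * cnj (P t))" "(\<integral>t. G t * cnj (P t) \<partial>unit_measure) = 0"
      unfolding cnjP using i z by auto
    have iGG: "integrable unit_measure (\<lambda>t. G t * cnj (G t))"
      by (intro integrable_unit_continuous continuous_intros cont)
    have "complex_of_real I = (\<integral>t. G t * cnj (G t) \<partial>unit_measure)"
      unfolding I_def integral_complex_of_real[symmetric] by (simp only: complex_norm_square)
    also have "\<dots> = (\<integral>t. G t * cnj (G t) - G t * cnj (P t) \<partial>unit_measure)"
      using iP iGG by simp
    finally have "\<bar>I\<bar> = cmod (\<integral>t. G t * cnj (G t) - G t * cnj (P t) \<partial>unit_measure)"
      by (metis norm_of_real)
    also have "\<dots> \<le> (\<integral>t. cmod (G t * cnj (G t) - G t * cnj (P t)) \<partial>unit_measure)"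
      by (rule integral_norm_bound)
    also have "\<dots> \<le> (\<integral>t. e * cmod (G t) \<partial>unit_measure)"
    proof (rule integral_mono_AE)
      show "AE t in unit_measure. cmod (G t * cnj (G t) - G t * cnj (P t)) \<le> e * cmod (G t)"
        using AE_unit
      proof eventually_elim
        case (elim t)
        have "cmod (G t * cnj (G t) - G t * cnj (P t)) = cmod (G t) * cmod (G t - P t)"
          by (metis complex_cnj_diff complex_mod_cnj norm_mult right_diff_distrib)
        also have "\<dots> \<le> cmod (G t) * e"
          using Pclose[of t] elim by (intro mult_left_mono) auto
        finally show ?case by (simp add: mult.commute)
      qed
    qed (use iP iGG iG in auto)
    finally show ?thesis by (simp add: J_def)
  qed
  have "I \<le> 0"
  proof (rule field_le_epsilon)
    fix e :: real assume e: "e > 0"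
    have J: "J \<ge> 0" by (simp add: J_def)
    \<comment> \<open>The denominator J + 1 also covers J = 0.\<close>
    have "I \<le> e / (J + 1) * J" using le[of "e / (J + 1)"] e J by simp
    also have "\<dots> \<le> e" using e J by (simp add: field_simps)
    finally show "I \<le> 0 + e" by simp
  qed
  moreover have "I \<ge> 0" by (simp add: I_def)
  ultimately have I0: "I = 0" by simp
  have iG2: "integrable unit_measure (\<lambda>t. complex_of_real ((cmod (G t))\<^sup>2))"
    by (intro integrable_unit_continuous continuous_intros cont)
  have "(\<integral>t. indicator {0..1} t *\<^sub>R complex_of_real ((cmod (G t))\<^sup>2) \<partial>unit_measure)
      = (\<integral>t. complex_of_real ((cmod (G t))\<^sup>2) \<partial>unit_measure)"
  proof (rule integral_cong_AE)
    have [measurable]: "G \<in> borel_measurable borel"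
      by (rule borel_measurable_continuous_onI[OF cont])
    show "(\<lambda>t. complex_of_real ((cmod (G t))\<^sup>2)) \<in> borel_measurable unit_measure"
      "(\<lambda>t. indicator {0..1} t *\<^sub>R complex_of_real ((cmod (G t))\<^sup>2)) \<in> borel_measurable unit_measure"
      by measurable
    show "AE t in unit_measure. indicator {0..1} t *\<^sub>R complex_of_real ((cmod (G t))\<^sup>2) = complex_of_real ((cmod (G t))\<^sup>2)"
      using AE_unit by eventually_elim (auto simp: indicator_def)
  qed
  also have "\<dots> = 0"
    using I0 by (simp add: I_def del: of_real_power)
  finally have "((\<lambda>t. complex_of_real ((cmod (G t))\<^sup>2)) has_integral 0) {0..1}"
    using unit_integral_has_integral[OF iG2, of 0 1] by simp
  from has_integral_linear[OF this bounded_linear_Re]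
  have "((\<lambda>t. (cmod (G t))\<^sup>2) has_integral 0) (cbox 0 1)"
    by (simp add: o_def)
  then have "(cmod (G t))\<^sup>2 = 0"
    by (rule has_integral_0_cbox_imp_0[rotated 2])
       (use t in \<open>auto intro!: continuous_intros continuous_on_subset[OF cont]\<close>)
  then show ?thesis by simp
qed

text \<open>Weierstrass approximation reaches continuous functions only, so h is replaced by its
  antiderivative H. The vanishing mean of h makes H take the same value 0 at both ends of the
  period, and integration by parts makes the nonzero coefficients of H vanish. Thus H is constant,
  hence 0, and h is recovered from its initial integrals.\<close>

lemma zero_coeffs_imp_AE_zero:
  assumes h: "integrable unit_measure h" and z: "\<And>n. (\<integral>t. h t * fexp n t \<partial>unit_measure) = 0"
  shows "AE t in unit_measure. h t = 0"
proof -
  note [measurable] = borel_integrable_unit[OF h]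
  define H where "H x = (\<integral>t. indicator {..x} t *\<^sub>R h t \<partial>unit_measure)" for x
  have contH: "continuous_on UNIV H"
    using continuous_antiderivative[OF h] by (simp add: H_def[abs_def])
  have Hge: "H x = 0" if "x \<ge> 1" for x
  proof -
    have "H x = (\<integral>t. h t \<partial>unit_measure)"
      unfolding H_def using that by (intro integral_cong_AE eventually_mono[OF AE_unit]) (auto simp: indicator_def)
    then show ?thesis using z[of 0] by simp
  qed
  have Hle: "H x = 0" if "x \<le> 0" for x
  proof -
    have "H x = (\<integral>t. 0 \<partial>unit_measure)"
      unfolding H_def using that
      by (intro integral_cong_AE eventually_mono[OF eventually_conj[OF AE_unit AE_unit_not_eq[of 0]]])
         (auto simp: indicator_def)
    then show ?thesis by simp
  qed
  \<comment> \<open>Integration by parts says nothing about the zeroth coefficient; subtracting the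
    mean removes it.\<close>
  define c where "c = (\<integral>x. H x \<partial>unit_measure)"
  have iH: "integrable unit_measure (\<lambda>t. H t * fexp n t)" for n
    by (intro integrable_unit_continuous continuous_intros contH)
  have nc: "no_coeffs (\<lambda>x. H x - c)"
    unfolding no_coeffs_def
  proof (intro conjI allI)
    show "continuous_on UNIV (\<lambda>x. H x - c)" by (intro continuous_intros contH)
    fix n
    have "(\<integral>t. (H t - c) * fexp n t \<partial>unit_measure) = (\<integral>t. H t * fexp n t \<partial>unit_measure) - (\<integral>t. c * fexp n t \<partial>unit_measure)"
      unfolding left_diff_distrib
      by (intro Bochner_Integration.integral_diff iH integrable_unit_continuous continuous_intros)
    also have "\<dots> = 0"
    proof (cases "n = 0")
      case True
      then show ?thesis by (simp add: c_def)
    next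
      case False
      then show ?thesis
        using integral_antiderivative_fexp[OF h False] z[of n] z[of 0] by (simp add: H_def integral_fexp)
    qed
    finally show "(\<integral>t. (H t - c) * fexp n t \<partial>unit_measure) = 0" .
  qed
  have Hc: "H x = c" if "0 \<le> x" "x \<le> 1" for x
    using no_coeffs_imp_zero[OF nc _ that] Hge[of 1] Hle[of 0] by simp
  have "H x = 0" for x
    using Hge[of x] Hle[of x] Hc[of x] Hc[of 0] Hle[of 0] by (cases "x \<le> 0"; cases "x \<ge> 1") auto
  then show ?thesis
    by (intro integral_initial_zero_imp_AE h) (simp add: H_def)
qed

section \<open>Fourier expansions\<close>

lemma continuous_on_circle_iff:
  fixes f :: "circle \<Rightarrow> 'a::topological_space"
  shows "continuous_on UNIV f \<longleftrightarrow> continuous_on UNIV (\<lambda>t. f (to_circle t))"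
proof
  assume "continuous_on UNIV f"
  then show "continuous_on UNIV (\<lambda>t. f (to_circle t))"
    using continuous_on_compose2[OF _ continuous_to_circle] by auto
next
  assume "continuous_on UNIV (\<lambda>t. f (to_circle t))"
  then show "continuous_on UNIV f"
    by (auto simp: continuous_on_open_vimage open_circle_def vimage_def)
qed

lemma circle_cases: obtains t where "p = to_circle t" "0 \<le> t" "t < 1"
proof
  show "p = to_circle (frac (rep_circle p))" by simp
qed (auto simp: frac_lt_1)

lemma continuous_circle_bounded:
  fixes f :: "circle \<Rightarrow> 'a::real_normed_vector"
  assumes "continuous_on UNIV f"
  obtains C where "\<And>p. norm (f p) \<le> C"
proof -
  have c: "continuous_on UNIV (\<lambda>t. f (to_circle t))"
    using assms by (simp add: continuous_on_circle_iff)
  have "compact ((\<lambda>t. f (to_circle t)) ` {0..1})"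
    by (intro compact_continuous_image continuous_on_subset[OF c]) auto
  then obtain C where C: "\<And>t. t \<in> {0..1} \<Longrightarrow> norm (f (to_circle t)) \<le> C"
    by (metis (mono_tags, lifting) bounded_iff compact_imp_bounded imageI)
  have "norm (f p) \<le> C" for p
    by (cases p rule: circle_cases) (use C in auto)
  then show ?thesis using that by blast
qed

lemma square_integrable_continuous:
  assumes "continuous_on UNIV f"
  shows "square_integrable f"
  using continuous_circle_bounded[OF assms] borel_measurable_continuous_onI[OF assms]
  by (metis square_integrable_bounded)

definition ce :: "int \<Rightarrow> circle \<Rightarrow> complex"
  where "ce n p = fexp n (rep_circle p)"

lemma ce_to_circle [simp]: "ce n (to_circle t) = fexp n t"
  unfolding ce_def by (rule periodic_rep) (rule fexp_periodic)

lemma continuous_ce: "continuous_on UNIV (ce n)"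
  by (simp add: continuous_on_circle_iff continuous_fexp)

lemma measurable_ce [measurable]: "ce n \<in> borel_measurable borel"
  by (rule borel_measurable_continuous_onI[OF continuous_ce])

lemma square_integrable_ce: "square_integrable (ce n)"
  by (rule square_integrable_continuous[OF continuous_ce])

lemma norm_ce [simp]: "cmod (ce n p) = 1"
  by (simp add: ce_def)

definition ee :: "int \<Rightarrow> L2_circle"
  where "ee n = to_L2 (ce n)"

definition fc :: "L2_circle \<Rightarrow> int \<Rightarrow> complex"
  where "fc \<xi> n = cinner \<xi> (ee n)"

lemma cinner_to_L2_unit:
  assumes "square_integrable f" "square_integrable g"
  shows "cinner (to_L2 f) (to_L2 g) = (\<integral>t. f (to_circle t) * cnj (g (to_circle t)) \<partial>unit_measure)"
proof -
  note [measurable] = square_integrableD[OF assms(1)] square_integrableD[OF assms(2)]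
  show ?thesis
    unfolding cinner_to_L2[OF assms] by (rule circle_integral) measurable
qed

lemma fc_to_L2: "square_integrable f \<Longrightarrow> fc (to_L2 f) n = (\<integral>t. f (to_circle t) * fexp (- n) t \<partial>unit_measure)"
  unfolding fc_def ee_def by (simp add: cinner_to_L2_unit square_integrable_ce cnj_fexp)

lemma integrable_unit_square_integrable:
  assumes f: "square_integrable f"
  shows "integrable unit_measure (\<lambda>t. f (to_circle t))"
  using integral_cmod_le_norm(1)[OF f] circle_integrable[OF square_integrableD[OF f]] by simp

lemma fc_ee: "fc (ee m) n = (if m = n then 1 else 0)"
  unfolding ee_def fc_to_L2[OF square_integrable_ce]
  using integral_fexp[of "m - n"] fexp_add[of m "-n"] by simp

lemma norm_ee [simp]: "norm (ee n) = 1"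
proof -
  have "complex_of_real ((norm (ee n))\<^sup>2) = 1"
    using fc_ee[of n n] by (simp only: cinner_self_norm[symmetric] fc_def) simp
  then have "(norm (ee n))\<^sup>2 = 1"
    by (simp only: of_real_eq_1_iff)
  then show ?thesis
    by (simp add: power2_eq_1_iff) (use norm_ge_zero[of "ee n"] in linarith)
qed

lemma fc_add: "fc (\<xi> + \<eta>) n = fc \<xi> n + fc \<eta> n"
  and fc_diff: "fc (\<xi> - \<eta>) n = fc \<xi> n - fc \<eta> n"
  and fc_scaleC: "fc (c *\<^sub>C \<xi>) n = c * fc \<xi> n"
  and fc_sum: "fc (\<Sum>i\<in>A. f i) n = (\<Sum>i\<in>A. fc (f i) n)"
  and fc_zero [simp]: "fc 0 n = 0"
  by (simp_all add: fc_def cinner_add_left cinner_diff_left cinner_scaleC_left cinner_sum_left)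

lemma cmod_fc_le: "cmod (fc \<xi> n) \<le> norm \<xi>"
  using cmod_cinner_le[of \<xi> "ee n"] by (simp add: fc_def)

lemma cinner_ee_left: "cinner (ee n) \<xi> = cnj (fc \<xi> n)"
  unfolding fc_def by (rule cinner_commute)

lemma tendsto_cinner_left:
  assumes "(X \<longlongrightarrow> \<xi>) F"
  shows "((\<lambda>x. cinner (X x) \<eta>) \<longlongrightarrow> cinner \<xi> \<eta>) F"
proof -
  have "((\<lambda>x. norm (X x - \<xi>) * norm \<eta>) \<longlongrightarrow> 0) F"
    using tendsto_mult_left_zero[OF tendsto_norm_zero[OF LIM_zero[OF assms]]] by simp
  then have "((\<lambda>x. cinner (X x) \<eta> - cinner \<xi> \<eta>) \<longlongrightarrow> 0) F"
    by (rule Lim_null_comparison[rotated]) (use cmod_cinner_le in \<open>auto simp: cinner_diff_left[symmetric]\<close>)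
  then show ?thesis by (rule LIM_zero_cancel)
qed

lemma tendsto_fc: "(X \<longlongrightarrow> \<xi>) F \<Longrightarrow> ((\<lambda>x. fc (X x) n) \<longlongrightarrow> fc \<xi> n) F"
  unfolding fc_def by (rule tendsto_cinner_left)

lemma fc_all_zero_imp_zero:
  assumes "\<And>n. fc \<xi> n = 0"
  shows "\<xi> = 0"
proof -
  have sq: "square_integrable (rep_L2 \<xi>)" by (rule square_integrable_rep)
  have "AE t in unit_measure. rep_L2 \<xi> (to_circle t) = 0"
  proof (rule zero_coeffs_imp_AE_zero)
    show "integrable unit_measure (\<lambda>t. rep_L2 \<xi> (to_circle t))"
      by (rule integrable_unit_square_integrable[OF sq])
    show "(\<integral>t. rep_L2 \<xi> (to_circle t) * fexp n t \<partial>unit_measure) = 0" for n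
      using assms[of "-n"] fc_to_L2[OF sq, of "-n"] by simp
  qed
  then have "AE p in circle_measure. rep_L2 \<xi> p = 0"
    unfolding circle_measure_eq_distr by (subst AE_distr_iff) auto
  then have "to_L2 (rep_L2 \<xi>) = to_L2 (\<lambda>_. 0)"
    by (intro to_L2_cong_AE sq square_integrable_zero)
  then show ?thesis by (simp add: zero_eq_to_L2)
qed

lemma fc_eqI: "(\<And>n. fc \<xi> n = fc \<eta> n) \<Longrightarrow> \<xi> = \<eta>"
  using fc_all_zero_imp_zero[of "\<xi> - \<eta>"] by (simp add: fc_diff)

section \<open>Trigonometric polynomials, Bessel's inequality and Fourier series\<close>

definition trig :: "int set \<Rightarrow> (int \<Rightarrow> complex) \<Rightarrow> L2_circle"
  where "trig A c = (\<Sum>n\<in>A. c n *\<^sub>C ee n)"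

lemma fc_trig: "finite A \<Longrightarrow> fc (trig A c) n = (if n \<in> A then c n else 0)"
  by (simp add: trig_def fc_sum fc_scaleC fc_ee if_distrib cong: if_cong)

lemma cinner_trig_right: "cinner \<xi> (trig A c) = (\<Sum>n\<in>A. fc \<xi> n * cnj (c n))"
  by (simp add: trig_def cinner_sum_right cinner_scaleC_right fc_def mult.commute)

lemma norm_trig: "finite A \<Longrightarrow> (norm (trig A c))\<^sup>2 = (\<Sum>n\<in>A. (cmod (c n))\<^sup>2)"
proof -
  assume A: "finite A"
  have "complex_of_real ((norm (trig A c))\<^sup>2) = (\<Sum>n\<in>A. c n * cnj (c n))"
    unfolding cinner_self_norm[symmetric] cinner_trig_right by (intro sum.cong) (simp_all add: fc_trig A)
  also have "\<dots> = complex_of_real (\<Sum>n\<in>A. (cmod (c n))\<^sup>2)"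
    by (simp only: complex_norm_square of_real_sum)
  finally show ?thesis by (simp only: of_real_eq_iff)
qed

lemma trig_diff: "B \<subseteq> A \<Longrightarrow> finite A \<Longrightarrow> trig A c - trig B c = trig (A - B) c"
  by (simp add: trig_def sum_diff)

text \<open>The partial sum is the orthogonal projection of \<xi>: its squared norm equals its inner
  product with \<xi>, and Cauchy-Schwarz lets one factor cancel.\<close>

lemma norm_trig_fc_le:
  assumes "finite A"
  shows "norm (trig A (fc \<xi>)) \<le> norm \<xi>"
proof -
  have "complex_of_real ((norm (trig A (fc \<xi>)))\<^sup>2) = cinner \<xi> (trig A (fc \<xi>))"
    unfolding cinner_trig_right norm_trig[OF assms] of_real_sum
    by (intro sum.cong refl) (rule complex_norm_square)
  then have "(norm (trig A (fc \<xi>)))\<^sup>2 = cmod (cinner \<xi> (trig A (fc \<xi>)))"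
    by (metis abs_of_nonneg norm_of_real zero_le_power2)
  also have "\<dots> \<le> norm \<xi> * norm (trig A (fc \<xi>))"
    by (rule cmod_cinner_le)
  finally show ?thesis
    by (cases "trig A (fc \<xi>) = 0") (simp_all add: power2_eq_square)
qed

abbreviation symm :: "nat \<Rightarrow> int set"
  where "symm N \<equiv> {- int N..int N}"

text \<open>Differences of partial sums are again trigonometric polynomials, with squared norms
  equal to differences of the sums of squares. The latter are increasing and bounded, so the partial
  sums form a Cauchy sequence and completeness gives the vector.\<close>

lemma trig_convergent:
  assumes bound: "\<And>N. (\<Sum>n\<in>symm N. (cmod (c n))\<^sup>2) \<le> K"
  obtains \<xi> where "(\<lambda>N. trig (symm N) c) \<longlonglongrightarrow> \<xi>" "fc \<xi> = c"
proof -
  define s where "s N = (\<Sum>n\<in>symm N. (cmod (c n))\<^sup>2)" for N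
  have inc: "s M \<le> s N" if "M \<le> N" for M N
    unfolding s_def using that by (intro sum_mono2) auto
  have "convergent s"
  proof (rule Bseq_monoseq_convergent)
    show "Bseq s"
      using bound by (intro BseqI'[of _ K]) (simp add: s_def abs_of_nonneg sum_nonneg)
    show "monoseq s"
      using inc by (auto simp: monoseq_def)
  qed
  then have "Cauchy s" by (rule convergent_Cauchy)
  have d: "(dist (trig (symm N) c) (trig (symm M) c))\<^sup>2 = s N - s M" if "M \<le> N" for M N
  proof -
    have "symm M \<subseteq> symm N" using that by auto
    then show ?thesis
      by (simp add: dist_norm trig_diff norm_trig s_def sum_diff)
  qed
  have "Cauchy (\<lambda>N. trig (symm N) c)"
    unfolding Cauchy_altdef
  proof (intro allI impI)
    fix e :: real assume e: "e > 0"
    obtain M where M: "\<And>m n. m \<ge> M \<Longrightarrow> n > m \<Longrightarrow> dist (s m) (s n) < e\<^sup>2"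
      using \<open>Cauchy s\<close> e unfolding Cauchy_altdef by (metis zero_less_power)
    have "dist (trig (symm m) c) (trig (symm n) c) < e" if "m \<ge> M" "n > m" for m n
    proof -
      have "(dist (trig (symm n) c) (trig (symm m) c))\<^sup>2 < e\<^sup>2"
        using d[of m n] M[OF that] that by (simp add: dist_real_def)
      then show ?thesis
        using e by (simp add: dist_commute power2_less_imp_less)
    qed
    then show "\<exists>M. \<forall>m\<ge>M. \<forall>n>m. dist (trig (symm m) c) (trig (symm n) c) < e" by blast
  qed
  then obtain \<xi> where \<xi>: "(\<lambda>N. trig (symm N) c) \<longlonglongrightarrow> \<xi>"
    using Cauchy_convergent by (auto simp: convergent_def)
  have "fc \<xi> n = c n" for n
  proof (rule LIMSEQ_unique[OF tendsto_fc[OF \<xi>, of n]])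
    have "eventually (\<lambda>N. fc (trig (symm N) c) n = c n) sequentially"
      by (rule eventually_sequentiallyI[of "nat \<bar>n\<bar>"]) (auto simp: fc_trig)
    then show "(\<lambda>N. fc (trig (symm N) c) n) \<longlonglongrightarrow> c n"
      by (rule tendsto_eventually)
  qed
  with \<xi> that show ?thesis by blast
qed

lemma bessel: "(\<Sum>n\<in>symm N. (cmod (fc \<xi> n))\<^sup>2) \<le> (norm \<xi>)\<^sup>2"
  using norm_trig_fc_le[of "symm N" \<xi>] norm_trig[of "symm N" "fc \<xi>"] by (metis finite_atLeastAtMost_int norm_ge_zero power_mono)

text \<open>Bessel's inequality makes the partial sums converge to some vector with the coefficients
  of \<xi>; uniqueness of coefficients identifies it with \<xi>.\<close>

lemma fourier_series: "(\<lambda>N. trig (symm N) (fc \<xi>)) \<longlonglongrightarrow> \<xi>"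
proof -
  obtain \<eta> where \<eta>: "(\<lambda>N. trig (symm N) (fc \<xi>)) \<longlonglongrightarrow> \<eta>" "fc \<eta> = fc \<xi>"
    using trig_convergent[OF bessel] .
  then have "\<eta> = \<xi>" by (intro fc_eqI) simp
  with \<eta> show ?thesis by simp
qed

lemma norm_le_if_trig_bounded:
  assumes "\<And>N. norm (trig (symm N) (fc \<xi>)) \<le> K"
  shows "norm \<xi> \<le> K"
  using tendsto_norm[OF fourier_series] by (rule LIMSEQ_le_const2) (use assms in auto)

text \<open>The Fourier partial sums of \<xi> are themselves the test vectors: pairing \<xi> with
  one of them gives the squared norm of that partial sum. Thus a bound of the pairing with
  trigonometric polynomials, which is all that the quadratic form offers, bounds the vector.\<close>

lemma norm_le_if_tested:
  assumes "\<And>N. cmod (cinner \<xi> (trig (symm N) (fc \<xi>))) \<le> K * norm (trig (symm N) (fc \<xi>))"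
  shows "norm \<xi> \<le> \<bar>K\<bar>"
proof (rule norm_le_if_trig_bounded)
  fix N
  let ?t = "trig (symm N) (fc \<xi>)"
  have "complex_of_real ((norm ?t)\<^sup>2) = cinner \<xi> ?t"
    unfolding cinner_trig_right norm_trig[OF finite_atLeastAtMost_int] of_real_sum
    by (intro sum.cong refl) (rule complex_norm_square)
  then have "(norm ?t)\<^sup>2 = cmod (cinner \<xi> ?t)"
    by (metis abs_of_nonneg norm_of_real zero_le_power2)
  then have "norm ?t * norm ?t \<le> K * norm ?t"
    using assms[of N] by (simp add: power2_eq_square)
  then show "norm ?t \<le> \<bar>K\<bar>"
    by (cases "norm ?t = 0") (auto simp: mult_le_cancel_right)
qed

text \<open>The source of vectors in the domains of multipliers: coefficients dominated by those of
  an existing vector are square summable. It is used to pass between \<kappa> and |\<kappa>|, and to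
  realise the commutators with single characters.\<close>

lemma multiplier_exists:
  assumes "\<And>n. cmod (c n) \<le> K * cmod (fc \<xi> n)"
  obtains \<zeta> where "fc \<zeta> = c"
proof -
  have "(\<Sum>n\<in>symm N. (cmod (c n))\<^sup>2) \<le> K\<^sup>2 * (norm \<xi>)\<^sup>2" for N
  proof -
    have "(\<Sum>n\<in>symm N. (cmod (c n))\<^sup>2) \<le> (\<Sum>n\<in>symm N. K\<^sup>2 * (cmod (fc \<xi> n))\<^sup>2)"
      unfolding power_mult_distrib[symmetric] by (intro sum_mono power_mono assms) auto
    also have "\<dots> = K\<^sup>2 * (\<Sum>n\<in>symm N. (cmod (fc \<xi> n))\<^sup>2)"
      by (simp add: sum_distrib_left)
    also have "\<dots> \<le> K\<^sup>2 * (norm \<xi>)\<^sup>2"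
      by (intro mult_left_mono bessel) auto
    finally show ?thesis .
  qed
  from trig_convergent[OF this] that show ?thesis by blast
qed

lemma norm_le_if_fc_le:
  assumes "\<And>n. cmod (fc \<alpha> n) \<le> K * cmod (fc \<beta> n)" and K: "K \<ge> 0"
  shows "norm \<alpha> \<le> K * norm \<beta>"
proof (rule norm_le_if_trig_bounded)
  fix N
  have "(norm (trig (symm N) (fc \<alpha>)))\<^sup>2 = (\<Sum>n\<in>symm N. (cmod (fc \<alpha> n))\<^sup>2)"
    by (simp add: norm_trig)
  also have "\<dots> \<le> (\<Sum>n\<in>symm N. K\<^sup>2 * (cmod (fc \<beta> n))\<^sup>2)"
    unfolding power_mult_distrib[symmetric] by (intro sum_mono power_mono assms) auto
  also have "\<dots> = K\<^sup>2 * (\<Sum>n\<in>symm N. (cmod (fc \<beta> n))\<^sup>2)"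
    by (simp add: sum_distrib_left)
  also have "\<dots> \<le> K\<^sup>2 * (norm \<beta>)\<^sup>2"
    by (intro mult_left_mono bessel) auto
  finally have "(norm (trig (symm N) (fc \<alpha>)))\<^sup>2 \<le> (K * norm \<beta>)\<^sup>2"
    by (simp add: power_mult_distrib)
  then show "norm (trig (symm N) (fc \<alpha>)) \<le> K * norm \<beta>"
    by (rule power2_le_imp_le) (simp add: K)
qed

text \<open>Lower semicontinuity of the norm under coefficientwise convergence: each finite sum of
  squares passes to the limit. It serves where a series of vectors is identified through its
  coefficients alone.\<close>

lemma norm_le_if_fc_tendsto:
  assumes lim: "\<And>n. (\<lambda>k. fc (X k) n) \<longlonglongrightarrow> fc \<xi> n" and K: "\<And>k. norm (X k) \<le> K"
  shows "norm \<xi> \<le> K"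
proof (rule norm_le_if_trig_bounded)
  fix N
  have K0: "0 \<le> K" using order_trans[OF norm_ge_zero K[of 0]] .
  have "(norm (trig (symm N) (fc \<xi>)))\<^sup>2 \<le> K\<^sup>2"
    unfolding norm_trig[OF finite_atLeastAtMost_int]
  proof (rule LIMSEQ_le_const2)
    show "(\<lambda>k. \<Sum>n\<in>symm N. (cmod (fc (X k) n))\<^sup>2) \<longlonglongrightarrow> (\<Sum>n\<in>symm N. (cmod (fc \<xi> n))\<^sup>2)"
      by (intro tendsto_intros lim)
    show "\<exists>M. \<forall>k\<ge>M. (\<Sum>n\<in>symm N. (cmod (fc (X k) n))\<^sup>2) \<le> K\<^sup>2"
      using order_trans[OF bessel power_mono[OF K norm_ge_zero]] by blast
  qed
  then show "norm (trig (symm N) (fc \<xi>)) \<le> K"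
    by (rule power2_le_imp_le) (rule K0)
qed

lemma cinner_fourier: "(\<lambda>N. \<Sum>n\<in>symm N. fc \<xi> n * cnj (fc \<eta> n)) \<longlonglongrightarrow> cinner \<xi> \<eta>"
proof -
  have "(\<lambda>N. cnj (cinner (trig (symm N) (fc \<eta>)) \<xi>)) \<longlonglongrightarrow> cnj (cinner \<eta> \<xi>)"
    by (intro tendsto_cnj tendsto_cinner_left fourier_series)
  then show ?thesis
    by (simp add: cinner_commute[symmetric] cinner_trig_right)
qed

section \<open>Fourier multipliers and their absolute values\<close>

text \<open>The maximal domain is built in: as the coefficients of any vector are square summable,
  the existence of \<zeta> is exactly the square summability of \<kappa> n times the coefficients of
  \<xi>.\<close>

definition mult_op :: "(int \<Rightarrow> real) \<Rightarrow> unbounded_op"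
  where "mult_op \<kappa> = {(\<xi>, \<zeta>). \<forall>n. fc \<zeta> n = of_real (\<kappa> n) * fc \<xi> n}"

lemma mult_op_iff: "(\<xi>, \<zeta>) \<in> mult_op \<kappa> \<longleftrightarrow> (\<forall>n. fc \<zeta> n = of_real (\<kappa> n) * fc \<xi> n)"
  by (simp add: mult_op_def)

lemma mult_op_unique: "(\<xi>, \<zeta>) \<in> mult_op \<kappa> \<Longrightarrow> (\<xi>, \<zeta>') \<in> mult_op \<kappa> \<Longrightarrow> \<zeta> = \<zeta>'"
  by (rule fc_eqI) (simp add: mult_op_iff)

lemma mult_op_add: "(\<xi>, \<zeta>) \<in> mult_op \<kappa> \<Longrightarrow> (\<xi>', \<zeta>') \<in> mult_op \<kappa> \<Longrightarrow> (\<xi> + \<xi>', \<zeta> + \<zeta>') \<in> mult_op \<kappa>"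
  by (simp add: mult_op_iff fc_add algebra_simps)

lemma mult_op_diff: "(\<xi>, \<zeta>) \<in> mult_op \<kappa> \<Longrightarrow> (\<xi>', \<zeta>') \<in> mult_op \<kappa> \<Longrightarrow> (\<xi> - \<xi>', \<zeta> - \<zeta>') \<in> mult_op \<kappa>"
  by (simp add: mult_op_iff fc_diff algebra_simps)

lemma mult_op_scaleC: "(\<xi>, \<zeta>) \<in> mult_op \<kappa> \<Longrightarrow> (c *\<^sub>C \<xi>, c *\<^sub>C \<zeta>) \<in> mult_op \<kappa>"
  by (simp add: mult_op_iff fc_scaleC)

lemma mult_op_zero: "(0, 0) \<in> mult_op \<kappa>"
  by (simp add: mult_op_iff)

lemma mult_op_sum: "(\<And>i. i \<in> A \<Longrightarrow> (f i, g i) \<in> mult_op \<kappa>) \<Longrightarrow> (\<Sum>i\<in>A. f i, \<Sum>i\<in>A. g i) \<in> mult_op \<kappa>"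
  by (induction A rule: infinite_finite_induct) (auto simp: mult_op_zero mult_op_add)

lemma mult_op_trig: "finite A \<Longrightarrow> (trig A c, trig A (\<lambda>n. of_real (\<kappa> n) * c n)) \<in> mult_op \<kappa>"
  by (simp add: mult_op_iff fc_trig)

lemma mult_op_ee: "(ee n, of_real (\<kappa> n) *\<^sub>C ee n) \<in> mult_op \<kappa>"
  by (auto simp: mult_op_iff fc_scaleC fc_ee)

lemma mult_op_closed:
  assumes "X \<longlonglongrightarrow> \<xi>" "Y \<longlonglongrightarrow> \<zeta>" "\<And>k::nat. (X k, Y k) \<in> mult_op \<kappa>"
  shows "(\<xi>, \<zeta>) \<in> mult_op \<kappa>"
  unfolding mult_op_iff
proof
  fix n
  have "(\<lambda>k. of_real (\<kappa> n) * fc (X k) n) \<longlonglongrightarrow> of_real (\<kappa> n) * fc \<xi> n"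
    by (intro tendsto_intros tendsto_fc assms)
  moreover have "(\<lambda>k. of_real (\<kappa> n) * fc (X k) n) = (\<lambda>k. fc (Y k) n)"
    using assms(3) by (simp add: mult_op_iff)
  ultimately show "fc \<zeta> n = of_real (\<kappa> n) * fc \<xi> n"
    using LIMSEQ_unique[OF tendsto_fc[OF assms(2)]] by metis
qed

lemma mult_op_symmetric:
  assumes "(\<xi>, \<theta>) \<in> mult_op \<kappa>" "(\<eta>, \<zeta>) \<in> mult_op \<kappa>"
  shows "cinner \<theta> \<eta> = cinner \<xi> \<zeta>"
  using cinner_fourier[of \<theta> \<eta>] cinner_fourier[of \<xi> \<zeta>] assms
  by (intro LIMSEQ_unique[OF cinner_fourier[of \<theta> \<eta>]]) (simp add: mult_op_iff mult_ac)

text \<open>Testing an adjoint pair against the eigenvectors \<open>ee n\<close> reads off its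
  coefficients, so the adjoint cannot exceed the multiplier with maximal domain. Density holds
  because trigonometric polynomials lie in the domain.\<close>

lemma self_adjoint_mult_op: "self_adjoint_op (mult_op \<kappa>)"
  unfolding self_adjoint_op_def
proof (intro conjI)
  show "single_valued (mult_op \<kappa>)"
    by (auto simp: single_valued_def intro: mult_op_unique)
  show "closure (Domain (mult_op \<kappa>)) = UNIV"
  proof (intro equalityI subset_UNIV subsetI)
    fix \<xi>
    show "\<xi> \<in> closure (Domain (mult_op \<kappa>))"
      unfolding closure_sequential
      using fourier_series[of \<xi>] mult_op_trig[OF finite_atLeastAtMost_int]
      by (intro exI[of _ "\<lambda>N. trig (symm N) (fc \<xi>)"] conjI allI DomainI)
  qed
  show "adjoint_op (mult_op \<kappa>) = mult_op \<kappa>"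
  proof (intro equalityI subsetI)
    fix z assume z: "z \<in> adjoint_op (mult_op \<kappa>)"
    obtain \<eta> \<zeta> where z': "z = (\<eta>, \<zeta>)" by (cases z)
    have "fc \<zeta> n = of_real (\<kappa> n) * fc \<eta> n" for n
    proof -
      have "cinner (of_real (\<kappa> n) *\<^sub>C ee n) \<eta> = cinner (ee n) \<zeta>"
        using z mult_op_ee[of n \<kappa>] by (auto simp: adjoint_op_def z')
      then have "of_real (\<kappa> n) * cnj (fc \<eta> n) = cnj (fc \<zeta> n)"
        by (simp add: cinner_scaleC_left cinner_ee_left)
      from arg_cong[OF this, of cnj] show ?thesis by simp
    qed
    then show "z \<in> mult_op \<kappa>" by (simp add: z' mult_op_iff)
  next
    fix z assume "z \<in> mult_op \<kappa>"
    then show "z \<in> adjoint_op (mult_op \<kappa>)"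
      by (auto simp: adjoint_op_def intro: mult_op_symmetric)
  qed
qed

lemma positive_mult_op:
  assumes "\<And>n. \<kappa> n \<ge> 0"
  shows "positive_op (mult_op \<kappa>)"
  unfolding positive_op_def
proof (intro ballI, clarify)
  fix \<xi> \<eta> assume *: "(\<xi>, \<eta>) \<in> mult_op \<kappa>"
  define r where "r N = (\<Sum>n\<in>symm N. \<kappa> n * (cmod (fc \<xi> n))\<^sup>2)" for N
  have "complex_of_real (r N) = (\<Sum>n\<in>symm N. fc \<eta> n * cnj (fc \<xi> n))" for N
    unfolding r_def of_real_sum of_real_mult complex_norm_square
    using * by (simp add: mult_op_iff mult_ac)
  then have lim: "(\<lambda>N. complex_of_real (r N)) \<longlonglongrightarrow> cinner \<eta> \<xi>"
    using cinner_fourier[of \<eta> \<xi>] by simp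
  have "Im (cinner \<eta> \<xi>) = 0"
    using tendsto_Im[OF lim] by (simp add: LIMSEQ_const_iff)
  moreover have "0 \<le> Re (cinner \<eta> \<xi>)"
    using tendsto_Re[OF lim] by (rule LIMSEQ_le_const) (auto simp: r_def intro!: exI[of _ 0] sum_nonneg mult_nonneg_nonneg assms)
  ultimately show "cinner \<eta> \<xi> \<in> \<real> \<and> 0 \<le> Re (cinner \<eta> \<xi>)"
    by (simp add: complex_is_Real_iff)
qed

text \<open>Relation composition asks for an intermediate vector. The two candidates have
  coefficients of equal modulus, so the existence of one gives the other, and squaring removes the
  sign.\<close>

lemma mult_op_abs_square: "mult_op (\<lambda>n. \<bar>\<kappa> n\<bar>) O mult_op (\<lambda>n. \<bar>\<kappa> n\<bar>) = mult_op \<kappa> O mult_op \<kappa>"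
proof -
  have *: "mult_op \<kappa> O mult_op \<kappa> \<subseteq> mult_op \<mu> O mult_op \<mu>" if eq: "\<And>n. \<bar>\<kappa> n\<bar> = \<bar>\<mu> n\<bar>" for \<kappa> \<mu> :: "int \<Rightarrow> real"
  proof
    fix z assume "z \<in> mult_op \<kappa> O mult_op \<kappa>"
    then obtain \<xi> \<eta> \<zeta> where z: "z = (\<xi>, \<zeta>)" "(\<xi>, \<eta>) \<in> mult_op \<kappa>" "(\<eta>, \<zeta>) \<in> mult_op \<kappa>"
      by blast
    have "cmod (of_real (\<mu> n) * fc \<xi> n) \<le> 1 * cmod (fc \<eta> n)" for n
      using z(2) eq[of n] by (simp add: mult_op_iff norm_mult)
    then obtain \<eta>' where \<eta>': "fc \<eta>' = (\<lambda>n. of_real (\<mu> n) * fc \<xi> n)"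
      by (rule multiplier_exists)
    have "(\<mu> n)\<^sup>2 = (\<kappa> n)\<^sup>2" for n
      using eq[of n] by (metis power2_abs)
    then have "complex_of_real (\<mu> n) * of_real (\<mu> n) = of_real (\<kappa> n) * of_real (\<kappa> n)" for n
      unfolding of_real_mult[symmetric] power2_eq_square by simp
    then have "(\<eta>', \<zeta>) \<in> mult_op \<mu>"
      using z \<eta>' by (simp add: mult_op_iff mult.assoc[symmetric])
    moreover have "(\<xi>, \<eta>') \<in> mult_op \<mu>"
      using \<eta>' by (simp add: mult_op_iff)
    ultimately show "z \<in> mult_op \<mu> O mult_op \<mu>" using z by blast
  qed
  show ?thesis
    using *[of "\<lambda>n. \<bar>\<kappa> n\<bar>" \<kappa>] *[of \<kappa> "\<lambda>n. \<bar>\<kappa> n\<bar>"] by auto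
qed

section \<open>Uniqueness of the positive square root\<close>

lemma self_adjoint_sym:
  assumes "self_adjoint_op P" "(\<xi>, \<theta>) \<in> P" "(\<eta>, \<zeta>) \<in> P"
  shows "cinner \<theta> \<eta> = cinner \<xi> \<zeta>"
proof -
  have "(\<eta>, \<zeta>) \<in> adjoint_op P"
    using assms by (simp add: self_adjoint_op_def)
  then show ?thesis
    using assms(2) by (auto simp: adjoint_op_def)
qed

text \<open>\<open>self_adjoint_op\<close> is a condition on a mere relation. Linearity of the graph
  comes from its being an adjoint, since the equations that define an adjoint are linear in the
  pair.\<close>

lemma self_adjoint_linear:
  assumes "self_adjoint_op P" "(\<xi>, \<theta>) \<in> P" "(\<eta>, \<zeta>) \<in> P"
  shows "(\<xi> + c *\<^sub>C \<eta>, \<theta> + c *\<^sub>C \<zeta>) \<in> P"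
proof -
  have "(\<xi> + c *\<^sub>C \<eta>, \<theta> + c *\<^sub>C \<zeta>) \<in> adjoint_op P"
    using self_adjoint_sym[OF assms(1)] assms(2,3)
    by (auto simp: adjoint_op_def cinner_add_right cinner_scaleC_right)
  then show ?thesis using assms(1) by (simp add: self_adjoint_op_def)
qed

text \<open>From (P + \<mu>)(P - \<mu>)\<xi> = 0, the vector \<eta> = (P - \<mu>)\<xi> satisfies
  P\<eta> = -\<mu>\<eta>, and positivity of P excludes this for \<mu> > 0 unless \<eta> = 0. For
  \<mu> = 0 the symmetry of P shows that the squared norm of P\<xi> is the inner product of \<xi>
  with P^2\<xi> = 0.\<close>

lemma square_root_eigenvector:
  assumes P: "self_adjoint_op P" "positive_op P" and \<mu>: "\<mu> \<ge> 0"
    and sq: "(\<xi>, of_real (\<mu>\<^sup>2) *\<^sub>C \<xi>) \<in> P O P"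
  shows "(\<xi>, of_real \<mu> *\<^sub>C \<xi>) \<in> P"
proof -
  obtain \<theta> where \<theta>: "(\<xi>, \<theta>) \<in> P" "(\<theta>, of_real (\<mu>\<^sup>2) *\<^sub>C \<xi>) \<in> P"
    using sq by blast
  define \<eta> where "\<eta> = \<theta> + of_real (- \<mu>) *\<^sub>C \<xi>"
  have "(\<eta>, of_real (\<mu>\<^sup>2) *\<^sub>C \<xi> + of_real (- \<mu>) *\<^sub>C \<theta>) \<in> P"
    unfolding \<eta>_def by (rule self_adjoint_linear[OF P(1) \<theta>(2,1)])
  moreover have "of_real (\<mu>\<^sup>2) *\<^sub>C \<xi> + of_real (- \<mu>) *\<^sub>C \<theta> = of_real (- \<mu>) *\<^sub>C \<eta>"
    by (rule fc_eqI) (simp add: \<eta>_def fc_add fc_scaleC power2_eq_square algebra_simps)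
  ultimately have \<eta>: "(\<eta>, of_real (- \<mu>) *\<^sub>C \<eta>) \<in> P" by simp
  have "\<eta> = 0"
  proof (cases "\<mu> = 0")
    case True
    then have "cinner \<theta> \<theta> = cinner \<xi> 0"
      using self_adjoint_sym[OF P(1) \<theta>(1) \<theta>(2)] by simp
    then have "\<theta> = 0" by (simp add: cinner_self_norm)
    then show ?thesis using True by (simp add: \<eta>_def)
  next
    case False
    have "0 \<le> Re (cinner (of_real (- \<mu>) *\<^sub>C \<eta>) \<eta>)"
      using P(2) \<eta> unfolding positive_op_def by fast
    then have "0 \<le> - \<mu> * (norm \<eta>)\<^sup>2"
      by (simp add: cinner_scaleC_left cinner_self_norm del: of_real_power)
    then have "(norm \<eta>)\<^sup>2 \<le> 0"
      using False \<mu> by (auto simp: mult_le_0_iff zero_le_mult_iff)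
    then show ?thesis by simp
  qed
  then have "\<theta> = of_real \<mu> *\<^sub>C \<xi>"
    using scaleC_add_left[of "of_real (- \<mu>)" "of_real \<mu>" \<xi>] by (simp add: \<eta>_def add_eq_0_iff uminus_eq_scaleC)
  with \<theta>(1) show ?thesis by simp
qed

text \<open>\<open>abs_op\<close> is a definite description, so every competitor P has to be shown
  equal to the multiplier. P agrees with it on the eigenvectors \<open>ee n\<close>, and a
  self-adjoint relation has no proper self-adjoint restriction.\<close>

lemma abs_mult_op: "abs_op (mult_op \<kappa>) = mult_op (\<lambda>n. \<bar>\<kappa> n\<bar>)"
  unfolding abs_op_def
proof (rule the_equality)
  have adj: "adjoint_op (mult_op \<kappa>) = mult_op \<kappa>"
    using self_adjoint_mult_op by (simp add: self_adjoint_op_def)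
  show "self_adjoint_op (mult_op (\<lambda>n. \<bar>\<kappa> n\<bar>)) \<and> positive_op (mult_op (\<lambda>n. \<bar>\<kappa> n\<bar>)) \<and>
    mult_op (\<lambda>n. \<bar>\<kappa> n\<bar>) O mult_op (\<lambda>n. \<bar>\<kappa> n\<bar>) = mult_op \<kappa> O adjoint_op (mult_op \<kappa>)"
    unfolding adj by (intro conjI self_adjoint_mult_op positive_mult_op mult_op_abs_square) simp
  fix P assume "self_adjoint_op P \<and> positive_op P \<and> P O P = mult_op \<kappa> O adjoint_op (mult_op \<kappa>)"
  then have P: "self_adjoint_op P" "positive_op P" "P O P = mult_op (\<lambda>n. \<bar>\<kappa> n\<bar>) O mult_op (\<lambda>n. \<bar>\<kappa> n\<bar>)"
    by (auto simp: adj mult_op_abs_square)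
  have eig: "(ee n, of_real \<bar>\<kappa> n\<bar> *\<^sub>C ee n) \<in> P" for n
  proof (rule square_root_eigenvector[OF P(1,2)])
    have "(of_real \<bar>\<kappa> n\<bar> *\<^sub>C ee n, of_real \<bar>\<kappa> n\<bar> *\<^sub>C of_real \<bar>\<kappa> n\<bar> *\<^sub>C ee n) \<in> mult_op (\<lambda>n. \<bar>\<kappa> n\<bar>)"
      by (intro mult_op_scaleC mult_op_ee)
    moreover have "(ee n, of_real \<bar>\<kappa> n\<bar> *\<^sub>C ee n) \<in> mult_op (\<lambda>n. \<bar>\<kappa> n\<bar>)"
      by (rule mult_op_ee)
    ultimately show "(ee n, of_real (\<bar>\<kappa> n\<bar>\<^sup>2) *\<^sub>C ee n) \<in> P O P"
      unfolding P(3) power2_eq_square of_real_mult scaleC_scaleC by blast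
  qed simp
  \<comment> \<open>Symmetry of P, tested against the eigenvectors, computes the coefficients of
    every value of P.\<close>
  have sub: "P \<subseteq> mult_op (\<lambda>n. \<bar>\<kappa> n\<bar>)"
  proof
    fix z assume z: "z \<in> P"
    obtain \<xi> \<theta> where z': "z = (\<xi>, \<theta>)" by (cases z)
    show "z \<in> mult_op (\<lambda>n. \<bar>\<kappa> n\<bar>)"
      using self_adjoint_sym[OF P(1) z[unfolded z'] eig] z'
      by (simp add: mult_op_iff cinner_scaleC_right fc_def)
  qed
  \<comment> \<open>Taking adjoints reverses the inclusion, while both operators are their own
    adjoints.\<close>
  have anti: "adjoint_op T \<subseteq> adjoint_op S" if "S \<subseteq> T" for S T
    using that by (auto simp: adjoint_op_def)
  have "mult_op (\<lambda>n. \<bar>\<kappa> n\<bar>) \<subseteq> P"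
    using anti[OF sub] P(1) self_adjoint_mult_op[of "\<lambda>n. \<bar>\<kappa> n\<bar>"] by (simp add: self_adjoint_op_def)
  with sub show "P = mult_op (\<lambda>n. \<bar>\<kappa> n\<bar>)" by blast
qed

section \<open>The operator \<open>D\<close> as a Fourier multiplier\<close>

lemma unit_integral_Icc_eq_atMost:
  fixes g :: "real \<Rightarrow> complex"
  assumes "integrable unit_measure g"
  shows "(\<integral>t. indicator {0..x} t *\<^sub>R g t \<partial>unit_measure) = (\<integral>t. indicator {..x} t *\<^sub>R g t \<partial>unit_measure)"
proof -
  note [measurable] = borel_integrable_unit[OF assms]
  show ?thesis
    by (intro integral_cong_AE eventually_mono[OF AE_unit]) (auto simp: indicator_def)
qed

lemma unit_integral_eq_atMost_1:
  fixes g :: "real \<Rightarrow> complex"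
  assumes "integrable unit_measure g"
  shows "(\<integral>t. indicator {..1} t *\<^sub>R g t \<partial>unit_measure) = (\<integral>t. g t \<partial>unit_measure)"
proof -
  note [measurable] = borel_integrable_unit[OF assms]
  show ?thesis
    by (intro integral_cong_AE eventually_mono[OF AE_unit]) (auto simp: indicator_def)
qed

text \<open>On one period f equals a constant plus the antiderivative of h, so its coefficients
  follow from the integration by parts formula with index -n. For n = 0 the claim is that h has mean
  zero.\<close>

lemma fc_AC:
  assumes f: "square_integrable f" and h: "square_integrable h"
    and AC: "\<And>x y. x \<le> y \<Longrightarrow> ((\<lambda>t. h (to_circle t)) has_integral (f (to_circle y) - f (to_circle x))) {x..y}"
  shows "fc (to_L2 h) n = 2 * pi * \<i> * of_int n * fc (to_L2 f) n"
proof -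
  define g where "g t = h (to_circle t)" for t
  have g: "integrable unit_measure g"
    unfolding g_def by (rule integrable_unit_square_integrable[OF h])
  note [measurable] = borel_integrable_unit[OF g] square_integrableD[OF f]
  define H where "H x = (\<integral>t. indicator {..x} t *\<^sub>R g t \<partial>unit_measure)" for x
  have fH: "f (to_circle x) = f (to_circle 0) + H x" if "0 \<le> x" "x \<le> 1" for x
  proof -
    have "(g has_integral H x) {0..x}"
      using unit_integral_has_integral[OF g, of 0 x] that by (simp add: H_def unit_integral_Icc_eq_atMost[OF g])
    moreover have "(g has_integral (f (to_circle x) - f (to_circle 0))) {0..x}"
      using AC[OF that(1)] by (simp add: g_def[abs_def])
    ultimately have "H x = f (to_circle x) - f (to_circle 0)"
      by (rule has_integral_unique)
    then show ?thesis by simp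
  qed
  have "to_circle 1 = to_circle 0"
    using to_circle_add_int[of 0] by simp
  \<comment> \<open>Periodicity of f enters here: the increment over a full period is the mean of h,
    which must vanish, and with it the boundary term.\<close>
  then have "H 1 = 0"
    using fH[of 1] by simp
  then have g0: "(\<integral>t. g t \<partial>unit_measure) = 0"
    using unit_integral_eq_atMost_1[OF g] by (simp add: H_def)
  show ?thesis
  proof (cases "n = 0")
    case True
    then show ?thesis
      using g0 by (simp add: fc_to_L2[OF h] g_def)
  next
    case False
    have contH: "continuous_on UNIV H"
      using continuous_antiderivative[OF g] by (simp add: H_def[abs_def])
    have [measurable]: "H \<in> borel_measurable borel"
      by (rule borel_measurable_continuous_onI[OF contH])
    define c where "c = f (to_circle 0)"
    have "fc (to_L2 f) n = (\<integral>t. c * fexp (- n) t + H t * fexp (- n) t \<partial>unit_measure)"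
      unfolding fc_to_L2[OF f]
      by (intro integral_cong_AE eventually_mono[OF AE_unit]) (auto simp: fH[folded c_def] distrib_right)
    also have "\<dots> = (\<integral>t. c * fexp (- n) t \<partial>unit_measure) + (\<integral>t. H t * fexp (- n) t \<partial>unit_measure)"
      by (intro Bochner_Integration.integral_add integrable_unit_continuous continuous_intros contH)
    also have "\<dots> = (0 - (\<integral>t. g t * fexp (- n) t \<partial>unit_measure)) / (2 * pi * \<i> * of_int (- n))"
      using integral_antiderivative_fexp[OF g, of "- n"] False by (simp add: H_def integral_fexp g0)
    also have "(\<integral>t. g t * fexp (- n) t \<partial>unit_measure) = fc (to_L2 h) n"
      by (simp add: fc_to_L2[OF h] g_def)
    finally show ?thesis
      using False by simp
  qed
qed

text \<open>\<open>dirac\<close> prescribes increments over all real intervals, not just inside one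
  period. As the mean is zero, whole periods contribute nothing, so only the fractional part of the
  endpoint remains.\<close>

lemma periodic_antiderivative:
  fixes g :: "real \<Rightarrow> complex"
  assumes g: "integrable unit_measure g" and per: "\<And>t. g (t + 1) = g t"
    and g0: "(\<integral>t. g t \<partial>unit_measure) = 0"
  defines "H \<equiv> (\<lambda>x. \<integral>t. indicator {..x} t *\<^sub>R g t \<partial>unit_measure)"
  shows "real_of_int k \<le> x \<Longrightarrow> (g has_integral H (frac x)) {of_int k..x}"
proof -
  have base: "(g has_integral H x) {of_int k..of_int k + x}" if "0 \<le> x" "x \<le> 1" for k x
  proof -
    have "(g has_integral H x) {0..x}"
      using unit_integral_has_integral[OF g, of 0 x] that by (simp add: H_def unit_integral_Icc_eq_atMost[OF g])
    from has_integral_shift_real_ivl[OF this, of "of_int (- k)"]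
    show ?thesis
      using periodic_int[of g, OF per, of _ "- k"] by (simp add: add.commute)
  qed
  have H1: "H 1 = 0"
    using unit_integral_eq_atMost_1[OF g] g0 by (simp add: H_def)
  have nat: "(g has_integral H y) {of_int k..of_int k + real m + y}" if "0 \<le> y" "y \<le> 1" for k m y
  proof (induction m arbitrary: k)
    case 0
    then show ?case using base[OF that] by simp
  next
    case (Suc m)
    have "(g has_integral (0 + H y)) {of_int k..of_int k + real (Suc m) + y}"
    proof (rule has_integral_combine)
      show "(g has_integral 0) {of_int k..of_int (k + 1)}"
        using base[of 1 k] H1 by simp
      show "(g has_integral H y) {of_int (k + 1)..of_int k + real (Suc m) + y}"
        using Suc.IH[of "k + 1"] by (simp add: add_ac)
    qed (use that in auto)
    then show ?case by simp
  qed
  assume "real_of_int k \<le> x"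
  then have k: "k \<le> \<lfloor>x\<rfloor>" by (simp add: le_floor_iff)
  then have "x = of_int k + real (nat (\<lfloor>x\<rfloor> - k)) + frac x"
    by (simp add: frac_def)
  then show "(g has_integral H (frac x)) {of_int k..x}"
    using nat[of "frac x" k "nat (\<lfloor>x\<rfloor> - k)"] by (simp add: frac_lt_1 less_imp_le)
qed

text \<open>The coefficient equation at n = 0 says that \<zeta> has mean zero, so i\<zeta> has a
  periodic antiderivative. Its coefficients at n \<noteq> 0 are those of \<xi>, and the constant of
  integration is chosen to fit the remaining one; uniqueness of coefficients then makes it a
  representative of \<xi>.\<close>

lemma mult_op_subset_dirac: "mult_op (\<lambda>n. 2 * pi * of_int n) \<subseteq> dirac"
proof
  fix z assume "z \<in> mult_op (\<lambda>n. 2 * pi * of_int n)"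
  then obtain \<xi> \<zeta> where z: "z = (\<xi>, \<zeta>)" and fc: "\<And>n. fc \<zeta> n = 2 * pi * of_int n * fc \<xi> n"
    by (cases z) (auto simp: mult_op_iff)
  \<comment> \<open>\<open>dirac\<close> divides the derivative by i, so the derivative itself has
    to be i\<zeta>.\<close>
  define h where "h p = \<i> * rep_L2 \<zeta> p" for p
  have h: "square_integrable h"
    unfolding h_def by (intro square_integrable_scale square_integrable_rep)
  have hz: "to_L2 h = \<i> *\<^sub>C \<zeta>"
    unfolding h_def using to_L2_scale[OF square_integrable_rep, of "\<i>" \<zeta>] by simp
  define g where "g t = h (to_circle t)" for t
  have g: "integrable unit_measure g"
    unfolding g_def by (rule integrable_unit_square_integrable[OF h])
  have per: "g (t + 1) = g t" for t by (simp add: g_def)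
  have g0: "(\<integral>t. g t \<partial>unit_measure) = 0"
    using fc_to_L2[OF h, of 0] fc[of 0] by (simp add: g_def hz fc_scaleC)
  define H where "H x = (\<integral>t. indicator {..x} t *\<^sub>R g t \<partial>unit_measure)" for x
  have int: "(g has_integral H (frac x)) {of_int k..x}" if "of_int k \<le> x" for k x
    unfolding H_def using periodic_antiderivative[OF g per g0 that] .
  have frac_rep: "frac (rep_circle (to_circle t)) = frac t" for t
    by (rule periodic_rep) (simp add: frac_1_eq)
  define f0 where "f0 p = H (frac (rep_circle p))" for p
  have f0: "f0 (to_circle t) = H (frac t)" for t
    by (simp add: f0_def frac_rep)
  have AC: "(g has_integral (f0 (to_circle y) - f0 (to_circle x))) {x..y}" if "x \<le> y" for x y
  proof -
    have i: "(g has_integral H (frac y)) {of_int \<lfloor>x\<rfloor>..y}" "(g has_integral H (frac x)) {of_int \<lfloor>x\<rfloor>..x}"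
      by (rule int, use that in linarith)+
    have "g integrable_on {x..y}"
      using i(1) by (rule integrable_subinterval_real[OF has_integral_integrable]) (use that in auto)
    then obtain j where j: "(g has_integral j) {x..y}" by blast
    have "(g has_integral (H (frac x) + j)) {of_int \<lfloor>x\<rfloor>..y}"
      by (rule has_integral_combine[OF _ that i(2) j]) simp
    then have "H (frac x) + j = H (frac y)"
      using i(1) by (rule has_integral_unique)
    then have "j = H (frac y) - H (frac x)"
      by (simp add: algebra_simps)
    then show ?thesis
      using j by (simp add: f0)
  qed
  have contf0: "continuous_on UNIV f0"
    unfolding continuous_on_circle_iff
  proof (rule continuous_at_imp_continuous_on, rule ballI)
    fix x :: real
    \<comment> \<open>One less than the floor, so that x is an interior point of the interval even
      when x is an integer.\<close>
    define k where "k = \<lfloor>x\<rfloor> - 1"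
    have eq: "f0 (to_circle t) = integral {of_int k..t} g" if "of_int k \<le> t" for t
      unfolding f0 using int[OF that] by (simp add: integral_unique)
    have "g integrable_on {of_int k..x + 1}"
      by (rule has_integral_integrable, rule int) (simp add: k_def, linarith)
    then have "continuous_on {of_int k..x + 1} (\<lambda>t. integral {of_int k..t} g)"
      by (rule indefinite_integral_continuous_1)
    then have "continuous_on {of_int k..x + 1} (\<lambda>t. f0 (to_circle t))"
      by (rule continuous_on_eq) (simp add: eq)
    then have "continuous_on {of_int k<..<x + 1} (\<lambda>t. f0 (to_circle t))"
      by (rule continuous_on_subset) auto
    moreover have "x \<in> {of_int k<..<x + 1}"
      by (simp add: k_def) linarith
    ultimately show "isCont (\<lambda>t. f0 (to_circle t)) x"
      using continuous_on_interior[of "{of_int k<..<x + 1}"] by (simp only: interior_open open_greaterThanLessThan)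
  qed
  then have sq0: "square_integrable f0"
    by (rule square_integrable_continuous)
  \<comment> \<open>The constant of integration, determined by the zeroth coefficient of
    \<xi>.\<close>
  define c where "c = fc \<xi> 0 - fc (to_L2 f0) 0"
  define f where "f p = f0 p + c" for p
  have sqc: "square_integrable (\<lambda>_. c)"
    by (rule square_integrable_continuous) simp
  have f: "square_integrable f"
    unfolding f_def by (rule square_integrable_add[OF sq0 sqc])
  have ACf: "((\<lambda>t. h (to_circle t)) has_integral (f (to_circle y) - f (to_circle x))) {x..y}" if "x \<le> y" for x y
    using AC[OF that] by (simp add: f_def g_def[abs_def])
  have "fc (to_L2 f) n = fc \<xi> n" for n
  proof (cases "n = 0")
    case True
    have "fc (to_L2 f) 0 = fc (to_L2 f0) 0 + fc (to_L2 (\<lambda>_. c)) 0"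
      unfolding f_def to_L2_add[OF sq0 sqc, symmetric] fc_add ..
    also have "\<dots> = fc \<xi> 0"
      using fc_to_L2[OF sqc, of 0] by (simp add: c_def)
    finally show ?thesis using True by simp
  next
    case False
    then show ?thesis
      using fc_AC[OF f h ACf, of n] fc[of n] by (simp add: hz fc_scaleC)
  qed
  then have "to_L2 f = \<xi>" by (rule fc_eqI)
  moreover have "to_L2 (\<lambda>p. h p / \<i>) = \<zeta>"
    by (simp add: h_def)
  ultimately show "z \<in> dirac"
    unfolding dirac_def z using f h ACf by blast
qed

lemma dirac_eq_mult_op: "dirac = mult_op (\<lambda>n. 2 * pi * of_int n)"
proof
  show "dirac \<subseteq> mult_op (\<lambda>n. 2 * pi * of_int n)"
  proof
    fix z assume "z \<in> dirac"
    then obtain f h where z: "z = (to_L2 f, to_L2 (\<lambda>p. h p / \<i>))" "square_integrable f" "square_integrable h"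
      "\<And>x y. x \<le> y \<Longrightarrow> ((\<lambda>t. h (to_circle t)) has_integral (f (to_circle y) - f (to_circle x))) {x..y}"
      unfolding dirac_def by blast
    have eq: "to_L2 (\<lambda>p. h p / \<i>) = (- \<i>) *\<^sub>C to_L2 h"
      by (simp add: to_L2_scale[OF z(3)] mult.commute)
    have "fc (- \<i> *\<^sub>C to_L2 h) n = of_real (2 * pi * of_int n) * fc (to_L2 f) n" for n
    proof -
      have "fc (to_L2 h) n = 2 * pi * \<i> * of_int n * fc (to_L2 f) n"
        by (rule fc_AC[OF z(2,3)]) (rule z(4))
      moreover have "- \<i> * (2 * pi * \<i> * of_int n * c) = of_real (2 * pi * of_int n) * c" for c
        by (simp add: complex_eq_iff)
      ultimately show ?thesis
        by (simp only: fc_scaleC)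
    qed
    then show "z \<in> mult_op (\<lambda>n. 2 * pi * of_int n)"
      by (simp only: z(1) eq mult_op_iff) blast
  qed
qed (rule mult_op_subset_dirac)

lemma circle_continuous_if_deriv:
  assumes "\<And>t. ((\<lambda>t. w (to_circle t)) has_vector_derivative w' t) (at t)"
  shows "continuous_on UNIV w"
  unfolding continuous_on_circle_iff
  using has_vector_derivative_continuous[OF assms] by (intro continuous_at_imp_continuous_on) auto

lemma C1_in_dirac:
  assumes w: "continuous_on UNIV w'"
    and d: "\<And>t. ((\<lambda>t. w (to_circle t)) has_vector_derivative w' (to_circle t)) (at t)"
  shows "(to_L2 w, to_L2 (\<lambda>p. w' p / \<i>)) \<in> dirac"
proof -
  have cw: "continuous_on UNIV w"
    by (rule circle_continuous_if_deriv[OF d])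
  show ?thesis
    unfolding dirac_def
    using square_integrable_continuous[OF cw] square_integrable_continuous[OF w]
    by (intro CollectI exI[of _ w] exI[of _ w'] conjI allI impI refl)
       (auto intro!: fundamental_theorem_of_calculus has_vector_derivative_at_within[OF d])
qed

section \<open>Weighted composition operators\<close>

text \<open>The identity is included, so that multiplication operators are the case \<phi> = id of
  the weighted composition operators below.\<close>

definition lifts_to :: "(circle \<Rightarrow> circle) \<Rightarrow> (real \<Rightarrow> real) \<Rightarrow> (real \<Rightarrow> real) \<Rightarrow> bool"
  where "lifts_to \<phi> \<Phi> \<Phi>' \<longleftrightarrow> circle_lift \<Phi> \<Phi>' \<and> (\<forall>t. \<phi> (to_circle t) = to_circle (\<Phi> t))"

lemma lifts_to_id: "lifts_to id (\<lambda>x. x) (\<lambda>_. 1)"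
  using circle_lift_translation[of 0] by (simp add: lifts_to_def)

text \<open>The increment over a period is a constant integer k, positive because \<Phi> increases.
  If k \<ge> 2, the intermediate value theorem gives a point strictly inside the period where \<Phi>
  exceeds its initial value by 1, against the injectivity of \<phi>.\<close>

lemma diff_plus_degree_one:
  assumes \<phi>: "\<phi> \<in> diff_plus" and L: "smooth_lift \<phi> \<Phi>"
  shows "\<Phi> (x + 1) = \<Phi> x + 1"
proof -
  have d: "(\<Phi> has_real_derivative deriv \<Phi> x) (at x)" for x
    using L by (simp add: smooth_lift_def smooth_imp_deriv)
  have lift: "\<phi> (to_circle x) = to_circle (\<Phi> x)" for x
    using L by (simp add: smooth_lift_def)
  have "deriv \<Phi> x > 0" for x
    using \<phi> unfolding circle_deriv_lift[OF L, symmetric] by (simp add: diff_plus_def)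
  then have mono: "\<Phi> x < \<Phi> y" if "x < y" for x y
    using DERIV_pos_imp_increasing[OF that] d by blast
  have cont: "continuous_on S \<Phi>" for S
    using L by (simp add: smooth_lift_def smooth_imp_continuous)
  have "to_circle (\<Phi> (x + 1)) = to_circle (\<Phi> x)" for x
    using lift[of "x + 1"] lift[of x] by simp
  then have "\<Phi> (x + 1) - \<Phi> x \<in> \<int>" for x
    by (simp add: to_circle_eq_iff)
  moreover have "continuous_on UNIV (\<lambda>x. \<Phi> (x + 1) - \<Phi> x)"
    by (intro continuous_intros continuous_on_compose2[OF cont[of UNIV]] cont) auto
  ultimately obtain k where k: "k \<in> \<int>" "\<And>x. \<Phi> (x + 1) - \<Phi> x = k"
    using continuous_Ints_constant by blast
  obtain j where j: "k = of_int j" using k(1) by (auto elim: Ints_cases)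
  have "k > 0" using mono[of 0 1] k(2)[of 0] by simp
  have "k = 1"
  proof (rule ccontr)
    assume "k \<noteq> 1"
    then have "k \<ge> 2" using \<open>k > 0\<close> by (simp add: j)
    then have "\<Phi> 1 \<ge> \<Phi> 0 + 2" using k(2)[of 0] by simp
    then obtain x where x: "0 \<le> x" "x \<le> 1" "\<Phi> x = \<Phi> 0 + 1"
      using IVT'[of \<Phi> 0 "\<Phi> 0 + 1" 1] cont by auto
    then have "0 < x" "x < 1"
      using \<open>\<Phi> 1 \<ge> \<Phi> 0 + 2\<close> by (auto simp: less_le)
    have "\<phi> (to_circle x) = \<phi> (to_circle 0)"
      by (simp add: lift x)
    then have "to_circle x = to_circle 0"
      using \<phi> by (auto simp: diff_plus_def bij_def inj_def)
    then have "x \<in> \<int>" by (simp add: to_circle_eq_iff)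
    then show False using \<open>0 < x\<close> \<open>x < 1\<close> by (auto elim!: Ints_cases)
  qed
  then show ?thesis using k(2)[of x] by simp
qed

lemma smooth_deriv_continuous:
  fixes \<Phi> :: "real \<Rightarrow> real"
  assumes "smooth \<Phi>"
  shows "continuous_on UNIV (deriv \<Phi>)"
proof -
  obtain F where F: "F 0 = \<Phi>" "\<And>n x. (F n has_vector_derivative F (Suc n) x) (at x)"
    using assms unfolding smooth_def by blast
  have "deriv \<Phi> x = F 1 x" for x
    using F(2)[of 0 x] F(1) by (simp add: has_real_derivative_iff_has_vector_derivative DERIV_imp_deriv)
  then have "deriv \<Phi> = F 1" by blast
  then show ?thesis
    using has_vector_derivative_continuous[OF F(2)[of 1]] by (auto intro: continuous_at_imp_continuous_on)
qed

lemma diff_plus_lifts_to: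
  assumes \<phi>: "\<phi> \<in> diff_plus" and L: "smooth_lift \<phi> \<Phi>"
  shows "lifts_to \<phi> \<Phi> (deriv \<Phi>)"
proof -
  have "deriv \<Phi> x > 0" for x
    using \<phi> unfolding circle_deriv_lift[OF L, symmetric] by (simp add: diff_plus_def)
  then show ?thesis
    using L diff_plus_degree_one[OF assms]
    by (simp add: lifts_to_def circle_lift_def smooth_lift_def smooth_imp_deriv smooth_deriv_continuous)
qed

lemma lifts_toD:
  assumes "lifts_to \<phi> \<Phi> \<Phi>'"
  shows "circle_lift \<Phi> \<Phi>'" "\<phi> (to_circle t) = to_circle (\<Phi> t)" "continuous_on UNIV \<phi>"
    "\<phi> \<in> borel_measurable borel"
proof -
  show L: "circle_lift \<Phi> \<Phi>'" and \<phi>: "\<phi> (to_circle t) = to_circle (\<Phi> t)" for t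
    using assms by (auto simp: lifts_to_def)
  have "continuous_on UNIV (\<lambda>t. to_circle (\<Phi> t))"
    by (rule continuous_on_compose2[OF continuous_to_circle circle_liftD(5)[OF L]]) simp
  then show "continuous_on UNIV \<phi>"
    by (simp add: continuous_on_circle_iff \<phi>)
  then show "\<phi> \<in> borel_measurable borel"
    by (rule borel_measurable_continuous_onI)
qed

lemma nn_integral_circle_compose:
  assumes L: "lifts_to \<phi> \<Phi> \<Phi>'" and [measurable]: "f \<in> borel_measurable borel"
  shows "(\<integral>\<^sup>+t. f (\<phi> (to_circle t)) * ennreal (\<Phi>' t) \<partial>unit_measure) = (\<integral>\<^sup>+p. f p \<partial>circle_measure)"
  using nn_integral_circle_lift[OF lifts_toD(1)[OF L], of "\<lambda>t. f (to_circle t)"]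
  by (simp add: lifts_toD(2)[OF L] circle_nn_integral)

text \<open>Substitution shows that the weighted measure of the preimage of a null set is 0, and the
  weight \<Phi>' is positive. This makes composition with \<phi> well defined on classes of
  functions.\<close>

lemma AE_circle_compose:
  assumes L: "lifts_to \<phi> \<Phi> \<Phi>'" and P: "AE p in circle_measure. P p"
  shows "AE p in circle_measure. P (\<phi> p)"
proof -
  note [measurable] = lifts_toD(4)[OF L] circle_liftD(6,7)[OF lifts_toD(1)[OF L]]
  obtain N where N: "N \<in> null_sets circle_measure" "{p. \<not> P p} \<subseteq> N"
    using P by (auto simp: eventually_ae_filter)
  then have [measurable]: "N \<in> sets borel" by (auto simp: null_sets_def)
  have "(\<integral>\<^sup>+t. indicator N (\<phi> (to_circle t)) * ennreal (\<Phi>' t) \<partial>unit_measure) = 0"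
    using N by (subst nn_integral_circle_compose[OF L]) (auto simp: null_sets_def)
  then have "AE t in unit_measure. indicator N (\<phi> (to_circle t)) * ennreal (\<Phi>' t) = 0"
    by (subst (asm) nn_integral_0_iff_AE) auto
  then have "AE t in unit_measure. \<phi> (to_circle t) \<notin> N"
  proof eventually_elim
    case (elim t)
    then show ?case
      using circle_liftD(3)[OF lifts_toD(1)[OF L], of t]
      by (auto simp: indicator_def ennreal_eq_0_iff split: if_splits)
  qed
  then have "AE p in circle_measure. \<phi> p \<notin> N"
    unfolding circle_measure_eq_distr by (subst AE_distr_iff) auto
  then show ?thesis
    by eventually_elim (use N in auto)
qed

lemma circle_lift_bounds:
  assumes L: "circle_lift \<Phi> \<Phi>'"
  obtains m M where "0 < m" "\<And>t. m \<le> \<Phi>' t" "\<And>t. \<Phi>' t \<le> M"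
proof -
  have c: "continuous_on {0..1} \<Phi>'"
    by (rule continuous_on_subset[OF circle_liftD(2)[OF L]]) simp
  obtain a b where a: "\<And>t. t \<in> {0..1} \<Longrightarrow> \<Phi>' a \<le> \<Phi>' t" and b: "\<And>t. t \<in> {0..1} \<Longrightarrow> \<Phi>' t \<le> \<Phi>' b"
    using continuous_attains_inf[OF compact_Icc _ c] continuous_attains_sup[OF compact_Icc _ c] by fastforce
  have per: "\<Phi>' (frac t) = \<Phi>' t" for t
    by (rule periodic_frac) (rule circle_liftD(8)[OF L])
  show ?thesis
  proof (rule that[of "\<Phi>' a" "\<Phi>' b"])
    show "0 < \<Phi>' a" by (rule circle_liftD(3)[OF L])
    fix t
    show "\<Phi>' a \<le> \<Phi>' t" using a[of "frac t"] per[of t] by (simp add: frac_lt_1 less_imp_le)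
    show "\<Phi>' t \<le> \<Phi>' b" using b[of "frac t"] per[of t] by (simp add: frac_lt_1 less_imp_le)
  qed
qed

text \<open>With m a positive lower bound of \<Phi>', the function |f \<circ> \<phi>|^2 is at most
  1/m times |f \<circ> \<phi>|^2 \<Phi>', whose integral is that of |f|^2. The bound obtained is the
  square root of 1/m.\<close>

lemma compose_bounded:
  assumes L: "lifts_to \<phi> \<Phi> \<Phi>'"
  obtains C where "C \<ge> 0" "\<And>f. square_integrable f \<Longrightarrow> square_integrable (\<lambda>p. f (\<phi> p))"
    "\<And>f. square_integrable f \<Longrightarrow> norm (to_L2 (\<lambda>p. f (\<phi> p))) \<le> C * norm (to_L2 f)"
proof -
  obtain m where m: "0 < m" "\<And>t. m \<le> \<Phi>' t"
    using circle_lift_bounds[OF lifts_toD(1)[OF L]] by metis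
  have main: "square_integrable (\<lambda>p. f (\<phi> p)) \<and> norm (to_L2 (\<lambda>p. f (\<phi> p))) \<le> sqrt (1/m) * norm (to_L2 f)"
    if f: "square_integrable f" for f
  proof -
    note [measurable] = lifts_toD(4)[OF L] circle_liftD(6,7)[OF lifts_toD(1)[OF L]] square_integrableD[OF f]
    have "(\<integral>\<^sup>+p. ennreal ((cmod (f (\<phi> p)))\<^sup>2) \<partial>circle_measure)
        = (\<integral>\<^sup>+t. ennreal ((cmod (f (\<phi> (to_circle t))))\<^sup>2) \<partial>unit_measure)"
      by (rule circle_nn_integral) measurable
    also have "\<dots> \<le> (\<integral>\<^sup>+t. ennreal (1/m) * (ennreal ((cmod (f (\<phi> (to_circle t))))\<^sup>2) * ennreal (\<Phi>' t)) \<partial>unit_measure)"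
    proof (rule nn_integral_mono)
      fix t
      have "(cmod (f (\<phi> (to_circle t))))\<^sup>2 * 1 \<le> (cmod (f (\<phi> (to_circle t))))\<^sup>2 * (1/m * \<Phi>' t)"
        using m by (intro mult_left_mono) (auto simp: field_simps)
      then have "(cmod (f (\<phi> (to_circle t))))\<^sup>2 \<le> 1/m * ((cmod (f (\<phi> (to_circle t))))\<^sup>2 * \<Phi>' t)"
        by (simp add: mult_ac)
      then have "ennreal ((cmod (f (\<phi> (to_circle t))))\<^sup>2) \<le> ennreal (1/m * ((cmod (f (\<phi> (to_circle t))))\<^sup>2 * \<Phi>' t))"
        by (rule ennreal_leI)
      also have "\<dots> = ennreal (1/m) * (ennreal ((cmod (f (\<phi> (to_circle t))))\<^sup>2) * ennreal (\<Phi>' t))"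
        using m(1) by (subst ennreal_mult') (simp_all add: ennreal_mult')
      finally show "ennreal ((cmod (f (\<phi> (to_circle t))))\<^sup>2)
          \<le> ennreal (1/m) * (ennreal ((cmod (f (\<phi> (to_circle t))))\<^sup>2) * ennreal (\<Phi>' t))" .
    qed
    also have "\<dots> = ennreal (1/m) * (\<integral>\<^sup>+t. ennreal ((cmod (f (\<phi> (to_circle t))))\<^sup>2) * ennreal (\<Phi>' t) \<partial>unit_measure)"
      by (rule nn_integral_cmult) measurable
    also have "\<dots> = ennreal (1/m) * (\<integral>\<^sup>+p. ennreal ((cmod (f p))\<^sup>2) \<partial>circle_measure)"
      by (subst nn_integral_circle_compose[OF L]) auto
    also have "(\<integral>\<^sup>+p. ennreal ((cmod (f p))\<^sup>2) \<partial>circle_measure) = ennreal ((norm (to_L2 f))\<^sup>2)"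
      unfolding norm_to_L2[OF f] using f by (intro nn_integral_eq_integral) (auto simp: square_integrable_def)
    also have "ennreal (1/m) * ennreal ((norm (to_L2 f))\<^sup>2) = ennreal ((sqrt (1/m) * norm (to_L2 f))\<^sup>2)"
      using m(1) by (subst ennreal_mult'[symmetric]) (simp_all add: power_mult_distrib power_divide real_sqrt_divide)
    finally have le: "(\<integral>\<^sup>+p. ennreal ((cmod (f (\<phi> p)))\<^sup>2) \<partial>circle_measure) \<le> ennreal ((sqrt (1/m) * norm (to_L2 f))\<^sup>2)" .
    have s: "square_integrable (\<lambda>p. f (\<phi> p))"
      unfolding square_integrable_def
    proof
      show "integrable circle_measure (\<lambda>p. (cmod (f (\<phi> p)))\<^sup>2)"
        using le_less_trans[OF le] by (intro integrableI_bounded) auto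
    qed measurable
    have "ennreal ((norm (to_L2 (\<lambda>p. f (\<phi> p))))\<^sup>2) = (\<integral>\<^sup>+p. ennreal ((cmod (f (\<phi> p)))\<^sup>2) \<partial>circle_measure)"
      unfolding norm_to_L2[OF s] using s by (intro nn_integral_eq_integral[symmetric]) (auto simp: square_integrable_def)
    with le have "ennreal ((norm (to_L2 (\<lambda>p. f (\<phi> p))))\<^sup>2) \<le> ennreal ((sqrt (1/m) * norm (to_L2 f))\<^sup>2)"
      by (simp only:)
    then have "(norm (to_L2 (\<lambda>p. f (\<phi> p))))\<^sup>2 \<le> (sqrt (1/m) * norm (to_L2 f))\<^sup>2"
      by (subst (asm) ennreal_le_iff) auto
    then have "norm (to_L2 (\<lambda>p. f (\<phi> p))) \<le> sqrt (1/m) * norm (to_L2 f)"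
      by (rule power2_le_imp_le) (use m(1) in simp)
    with s show ?thesis by blast
  qed
  show ?thesis
    by (rule that[of "sqrt (1/m)"]) (use m(1) main in auto)
qed

section \<open>The operators w C\<close>

definition wcomp :: "(circle \<Rightarrow> complex) \<Rightarrow> (circle \<Rightarrow> circle) \<Rightarrow> L2_circle \<Rightarrow> L2_circle"
  where "wcomp w \<phi> \<xi> = to_L2 (\<lambda>p. w p * rep_L2 \<xi> (\<phi> p))"

lemma square_integrable_wcomp:
  assumes L: "lifts_to \<phi> \<Phi> \<Phi>'" and w: "continuous_on UNIV w" and f: "square_integrable f"
  shows "square_integrable (\<lambda>p. w p * f (\<phi> p))"
proof -
  obtain C where "\<And>p. cmod (w p) \<le> C"
    using continuous_circle_bounded[OF w] by blast
  moreover have "square_integrable (\<lambda>p. f (\<phi> p))"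
    using compose_bounded[OF L] f by metis
  ultimately show ?thesis
    by (intro square_integrable_bounded_mult(1)[of w C] borel_measurable_continuous_onI w)
qed

lemma wcomp_to_L2:
  assumes L: "lifts_to \<phi> \<Phi> \<Phi>'" and w: "continuous_on UNIV w" and f: "square_integrable f"
  shows "wcomp w \<phi> (to_L2 f) = to_L2 (\<lambda>p. w p * f (\<phi> p))"
  unfolding wcomp_def
  using AE_circle_compose[OF L rep_to_L2[OF f]]
  by (intro to_L2_cong_AE square_integrable_wcomp[OF L w] square_integrable_rep f) (auto elim: eventually_mono)

lemma wcomp_add:
  assumes L: "lifts_to \<phi> \<Phi> \<Phi>'" and w: "continuous_on UNIV w"
  shows "wcomp w \<phi> (\<xi> + \<eta>) = wcomp w \<phi> \<xi> + wcomp w \<phi> \<eta>"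
proof -
  note r = square_integrable_rep[of \<xi>] square_integrable_rep[of \<eta>]
  have "wcomp w \<phi> (\<xi> + \<eta>) = wcomp w \<phi> (to_L2 (\<lambda>p. rep_L2 \<xi> p + rep_L2 \<eta> p))"
    using to_L2_add[OF r] by simp
  also have "\<dots> = to_L2 (\<lambda>p. w p * rep_L2 \<xi> (\<phi> p) + w p * rep_L2 \<eta> (\<phi> p))"
    by (subst wcomp_to_L2[OF L w square_integrable_add[OF r]]) (simp add: distrib_left)
  also have "\<dots> = wcomp w \<phi> \<xi> + wcomp w \<phi> \<eta>"
    unfolding wcomp_def by (rule to_L2_add[symmetric]) (intro square_integrable_wcomp[OF L w] r)+
  finally show ?thesis .
qed

lemma wcomp_scaleC:
  assumes L: "lifts_to \<phi> \<Phi> \<Phi>'" and w: "continuous_on UNIV w"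
  shows "wcomp w \<phi> (c *\<^sub>C \<xi>) = c *\<^sub>C wcomp w \<phi> \<xi>"
proof -
  note r = square_integrable_rep[of \<xi>]
  have "wcomp w \<phi> (c *\<^sub>C \<xi>) = wcomp w \<phi> (to_L2 (\<lambda>p. c * rep_L2 \<xi> p))"
    using to_L2_scale[OF r, of c] by simp
  also have "\<dots> = to_L2 (\<lambda>p. c * (w p * rep_L2 \<xi> (\<phi> p)))"
    by (subst wcomp_to_L2[OF L w square_integrable_scale[OF r]]) (simp add: mult_ac)
  also have "\<dots> = c *\<^sub>C wcomp w \<phi> \<xi>"
    unfolding wcomp_def by (rule to_L2_scale[symmetric]) (intro square_integrable_wcomp[OF L w] r)
  finally show ?thesis .
qed

lemma wcomp_diff:
  assumes L: "lifts_to \<phi> \<Phi> \<Phi>'" and w: "continuous_on UNIV w"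
  shows "wcomp w \<phi> (\<xi> - \<eta>) = wcomp w \<phi> \<xi> - wcomp w \<phi> \<eta>"
  by (simp add: minus_eq_scaleC wcomp_add[OF assms] wcomp_scaleC[OF assms])

lemma wcomp_zero:
  assumes L: "lifts_to \<phi> \<Phi> \<Phi>'" and w: "continuous_on UNIV w"
  shows "wcomp w \<phi> 0 = 0"
  using wcomp_scaleC[OF assms, of 0 0] by simp

lemma wcomp_sum:
  assumes L: "lifts_to \<phi> \<Phi> \<Phi>'" and w: "continuous_on UNIV w"
  shows "wcomp w \<phi> (\<Sum>i\<in>A. f i) = (\<Sum>i\<in>A. wcomp w \<phi> (f i))"
  by (induction A rule: infinite_finite_induct) (auto simp: wcomp_add[OF assms] wcomp_zero[OF assms])

lemma wcomp_bounded:
  assumes L: "lifts_to \<phi> \<Phi> \<Phi>'" and w: "continuous_on UNIV w"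
  obtains C where "C \<ge> 0" "\<And>\<xi>. norm (wcomp w \<phi> \<xi>) \<le> C * norm \<xi>"
proof -
  obtain K where K: "\<And>p. cmod (w p) \<le> K"
    using continuous_circle_bounded[OF w] by blast
  have K0: "0 \<le> K" using order_trans[OF norm_ge_zero K] .
  obtain C where C: "C \<ge> 0" "\<And>f. square_integrable f \<Longrightarrow> square_integrable (\<lambda>p. f (\<phi> p))"
    "\<And>f. square_integrable f \<Longrightarrow> norm (to_L2 (\<lambda>p. f (\<phi> p))) \<le> C * norm (to_L2 f)"
    using compose_bounded[OF L] by metis
  have "norm (wcomp w \<phi> \<xi>) \<le> K * C * norm \<xi>" for \<xi>
  proof -
    note r = square_integrable_rep[of \<xi>]
    have "norm (wcomp w \<phi> \<xi>) \<le> K * norm (to_L2 (\<lambda>p. rep_L2 \<xi> (\<phi> p)))"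
      unfolding wcomp_def
      by (rule square_integrable_bounded_mult(2)[OF borel_measurable_continuous_onI[OF w] K C(2)[OF r]])
    also have "\<dots> \<le> K * (C * norm \<xi>)"
      using C(3)[OF r] by (intro mult_left_mono K0) simp
    finally show ?thesis by simp
  qed
  then show ?thesis using that[of "K * C"] K0 C(1) by simp
qed

lemma tendsto_bounded_additive:
  fixes T :: "L2_circle \<Rightarrow> L2_circle"
  assumes diff: "\<And>\<xi> \<eta>. T (\<xi> - \<eta>) = T \<xi> - T \<eta>" and C: "\<And>\<xi>. norm (T \<xi>) \<le> C * norm \<xi>"
    and X: "(X \<longlongrightarrow> \<xi>) F"
  shows "((\<lambda>k. T (X k)) \<longlongrightarrow> T \<xi>) F"
proof -
  have "((\<lambda>k. C * norm (X k - \<xi>)) \<longlongrightarrow> 0) F"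
    using tendsto_mult_right_zero[OF tendsto_norm_zero[OF LIM_zero[OF X]]] .
  then have "((\<lambda>k. T (X k) - T \<xi>) \<longlongrightarrow> 0) F"
    by (rule Lim_null_comparison[rotated]) (use C in \<open>auto simp: diff[symmetric]\<close>)
  then show ?thesis by (rule LIM_zero_cancel)
qed

lemma tendsto_wcomp:
  assumes L: "lifts_to \<phi> \<Phi> \<Phi>'" and w: "continuous_on UNIV w" and X: "(X \<longlongrightarrow> \<xi>) F"
  shows "((\<lambda>k. wcomp w \<phi> (X k)) \<longlongrightarrow> wcomp w \<phi> \<xi>) F"
proof -
  obtain C where "\<And>\<xi>. norm (wcomp w \<phi> \<xi>) \<le> C * norm \<xi>"
    using wcomp_bounded[OF L w] by blast
  then show ?thesis
    by (rule tendsto_bounded_additive[OF wcomp_diff[OF L w] _ X])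
qed

lemma wcomp_factor:
  assumes L: "lifts_to \<phi> \<Phi> \<Phi>'" and w: "continuous_on UNIV w" and v: "continuous_on UNIV v"
  shows "wcomp (\<lambda>p. w p * v p) \<phi> \<xi> = wcomp w id (wcomp v \<phi> \<xi>)"
proof -
  have "wcomp w id (wcomp v \<phi> \<xi>) = to_L2 (\<lambda>p. w p * (v (id p) * rep_L2 \<xi> (\<phi> (id p))))"
    unfolding wcomp_def[of v]
    using wcomp_to_L2[OF lifts_to_id w square_integrable_wcomp[OF L v square_integrable_rep]] by simp
  then show ?thesis
    by (simp add: wcomp_def mult.assoc)
qed

text \<open>The Leibniz and chain rules on the domain of \<open>D\<close>: they hold classically on trigonometric
  polynomials, and \<open>D\<close> is closed.\<close>

lemma wcomp_dirac:
  assumes L: "lifts_to \<phi> \<Phi> \<Phi>'" and w': "continuous_on UNIV w'" and \<delta>: "\<And>t. \<delta> (to_circle t) = of_real (\<Phi>' t)"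
    and d: "\<And>t. ((\<lambda>t. w (to_circle t)) has_vector_derivative w' (to_circle t)) (at t)"
    and \<xi>: "(\<xi>, \<zeta>) \<in> dirac"
  shows "(wcomp w \<phi> \<xi>, wcomp (\<lambda>p. \<delta> p * w p) \<phi> \<zeta> + wcomp (\<lambda>p. w' p / \<i>) \<phi> \<xi>) \<in> dirac"
proof -
  have cw: "continuous_on UNIV w"
    by (rule circle_continuous_if_deriv[OF d])
  have c\<delta>: "continuous_on UNIV \<delta>"
    unfolding continuous_on_circle_iff \<delta> by (intro continuous_intros circle_liftD(2)[OF lifts_toD(1)[OF L]])
  define u where "u p = w' p / \<i>" for p
  have c1: "continuous_on UNIV (\<lambda>p. \<delta> p * w p)" "continuous_on UNIV u"
    unfolding u_def by (intro continuous_intros cw c\<delta> w'; simp)+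
  \<comment> \<open>The expected image, as a function of the pair (D\<xi>, \<xi>): it is additive
    and continuous in the pair although D is not continuous.\<close>
  define T where "T \<zeta> \<xi> = wcomp (\<lambda>p. \<delta> p * w p) \<phi> \<zeta> + wcomp u \<phi> \<xi>" for \<zeta> \<xi>
  have ee: "(wcomp w \<phi> (ee n), T (of_real (2 * pi * of_int n) *\<^sub>C ee n) (ee n)) \<in> dirac" for n
  proof -
    define v where "v p = w p * ce n (\<phi> p)" for p
    define v' where "v' p = w' p * ce n (\<phi> p) + w p * (of_real 1 * \<delta> p * (2 * pi * \<i> * of_int n * ce n (\<phi> p)))" for p
    have cce: "continuous_on UNIV (\<lambda>p. ce n (\<phi> p))"
      by (rule continuous_on_compose2[OF continuous_ce lifts_toD(3)[OF L]]) simp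
    have cv': "continuous_on UNIV v'"
      unfolding v'_def by (intro continuous_intros cw w' c\<delta> cce)
    have dv: "((\<lambda>t. v (to_circle t)) has_vector_derivative v' (to_circle t)) (at t)" for t
    proof -
      have "((\<lambda>t. fexp n (\<Phi> t)) has_vector_derivative \<Phi>' t *\<^sub>R (2 * pi * \<i> * of_int n * fexp n (\<Phi> t))) (at t)"
        using vector_diff_chain_at[OF _ fexp_has_vector_derivative, of \<Phi> "\<Phi>' t" t n]
          circle_liftD(1)[OF lifts_toD(1)[OF L], of t]
        by (simp add: o_def has_real_derivative_iff_has_vector_derivative)
      from has_vector_derivative_mult[OF d this] show ?thesis
        by (simp add: v_def v'_def lifts_toD(2)[OF L] \<delta> scaleR_conv_of_real algebra_simps)
    qed
    have "(to_L2 v, to_L2 (\<lambda>p. v' p / \<i>)) \<in> dirac"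
      by (rule C1_in_dirac[OF cv' dv])
    moreover have "to_L2 v = wcomp w \<phi> (ee n)"
      unfolding v_def ee_def wcomp_to_L2[OF L cw square_integrable_ce] ..
    moreover have "to_L2 (\<lambda>p. v' p / \<i>) = T (of_real (2 * pi * of_int n) *\<^sub>C ee n) (ee n)"
    proof -
      have "T (of_real (2 * pi * of_int n) *\<^sub>C ee n) (ee n)
        = to_L2 (\<lambda>p. (\<delta> p * w p) * (of_real (2 * pi * of_int n) * ce n (\<phi> p))) + to_L2 (\<lambda>p. u p * ce n (\<phi> p))"
        unfolding T_def ee_def to_L2_scale[OF square_integrable_ce]
          wcomp_to_L2[OF L c1(1) square_integrable_scale[OF square_integrable_ce]]
          wcomp_to_L2[OF L c1(2) square_integrable_ce] ..
      also have "\<dots> = to_L2 (\<lambda>p. (\<delta> p * w p) * (of_real (2 * pi * of_int n) * ce n (\<phi> p)) + u p * ce n (\<phi> p))"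
        by (rule to_L2_add)
           (rule square_integrable_wcomp[OF L c1(1) square_integrable_scale[OF square_integrable_ce]]
             square_integrable_wcomp[OF L c1(2) square_integrable_ce])+
      also have "(\<lambda>p. (\<delta> p * w p) * (of_real (2 * pi * of_int n) * ce n (\<phi> p)) + u p * ce n (\<phi> p)) = (\<lambda>p. v' p / \<i>)"
        by (simp add: v'_def u_def fun_eq_iff field_simps)
      finally show ?thesis by simp
    qed
    ultimately show ?thesis by simp
  qed
  define D where "D = mult_op (\<lambda>n. 2 * pi * of_int n)"
  have D: "dirac = D" by (simp add: D_def dirac_eq_mult_op)
  have T_add: "T (\<zeta> + \<zeta>') (\<xi> + \<xi>') = T \<zeta> \<xi> + T \<zeta>' \<xi>'" for \<zeta> \<zeta>' \<xi> \<xi>'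
    by (simp add: T_def wcomp_add[OF L c1(1)] wcomp_add[OF L c1(2)])
  have T_scale: "T (c *\<^sub>C \<zeta>) (c *\<^sub>C \<xi>) = c *\<^sub>C T \<zeta> \<xi>" for c \<zeta> \<xi>
    by (simp add: T_def wcomp_scaleC[OF L c1(1)] wcomp_scaleC[OF L c1(2)] scaleC_add_right)
  have T_sum: "T (\<Sum>i\<in>A. f i) (\<Sum>i\<in>A. g i) = (\<Sum>i\<in>A. T (f i) (g i))" for A and f g :: "int \<Rightarrow> L2_circle"
    by (simp add: T_def wcomp_sum[OF L c1(1)] wcomp_sum[OF L c1(2)] sum.distrib)
  have trig: "(wcomp w \<phi> (trig A c), T (trig A (\<lambda>n. of_real (2 * pi * of_int n) * c n)) (trig A c)) \<in> D" for A c
  proof -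
    have "(\<Sum>n\<in>A. wcomp w \<phi> (c n *\<^sub>C ee n), \<Sum>n\<in>A. T (c n *\<^sub>C of_real (2 * pi * of_int n) *\<^sub>C ee n) (c n *\<^sub>C ee n)) \<in> D"
      unfolding D_def T_scale wcomp_scaleC[OF L cw]
      by (intro mult_op_sum mult_op_scaleC) (use ee in \<open>simp add: D D_def\<close>)
    then show ?thesis
      by (simp add: trig_def wcomp_sum[OF L cw] T_sum mult.commute del: of_real_mult)
  qed
  \<comment> \<open>Hence the partial sums of \<zeta> are the images under D of those of \<xi>, and
    both sequences converge; closedness of the multiplier then applies.\<close>
  have fc\<zeta>: "fc \<zeta> = (\<lambda>n. of_real (2 * pi * of_int n) * fc \<xi> n)"
    using \<xi> by (auto simp: D D_def mult_op_iff fun_eq_iff)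
  have "(wcomp w \<phi> \<xi>, T \<zeta> \<xi>) \<in> D"
    unfolding D_def
  proof (rule mult_op_closed)
    show "(\<lambda>N. wcomp w \<phi> (trig (symm N) (fc \<xi>))) \<longlonglongrightarrow> wcomp w \<phi> \<xi>"
      by (intro tendsto_wcomp[OF L cw] fourier_series)
    show "(\<lambda>N. T (trig (symm N) (fc \<zeta>)) (trig (symm N) (fc \<xi>))) \<longlonglongrightarrow> T \<zeta> \<xi>"
      unfolding T_def by (intro tendsto_add tendsto_wcomp[OF L c1(1)] tendsto_wcomp[OF L c1(2)] fourier_series)
    show "(wcomp w \<phi> (trig (symm N) (fc \<xi>)), T (trig (symm N) (fc \<zeta>)) (trig (symm N) (fc \<xi>))) \<in> mult_op (\<lambda>n. 2 * pi * of_int n)" for N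
      unfolding fc\<zeta> using trig by (simp add: D_def)
  qed
  then show ?thesis unfolding D T_def u_def .
qed

section \<open>Functions of class \<open>C\<^sup>n\<close>\<close>

text \<open>The recursion on the order makes the closure properties provable by induction on n, for
  which \<open>smooth\<close>, with its whole sequence of derivatives given at once, is
  inconvenient.\<close>

primrec Cn :: "nat \<Rightarrow> (real \<Rightarrow> 'a::real_normed_vector) \<Rightarrow> bool" where
  "Cn 0 f \<longleftrightarrow> continuous_on UNIV f"
| "Cn (Suc n) f \<longleftrightarrow> (\<exists>f'. (\<forall>x. (f has_vector_derivative f' x) (at x)) \<and> Cn n f')"

lemma Cn_Suc_imp: "Cn (Suc n) f \<Longrightarrow> Cn n f"
proof (induction n arbitrary: f)
  case 0
  then show ?case
    by (auto intro!: continuous_at_imp_continuous_on intro: has_vector_derivative_continuous)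
next
  case (Suc n)
  then obtain f' where "\<forall>x. (f has_vector_derivative f' x) (at x)" "Cn (Suc n) f'"
    unfolding Cn.simps(2)[of "Suc n"] by blast
  then show ?case using Suc.IH by auto
qed

lemma Cn_imp_continuous: "Cn n f \<Longrightarrow> continuous_on UNIV f"
proof (induction n)
  case (Suc n)
  then show ?case using Cn_Suc_imp by blast
qed simp

lemma smooth_imp_Cn: "smooth f \<Longrightarrow> Cn n f"
proof -
  assume "smooth f"
  then obtain F where F: "F 0 = f" "\<And>n x. (F n has_vector_derivative F (Suc n) x) (at x)"
    unfolding smooth_def by blast
  have "Cn n (F m)" for m
  proof (induction n arbitrary: m)
    case 0
    then show ?case
      using has_vector_derivative_continuous[OF F(2)] by (auto intro!: continuous_at_imp_continuous_on)
  next
    case (Suc n)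
    then show ?case using F(2) by auto
  qed
  then show ?thesis using F(1) by metis
qed

lemma Cn_const: "Cn n (\<lambda>_. c)"
proof (induction n arbitrary: c)
  case (Suc n)
  then show ?case
    unfolding Cn.simps by (intro exI[of _ "\<lambda>_. 0"]) (auto intro: has_vector_derivative_const)
qed simp

lemma Cn_add:
  "Cn n f \<Longrightarrow> Cn n g \<Longrightarrow> Cn n (\<lambda>x. f x + g x)"
proof (induction n arbitrary: f g)
  case (Suc n)
  then obtain f' g' where "\<forall>x. (f has_vector_derivative f' x) (at x)" "Cn n f'"
    "\<forall>x. (g has_vector_derivative g' x) (at x)" "Cn n g'"
    by auto
  then show ?case
    unfolding Cn.simps
    by (intro exI[of _ "\<lambda>x. f' x + g' x"]) (auto intro!: has_vector_derivative_add Suc.IH)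
qed (auto intro: continuous_intros)

lemma Cn_mult:
  fixes f g :: "real \<Rightarrow> 'a::real_normed_algebra"
  shows "Cn n f \<Longrightarrow> Cn n g \<Longrightarrow> Cn n (\<lambda>x. f x * g x)"
proof (induction n arbitrary: f g)
  case (Suc n)
  then obtain f' g' where "\<forall>x. (f has_vector_derivative f' x) (at x)" "Cn n f'"
    "\<forall>x. (g has_vector_derivative g' x) (at x)" "Cn n g'"
    by auto
  moreover have "Cn n f" "Cn n g"
    using Suc.prems[THEN Cn_Suc_imp] .
  ultimately show ?case
    unfolding Cn.simps
    by (intro exI[of _ "\<lambda>x. f x * g' x + f' x * g x"])
       (auto intro!: has_vector_derivative_mult Cn_add Suc.IH)
qed (auto intro: continuous_intros)

lemma Cn_of_real:
  fixes f :: "real \<Rightarrow> real"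
  shows "Cn n f \<Longrightarrow> Cn n (\<lambda>x. complex_of_real (f x))"
proof (induction n arbitrary: f)
  case (Suc n)
  then obtain f' where "\<forall>x. (f has_vector_derivative f' x) (at x)" "Cn n f'"
    by auto
  then show ?case
    unfolding Cn.simps
    by (intro exI[of _ "\<lambda>x. of_real (f' x)"]) (auto simp: has_real_derivative_iff_has_vector_derivative intro!: has_vector_derivative_of_real Suc.IH)
qed (auto intro: continuous_intros)

text \<open>The derivative of r = g^(-1/2) is -g' r^3 / 2, a polynomial in g' and r, so the
  induction closes on r itself. The square root is then obtained as g r.\<close>

lemma Cn_inverse_sqrt:
  fixes g :: "real \<Rightarrow> real"
  assumes pos: "\<And>x. g x > 0"
  shows "Cn n g \<Longrightarrow> Cn n (\<lambda>x. inverse (sqrt (g x)))"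
proof (induction n)
  case 0
  then show ?case
    using pos by (auto intro!: continuous_intros simp: less_imp_neq[symmetric])
next
  case (Suc n)
  define r where "r x = inverse (sqrt (g x))" for x
  obtain g' where g': "\<forall>x. (g has_vector_derivative g' x) (at x)" "Cn n g'"
    using Suc.prems by auto
  have r: "Cn n r"
    unfolding r_def using Suc.IH Cn_Suc_imp[OF Suc.prems] .
  have "(r has_vector_derivative (- (1/2)) * (g' x * (r x * (r x * r x)))) (at x)" for x
  proof -
    have "(g has_real_derivative g' x) (at x)"
      using g'(1) by (simp add: has_real_derivative_iff_has_vector_derivative)
    then have "((\<lambda>x. inverse (sqrt (g x))) has_real_derivative
       - (inverse (sqrt (g x)) * (inverse (sqrt (g x)) / 2 * g' x) * inverse (sqrt (g x)))) (at x)"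
      using pos[of x] by (auto intro!: derivative_eq_intros)
    then show ?thesis
      by (simp add: r_def[abs_def] has_real_derivative_iff_has_vector_derivative mult_ac)
  qed
  moreover have "Cn n (\<lambda>x. (- (1/2)) * (g' x * (r x * (r x * r x))))"
    by (intro Cn_mult Cn_const r g')
  ultimately show ?case
    unfolding Cn.simps r_def[symmetric] by (intro exI conjI allI)
qed

lemma Cn_sqrt:
  fixes g :: "real \<Rightarrow> real"
  assumes pos: "\<And>x. g x > 0" and g: "Cn n g"
  shows "Cn n (\<lambda>x. sqrt (g x))"
proof -
  have "Cn n (\<lambda>x. g x * inverse (sqrt (g x)))"
    by (intro Cn_mult Cn_inverse_sqrt g pos)
  moreover have "g x * inverse (sqrt (g x)) = sqrt (g x)" for x
    using pos[of x] by (simp add: divide_inverse[symmetric] real_div_sqrt)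
  ultimately show ?thesis by simp
qed

definition circle_Cn :: "nat \<Rightarrow> (circle \<Rightarrow> complex) \<Rightarrow> bool"
  where "circle_Cn n w \<longleftrightarrow> Cn n (\<lambda>t. w (to_circle t))"

lemma circle_Cn_continuous: "circle_Cn n w \<Longrightarrow> continuous_on UNIV w"
  unfolding circle_Cn_def continuous_on_circle_iff by (rule Cn_imp_continuous)

text \<open>The derivative of a periodic function is periodic by uniqueness of derivatives, hence
  descends to the circle.\<close>

lemma circle_Cn_deriv:
  assumes "circle_Cn (Suc n) w"
  obtains w' where "circle_Cn n w'"
    "\<And>t. ((\<lambda>t. w (to_circle t)) has_vector_derivative w' (to_circle t)) (at t)"
proof -
  obtain f' where f': "\<And>t. ((\<lambda>t. w (to_circle t)) has_vector_derivative f' t) (at t)" "Cn n f'"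
    using assms by (auto simp: circle_Cn_def)
  have per: "f' (t + 1) = f' t" for t
  proof -
    have "((\<lambda>t. t + 1) has_vector_derivative 1) (at t)" for t :: real
      by (auto intro!: derivative_eq_intros)
    from vector_diff_chain_at[OF this f'(1)]
    have "((\<lambda>t. w (to_circle t)) has_vector_derivative f' (t + 1)) (at t)"
      by (simp add: o_def)
    then show ?thesis
      using f'(1) by (rule vector_derivative_unique_at)
  qed
  define w' where "w' p = f' (rep_circle p)" for p
  have w': "w' (to_circle t) = f' t" for t
    unfolding w'_def by (rule periodic_rep) (rule per)
  show ?thesis
    by (rule that[of w']) (use f' in \<open>auto simp: w' circle_Cn_def\<close>)
qed

section \<open>Commutators of \<open>|D|\<close> with multiplication operators\<close>

lemma fc_deriv:
  assumes w': "continuous_on UNIV w'"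
    and d: "\<And>t. ((\<lambda>t. w (to_circle t)) has_vector_derivative w' (to_circle t)) (at t)"
  shows "fc (to_L2 w') n = 2 * pi * \<i> * of_int n * fc (to_L2 w) n"
proof (rule fc_AC)
  show "square_integrable w"
    by (rule square_integrable_continuous[OF circle_continuous_if_deriv[OF d]])
  show "square_integrable w'" by (rule square_integrable_continuous[OF w'])
  show "((\<lambda>t. w' (to_circle t)) has_integral (w (to_circle y) - w (to_circle x))) {x..y}" if "x \<le> y" for x y
    using that by (intro fundamental_theorem_of_calculus has_vector_derivative_at_within[OF d])
qed

lemma symm_sum_Suc:
  fixes b :: "int \<Rightarrow> real"
  shows "(\<Sum>k\<in>symm (Suc N). b k) = b (int (Suc N)) + b (- int (Suc N)) + (\<Sum>k\<in>symm N. b k)"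
proof -
  have "symm (Suc N) = insert (int (Suc N)) (insert (- int (Suc N)) (symm N))"
    by auto
  then show ?thesis by simp
qed

text \<open>Three derivatives multiply the k-th coefficient by (2\<pi>ik)^3 and still give a bounded
  sequence. So 2\<pi>|k| times the coefficient of w is at most a constant over k^2, which is
  summable.\<close>

lemma C3_coeffs_summable:
  assumes "circle_Cn 3 w"
  obtains M where "M \<ge> 0" "\<And>N. (\<Sum>k\<in>symm N. cmod (fc (to_L2 w) k) * (2 * pi * \<bar>of_int k\<bar>)) \<le> M"
proof -
  have "circle_Cn (Suc (Suc (Suc 0))) w" using assms by (simp add: numeral_3_eq_3)
  then obtain w1 where w1: "circle_Cn (Suc (Suc 0)) w1" "\<And>t. ((\<lambda>t. w (to_circle t)) has_vector_derivative w1 (to_circle t)) (at t)"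
    using circle_Cn_deriv by blast
  obtain w2 where w2: "circle_Cn (Suc 0) w2" "\<And>t. ((\<lambda>t. w1 (to_circle t)) has_vector_derivative w2 (to_circle t)) (at t)"
    using circle_Cn_deriv[OF w1(1)] by blast
  obtain w3 where w3: "circle_Cn 0 w3" "\<And>t. ((\<lambda>t. w2 (to_circle t)) has_vector_derivative w3 (to_circle t)) (at t)"
    using circle_Cn_deriv[OF w2(1)] by blast
  define K where "K = norm (to_L2 w3)"
  have K: "K \<ge> 0" by (simp add: K_def)
  define b where "b k = cmod (fc (to_L2 w) k) * (2 * pi * \<bar>of_int k\<bar>)" for k
  have "cmod (fc (to_L2 w3) k) = b k * (2 * pi * \<bar>of_int k\<bar>)\<^sup>2" for k
    unfolding fc_deriv[OF circle_Cn_continuous[OF w3(1)] w3(2)] fc_deriv[OF circle_Cn_continuous[OF w2(1)] w2(2)]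
      fc_deriv[OF circle_Cn_continuous[OF w1(1)] w1(2)]
    by (simp add: norm_mult b_def power2_eq_square mult_ac)
  then have b3: "b k * (2 * pi * \<bar>of_int k\<bar>)\<^sup>2 \<le> K" for k
    using cmod_fc_le[of "to_L2 w3" k] by (simp add: K_def)
  have b0: "b k \<ge> 0" for k by (simp add: b_def)
  have b: "b k \<le> K * inverse ((real (Suc m))\<^sup>2)" if "\<bar>k\<bar> = int (Suc m)" for k m
  proof -
    have k: "\<bar>of_int k\<bar> = real (Suc m)"
      using that by (metis of_int_abs of_int_of_nat_eq)
    have "b k * (real (Suc m))\<^sup>2 \<le> b k * (2 * pi * \<bar>of_int k\<bar>)\<^sup>2"
      unfolding k using pi_gt3 by (intro mult_left_mono power_mono b0) auto
    also have "\<dots> \<le> K" by (rule b3)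
    finally show ?thesis by (simp add: field_simps)
  qed
  \<comment> \<open>The factor 2 counts k and -k for |k| = m + 1; the index k = 0 contributes
    0.\<close>
  have sum: "summable (\<lambda>m. 2 * (K * inverse ((real (Suc m))\<^sup>2)))"
    using inverse_power_summable[of 2, where 'a=real]
    by (intro summable_mult) (subst summable_Suc_iff, simp)
  have "(\<Sum>k\<in>symm N. b k) \<le> (\<Sum>m<N. 2 * (K * inverse ((real (Suc m))\<^sup>2)))" for N
  proof (induction N)
    case 0
    then show ?case by (simp add: b_def)
  next
    case (Suc N)
    show ?case
      unfolding symm_sum_Suc sum.lessThan_Suc
      using Suc b[of "int (Suc N)" N] b[of "- int (Suc N)" N] by simp
  qed
  also have "(\<Sum>m<N. 2 * (K * inverse ((real (Suc m))\<^sup>2))) \<le> (\<Sum>m. 2 * (K * inverse ((real (Suc m))\<^sup>2)))" for N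
    using K by (intro sum_le_suminf sum) auto
  finally show ?thesis
    using that[of "\<Sum>m. 2 * (K * inverse ((real (Suc m))\<^sup>2))"] suminf_nonneg[OF sum] K by (simp add: b_def)
qed

lemma fc_mult_ce: "fc (wcomp (ce k) id \<xi>) n = fc \<xi> (n - k)"
proof -
  note r = square_integrable_rep[of \<xi>]
  have "fc (wcomp (ce k) id \<xi>) n = (\<integral>t. ce k (to_circle t) * rep_L2 \<xi> (id (to_circle t)) * fexp (- n) t \<partial>unit_measure)"
    unfolding wcomp_def by (rule fc_to_L2[OF square_integrable_wcomp[OF lifts_to_id continuous_ce r]])
  also have "\<dots> = (\<integral>t. rep_L2 \<xi> (to_circle t) * fexp (- (n - k)) t \<partial>unit_measure)"
    using fexp_add[of k "- n"] by (intro Bochner_Integration.integral_cong) auto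
  also have "\<dots> = fc \<xi> (n - k)"
    using fc_to_L2[OF r] by simp
  finally show ?thesis .
qed

lemma norm_mult_ce: "norm (wcomp (ce k) id \<xi>) \<le> norm \<xi>"
  using square_integrable_bounded_mult(2)[OF measurable_ce, of k 1 "rep_L2 \<xi>"]
  by (simp add: wcomp_def square_integrable_rep)

text \<open>For fixed \<xi> and n, the n-th coefficient of w\<xi> is the inner product of w with the
  fixed vector \<open>ce n\<close> times the conjugate of \<xi>. It is thus continuous in w for the
  L^2 norm, so the Fourier series of w may be inserted term by term.\<close>

lemma fc_mult_series:
  assumes w: "continuous_on UNIV w"
  shows "(\<lambda>N. \<Sum>k\<in>symm N. fc (to_L2 w) k * fc (wcomp (ce k) id \<xi>) n) \<longlonglongrightarrow> fc (wcomp w id \<xi>) n"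
proof -
  note r = square_integrable_rep[of \<xi>]
  define f where "f p = cnj (rep_L2 \<xi> p)" for p
  have f: "square_integrable f"
    using r unfolding f_def square_integrable_def complex_mod_cnj by simp
  define \<eta> where "\<eta> = to_L2 (\<lambda>p. ce n p * f p)"
  have s\<eta>: "square_integrable (\<lambda>p. ce n p * f p)"
    using square_integrable_wcomp[OF lifts_to_id continuous_ce f] by simp
  have *: "cinner (to_L2 v) \<eta> = fc (wcomp v id \<xi>) n" if v: "continuous_on UNIV v" for v
  proof -
    have "cinner (to_L2 v) \<eta> = (\<integral>p. v p * cnj (ce n p * f p) \<partial>circle_measure)"
      unfolding \<eta>_def by (rule cinner_to_L2[OF square_integrable_continuous[OF v] s\<eta>])
    also have "\<dots> = (\<integral>p. v p * rep_L2 \<xi> (id p) * cnj (ce n p) \<partial>circle_measure)"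
      by (simp add: f_def mult_ac)
    also have "\<dots> = fc (wcomp v id \<xi>) n"
      unfolding wcomp_def fc_def ee_def
      by (rule cinner_to_L2[OF square_integrable_wcomp[OF lifts_to_id v r] square_integrable_ce, symmetric])
    finally show ?thesis .
  qed
  have "(\<lambda>N. cinner (trig (symm N) (fc (to_L2 w))) \<eta>) \<longlonglongrightarrow> cinner (to_L2 w) \<eta>"
    by (intro tendsto_cinner_left fourier_series)
  moreover have "cinner (trig (symm N) c) \<eta> = (\<Sum>k\<in>symm N. c k * fc (wcomp (ce k) id \<xi>) n)" for N c
    unfolding trig_def cinner_sum_left cinner_scaleC_left using *[OF continuous_ce] by (simp add: ee_def)
  ultimately show ?thesis
    by (simp add: *[OF w])
qed

text \<open>A single character shifts coefficients by k, so its commutator with |D| is bounded by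
  2\<pi>|k|, the triangle inequality applied to |n| and |n - k|. Weighted by the coefficients of w
  these bounds have bounded partial sums. The series of commutators is matched with the commutator
  of w coefficient by coefficient.\<close>

lemma multiplication_abs_commutator:
  assumes w: "circle_Cn 3 w"
  obtains M where "M \<ge> 0"
    "\<And>\<xi> \<eta> \<eta>'. (\<xi>, \<eta>) \<in> mult_op (\<lambda>n. 2 * pi * \<bar>of_int n\<bar>) \<Longrightarrow>
      (wcomp w id \<xi>, \<eta>') \<in> mult_op (\<lambda>n. 2 * pi * \<bar>of_int n\<bar>) \<Longrightarrow>
      norm (\<eta>' - wcomp w id \<eta>) \<le> M * norm \<xi>"
proof -
  obtain M where M: "M \<ge> 0" "\<And>N. (\<Sum>k\<in>symm N. cmod (fc (to_L2 w) k) * (2 * pi * \<bar>of_int k\<bar>)) \<le> M"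
    using C3_coeffs_summable[OF w] by blast
  have "norm (\<eta>' - wcomp w id \<eta>) \<le> M * norm \<xi>"
    if \<xi>: "(\<xi>, \<eta>) \<in> mult_op (\<lambda>n. 2 * pi * \<bar>of_int n\<bar>)"
      and w\<xi>: "(wcomp w id \<xi>, \<eta>') \<in> mult_op (\<lambda>n. 2 * pi * \<bar>of_int n\<bar>)" for \<xi> \<eta> \<eta>'
  proof -
    have fc\<eta>: "fc \<eta> n = of_real (2 * pi * \<bar>of_int n\<bar>) * fc \<xi> n" for n
      using \<xi> by (simp add: mult_op_iff)
    have fc\<eta>': "fc \<eta>' n = of_real (2 * pi * \<bar>of_int n\<bar>) * fc (wcomp w id \<xi>) n" for n
      using w\<xi> by (simp add: mult_op_iff)
    define c where "c k n = of_real (2 * pi * (\<bar>of_int n\<bar> - \<bar>of_int (n - k)\<bar>)) * fc (wcomp (ce k) id \<xi>) n" for k n :: int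
    have cle: "cmod (c k n) \<le> (2 * pi * \<bar>of_int k\<bar>) * cmod (fc (wcomp (ce k) id \<xi>) n)" for k n
    proof -
      have "\<bar>\<bar>real_of_int n\<bar> - \<bar>of_int (n - k)\<bar>\<bar> \<le> \<bar>of_int k\<bar>"
        using abs_triangle_ineq3[of "real_of_int n" "of_int (n - k)"] by simp
      then have "\<bar>2 * pi * (\<bar>real_of_int n\<bar> - \<bar>of_int (n - k)\<bar>)\<bar> \<le> 2 * pi * \<bar>of_int k\<bar>"
        by (simp add: abs_mult)
      then show ?thesis
        unfolding c_def norm_mult norm_of_real by (rule mult_right_mono) simp
    qed
    then have "\<exists>E. fc E = c k" for k
      using multiplier_exists[OF cle, of k] by metis
    \<comment> \<open>\<open>E k\<close> is the commutator of |D| with multiplication by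
      \<open>ce k\<close>, applied to \<xi>; \<open>c_eq\<close> below confirms this.\<close>
    then obtain E where E: "\<And>k. fc (E k) = c k" by metis
    have E_norm: "norm (E k) \<le> (2 * pi * \<bar>of_int k\<bar>) * norm \<xi>" for k
    proof -
      have "norm (E k) \<le> (2 * pi * \<bar>of_int k\<bar>) * norm (wcomp (ce k) id \<xi>)"
        by (rule norm_le_if_fc_le) (use cle in \<open>auto simp: E\<close>)
      also have "\<dots> \<le> (2 * pi * \<bar>of_int k\<bar>) * norm \<xi>"
        by (intro mult_left_mono norm_mult_ce) auto
      finally show ?thesis .
    qed
    have c_eq: "c k n = of_real (2 * pi * \<bar>of_int n\<bar>) * fc (wcomp (ce k) id \<xi>) n - fc (wcomp (ce k) id \<eta>) n" for k n
      by (simp add: c_def fc_mult_ce fc\<eta> algebra_simps)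
    define a where "a = fc (to_L2 w)"
    define X where "X N = (\<Sum>k\<in>symm N. a k *\<^sub>C E k)" for N
    show ?thesis
    proof (rule norm_le_if_fc_tendsto)
      fix N
      have "norm (X N) \<le> (\<Sum>k\<in>symm N. norm (a k *\<^sub>C E k))"
        unfolding X_def by (rule norm_sum)
      also have "\<dots> \<le> (\<Sum>k\<in>symm N. cmod (a k) * (2 * pi * \<bar>of_int k\<bar>) * norm \<xi>)"
        unfolding norm_scaleC mult.assoc using E_norm by (intro sum_mono mult_left_mono) (simp_all add: mult.assoc)
      also have "\<dots> = (\<Sum>k\<in>symm N. cmod (a k) * (2 * pi * \<bar>of_int k\<bar>)) * norm \<xi>"
        by (simp add: sum_distrib_right)
      also have "\<dots> \<le> M * norm \<xi>"
        using M(2)[of N] by (intro mult_right_mono) (auto simp: a_def)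
      finally show "norm (X N) \<le> M * norm \<xi>" .
    next
      fix n
      have cw: "continuous_on UNIV w" by (rule circle_Cn_continuous[OF w])
      have "fc (X N) n = of_real (2 * pi * \<bar>of_int n\<bar>) * (\<Sum>k\<in>symm N. a k * fc (wcomp (ce k) id \<xi>) n)
          - (\<Sum>k\<in>symm N. a k * fc (wcomp (ce k) id \<eta>) n)" for N
        unfolding X_def fc_sum fc_scaleC E c_eq sum_distrib_left sum_subtractf[symmetric]
        by (intro sum.cong) (simp_all add: algebra_simps)
      moreover have "(\<lambda>N. of_real (2 * pi * \<bar>of_int n\<bar>) * (\<Sum>k\<in>symm N. a k * fc (wcomp (ce k) id \<xi>) n)
          - (\<Sum>k\<in>symm N. a k * fc (wcomp (ce k) id \<eta>) n))
        \<longlonglongrightarrow> of_real (2 * pi * \<bar>of_int n\<bar>) * fc (wcomp w id \<xi>) n - fc (wcomp w id \<eta>) n"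
        unfolding a_def by (intro tendsto_intros fc_mult_series cw)
      ultimately show "(\<lambda>N. fc (X N) n) \<longlonglongrightarrow> fc (\<eta>' - wcomp w id \<eta>) n"
        by (simp add: fc_diff fc\<eta>')
    qed
  qed
  with M(1) that show ?thesis by blast
qed

section \<open>The kernel \<open>1 / sin\<^sup>2 \<pi>(u - v)\<close> under a diffeomorphism\<close>

lemma abs_sin_minus_self_le: "\<bar>sin x - x\<bar> \<le> \<bar>x\<bar> ^ 3 / 6" for x :: real
proof -
  have "(\<Sum>m<3. sin_coeff m * x ^ m) = x"
    by (simp add: numeral_3_eq_3 sin_coeff_def)
  then show ?thesis
    using Maclaurin_sin_bound[of x 3] by (simp add: fact_numeral)
qed

text \<open>With x = \<pi>\<delta> and \<pi> < 3.2 one has |x| \<le> 8/5. The cubic error of sin x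
  is then at most |x| (8/5)^2 / 6 \<le> |x| / 2, which leaves |sin x| \<ge> |x| / 2 \<ge>
  |\<delta>|. This compares the distance on the circle with half the chord.\<close>

lemma abs_le_abs_sin_pi:
  assumes "\<bar>\<delta>\<bar> \<le> 1/2"
  shows "\<bar>\<delta>\<bar> \<le> \<bar>sin (pi * \<delta>)\<bar>"
proof -
  define x where "x = pi * \<delta>"
  have x: "\<bar>x\<bar> \<le> 8/5"
  proof -
    have "\<bar>x\<bar> = pi * \<bar>\<delta>\<bar>" by (simp add: x_def abs_mult)
    also have "\<dots> \<le> 3.2 * (1/2)"
      using pi_approx assms by (intro mult_mono) auto
    finally show ?thesis by simp
  qed
  have "\<bar>x\<bar> ^ 3 = \<bar>x\<bar>\<^sup>2 * \<bar>x\<bar>" by (simp add: power2_eq_square power3_eq_cube)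
  also have "\<dots> \<le> (8/5)\<^sup>2 * \<bar>x\<bar>"
    by (intro mult_right_mono power_mono x) auto
  finally have "\<bar>x\<bar> ^ 3 / 6 \<le> \<bar>x\<bar> / 2"
    by (simp add: power2_eq_square)
  then have "\<bar>x\<bar> / 2 \<le> \<bar>sin x\<bar>"
    using abs_sin_minus_self_le[of x] by linarith
  moreover have "\<bar>\<delta>\<bar> \<le> \<bar>x\<bar> / 2"
  proof -
    have "2 * \<bar>\<delta>\<bar> \<le> pi * \<bar>\<delta>\<bar>" using pi_gt3 by (intro mult_right_mono) auto
    then show ?thesis by (simp add: x_def abs_mult)
  qed
  ultimately show ?thesis by (simp add: x_def)
qed

lemma sin_sq_minus_sq_le: "\<bar>(sin x)\<^sup>2 - x\<^sup>2\<bar> \<le> x ^ 4" for x :: real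
proof -
  have "\<bar>(sin x)\<^sup>2 - x\<^sup>2\<bar> = \<bar>sin x - x\<bar> * \<bar>sin x + x\<bar>"
    by (simp add: abs_mult[symmetric] power2_eq_square algebra_simps)
  also have "\<dots> \<le> (\<bar>x\<bar> ^ 3 / 6) * (2 * \<bar>x\<bar>)"
  proof (intro mult_mono abs_sin_minus_self_le)
    show "\<bar>sin x + x\<bar> \<le> 2 * \<bar>x\<bar>"
      using abs_sin_x_le_abs_x[of x] by linarith
  qed auto
  also have "\<dots> = x ^ 4 / 3"
  proof -
    have "\<bar>x\<bar> * \<bar>x\<bar> ^ 3 = \<bar>x\<bar> ^ 4" by (simp add: power_eq_if)
    then show ?thesis by simp
  qed
  also have "\<dots> \<le> x ^ 4" by simp
  finally show ?thesis .
qed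

lemma sin_sq_pi_add_int: "(sin (pi * (x + of_int k)))\<^sup>2 = (sin (pi * x))\<^sup>2"
  by (rule periodic_int[of "\<lambda>x. (sin (pi * x))\<^sup>2"]) (simp add: distrib_left)

lemma sin_pi_ge_min:
  assumes "0 \<le> \<Delta>" "\<Delta> \<le> 1"
  shows "min \<Delta> (1 - \<Delta>) \<le> \<bar>sin (pi * \<Delta>)\<bar>"
proof (cases "\<Delta> \<le> 1/2")
  case True
  then show ?thesis using abs_le_abs_sin_pi[of \<Delta>] assms by simp
next
  case False
  have "sin (pi * (1 - \<Delta>)) = sin (pi * \<Delta>)"
    by (simp add: right_diff_distrib sin_diff)
  then show ?thesis using abs_le_abs_sin_pi[of "1 - \<Delta>"] assms False by simp
qed

text \<open>Here a and b stand for \<Phi>' v and \<Phi>'' v, \<delta> for u - v, and r and s for the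
  Taylor remainders of \<Phi>' u and of \<Phi> u - \<Phi> v. The expression is \<Phi>' u \<Phi>' v
  \<delta>^2 - (\<Phi> u - \<Phi> v)^2; its terms of order \<delta>^2 and \<delta>^3 cancel, and
  order \<delta>^4 is what the denominator sin^2 sin^2 can absorb.\<close>

lemma schwarzian_numerator_bound:
  fixes a b r s \<delta> M M2 M3 :: real
  assumes \<delta>: "0 \<le> \<delta>" "\<delta> \<le> 1" and a: "\<bar>a\<bar> \<le> M" and b: "\<bar>b\<bar> \<le> M2"
    and r: "\<bar>r\<bar> \<le> M3 * \<delta>\<^sup>2" and s: "\<bar>s\<bar> \<le> M3 * \<delta> ^ 3"
  shows "\<bar>(a + b * \<delta> + r) * a * \<delta>\<^sup>2 - (a * \<delta> + b / 2 * \<delta>\<^sup>2 + s)\<^sup>2\<bar>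
    \<le> (M * M3 + M2\<^sup>2 + 2 * M3 * (M + M2) + M3\<^sup>2) * \<delta> ^ 4"
proof -
  have M: "0 \<le> M" "0 \<le> M2" using a b by auto
  have M3: "0 \<le> M3 * \<delta> ^ 3" "0 \<le> M3 * \<delta>\<^sup>2"
    using order_trans[OF abs_ge_zero s] order_trans[OF abs_ge_zero r] by auto
  have eq: "(a + b * \<delta> + r) * a * \<delta>\<^sup>2 - (a * \<delta> + b / 2 * \<delta>\<^sup>2 + s)\<^sup>2
     = a * r * \<delta>\<^sup>2 - (b / 2 * \<delta>\<^sup>2)\<^sup>2 - 2 * s * (a * \<delta> + b / 2 * \<delta>\<^sup>2) - s\<^sup>2"
    by (simp add: power2_eq_square algebra_simps)
  have 1: "\<bar>a * r * \<delta>\<^sup>2\<bar> \<le> M * M3 * \<delta> ^ 4"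
  proof -
    have "\<bar>a * r * \<delta>\<^sup>2\<bar> = \<bar>a\<bar> * \<bar>r\<bar> * \<delta>\<^sup>2" by (simp add: abs_mult)
    also have "\<dots> \<le> M * (M3 * \<delta>\<^sup>2) * \<delta>\<^sup>2"
      by (intro mult_mono a r) (use M M3 in auto)
    also have "\<dots> = M * M3 * \<delta> ^ 4" by (simp add: power_eq_if)
    finally show ?thesis .
  qed
  have 2: "\<bar>(b / 2 * \<delta>\<^sup>2)\<^sup>2\<bar> \<le> M2\<^sup>2 * \<delta> ^ 4"
  proof -
    have "\<bar>b / 2 * \<delta>\<^sup>2\<bar> \<le> M2 * \<delta>\<^sup>2"
      unfolding abs_mult using b M by (intro mult_mono) auto
    then have "\<bar>b / 2 * \<delta>\<^sup>2\<bar>\<^sup>2 \<le> (M2 * \<delta>\<^sup>2)\<^sup>2"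
      by (rule power_mono) simp
    also have "\<dots> = M2\<^sup>2 * \<delta> ^ 4" by (simp add: power_mult_distrib)
    finally show ?thesis by (simp only: power2_abs abs_of_nonneg[OF zero_le_power2])
  qed
  have 3: "\<bar>2 * s * (a * \<delta> + b / 2 * \<delta>\<^sup>2)\<bar> \<le> 2 * M3 * (M + M2) * \<delta> ^ 4"
  proof -
    have d2: "\<delta>\<^sup>2 \<le> \<delta>" using \<delta> by (simp add: power2_eq_square mult_left_le)
    have "\<bar>a * \<delta> + b / 2 * \<delta>\<^sup>2\<bar> \<le> \<bar>a\<bar> * \<delta> + \<bar>b\<bar> / 2 * \<delta>\<^sup>2"
      using abs_triangle_ineq[of "a * \<delta>" "b / 2 * \<delta>\<^sup>2"] \<delta> by (simp add: abs_mult)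
    also have "\<dots> \<le> M * \<delta> + M2 * \<delta>"
      using a b M \<delta> d2 by (intro add_mono mult_mono) auto
    finally have "\<bar>a * \<delta> + b / 2 * \<delta>\<^sup>2\<bar> \<le> (M + M2) * \<delta>" by (simp add: algebra_simps)
    then have "\<bar>s\<bar> * \<bar>a * \<delta> + b / 2 * \<delta>\<^sup>2\<bar> \<le> (M3 * \<delta> ^ 3) * ((M + M2) * \<delta>)"
      by (intro mult_mono s) (use M3 in auto)
    also have "\<dots> = M3 * (M + M2) * \<delta> ^ 4" by (simp add: power_eq_if)
    finally show ?thesis by (simp add: abs_mult)
  qed
  have 4: "\<bar>s\<^sup>2\<bar> \<le> M3\<^sup>2 * \<delta> ^ 4"
  proof -
    have "\<bar>s\<bar>\<^sup>2 \<le> (M3 * \<delta> ^ 3)\<^sup>2" by (rule power_mono[OF s]) simp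
    also have "\<dots> = M3\<^sup>2 * \<delta> ^ 6" by (simp add: power_mult_distrib power_mult[symmetric])
    also have "\<dots> \<le> M3\<^sup>2 * \<delta> ^ 4"
      using \<delta> by (intro mult_left_mono power_decreasing) auto
    finally show ?thesis by simp
  qed
  show ?thesis
    unfolding eq using 1 2 3 4 distrib_right[of "M * M3 + M2\<^sup>2 + 2 * M3 * (M + M2)" "M3\<^sup>2" "\<delta> ^ 4"]
      distrib_right[of "M * M3 + M2\<^sup>2" "2 * M3 * (M + M2)" "\<delta> ^ 4"] distrib_right[of "M * M3" "M2\<^sup>2" "\<delta> ^ 4"]
    by linarith
qed

text \<open>On the diagonal the difference tends to a multiple of the Schwarzian derivative of \<open>\<Phi>\<close>, which
  is why three derivatives are needed.\<close>

lemma kernel_bound: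
  assumes L: "circle_lift \<Phi> \<Phi>'" and C3: "Cn 2 \<Phi>'"
  obtains K where "K \<ge> 0" "\<And>u v. sin (pi * (u - v)) \<noteq> 0 \<Longrightarrow>
    \<bar>\<Phi>' u * \<Phi>' v / (sin (pi * (\<Phi> u - \<Phi> v)))\<^sup>2 - 1 / (sin (pi * (u - v)))\<^sup>2\<bar> \<le> K"
proof -
  obtain m M where m: "0 < m" "\<And>t. m \<le> \<Phi>' t" and M: "\<And>t. \<Phi>' t \<le> M"
    using circle_lift_bounds[OF L] by metis
  have M0: "0 \<le> M" using m(1) m(2)[of 0] M[of 0] by linarith
  obtain \<Phi>2 \<Phi>3 where d2: "\<And>x. (\<Phi>' has_real_derivative \<Phi>2 x) (at x)"
    and d3: "\<And>x. (\<Phi>2 has_real_derivative \<Phi>3 x) (at x)" and c3: "continuous_on UNIV \<Phi>3"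
    using C3 by (auto simp: numeral_2_eq_2 has_real_derivative_iff_has_vector_derivative)
  note d1 = circle_liftD(1)[OF L]
  have per: "f' (x + 1) = f' x" if "\<And>x. (f has_real_derivative f' x) (at x)" "\<And>x. f (x + 1) = f x"
    for f f' :: "real \<Rightarrow> real" and x
  proof -
    have "((\<lambda>x. f (x + 1)) has_real_derivative f' (x + 1)) (at x)"
      using that(1)[of "x+1"] DERIV_shift[of f "f' (x+1)" x 1] by simp
    then show ?thesis
      using that by (auto intro: DERIV_unique)
  qed
  have per2: "\<Phi>2 (x + 1) = \<Phi>2 x" for x
    by (rule per[OF d2 circle_liftD(8)[OF L]])
  have per3: "\<Phi>3 (x + 1) = \<Phi>3 x" for x
    by (rule per[OF d3 per2])
  have bdd: "\<exists>C. \<forall>x. \<bar>f x\<bar> \<le> C" if "continuous_on UNIV f" "\<And>x. f (x + 1) = f x" for f :: "real \<Rightarrow> real"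
  proof -
    have "compact (f ` {0..1})"
      by (intro compact_continuous_image continuous_on_subset[OF that(1)]) auto
    then obtain C where C: "\<And>t. t \<in> {0..1} \<Longrightarrow> \<bar>f t\<bar> \<le> C"
      by (metis bounded_iff compact_imp_bounded imageI real_norm_def)
    have "\<bar>f t\<bar> \<le> C" for t
      using C[of "frac t"] periodic_frac[of f t, OF that(2)] by (simp add: frac_lt_1 less_imp_le)
    then show ?thesis by blast
  qed
  obtain M2 where M2: "\<And>x. \<bar>\<Phi>2 x\<bar> \<le> M2"
    using bdd[of \<Phi>2, OF _ per2] d3 by (metis DERIV_isCont continuous_at_imp_continuous_on)
  obtain M3 where M3: "\<And>x. \<bar>\<Phi>3 x\<bar> \<le> M3"
    using bdd[of \<Phi>3, OF c3 per3] by metis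
  have M3_0: "0 \<le> M3" using order_trans[OF abs_ge_zero M3] .
  define C where "C = M * M3 + M2\<^sup>2 + 2 * M3 * (M + M2) + M3\<^sup>2"
  \<comment> \<open>The first summand bounds the numerator with squares in place of squared sines,
    the other two pay for that replacement at \<delta> and at \<Delta>. The division by m^2 comes
    from the lower bound \<open>den\<close> of the denominator.\<close>
  define K where "K = (pi\<^sup>2 * C + M * M * pi ^ 4 + pi ^ 4 * M ^ 4) / m\<^sup>2"
  define Q where "Q u v = \<Phi>' u * \<Phi>' v / (sin (pi * (\<Phi> u - \<Phi> v)))\<^sup>2 - 1 / (sin (pi * (u - v)))\<^sup>2" for u v
  have main: "\<bar>Q u v\<bar> \<le> K" if uv: "v < u" "u \<le> v + 1/2" for u v
  proof -
    define \<delta> where "\<delta> = u - v"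
    define \<Delta> where "\<Delta> = \<Phi> u - \<Phi> v"
    have \<delta>: "0 < \<delta>" "\<delta> \<le> 1/2" using uv by (auto simp: \<delta>_def)
    obtain z where z: "v < z" "z < u" "\<Delta> = (u - v) * \<Phi>' z"
      using MVT2[of v u \<Phi> \<Phi>'] uv d1 by (auto simp: \<Delta>_def)
    have \<Delta>m: "m * \<delta> \<le> \<Delta>" "\<Delta> \<le> M * \<delta>"
      using z m(2)[of z] M[of z] \<delta> by (auto simp: \<delta>_def mult.commute)
    obtain y where y: "\<Phi> (v + 1) - \<Phi> u = (v + 1 - u) * \<Phi>' y"
      using MVT2[of u "v + 1" \<Phi> \<Phi>'] uv d1 by auto
    \<comment> \<open>The complementary arc from u to v + 1 has length at least 1/2, hence at least
      \<delta>, and its image has length 1 - \<Delta>. So the images of u and v do not come close to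
      each other around the other side of the circle.\<close>
    have "m * \<delta> \<le> (v + 1 - u) * \<Phi>' y"
      using m \<delta> by (subst mult.commute, intro mult_mono) (auto simp: \<delta>_def)
    then have \<Delta>1: "m * \<delta> \<le> 1 - \<Delta>"
      using y circle_liftD(4)[OF L, of v] by (simp add: \<Delta>_def)
    have m\<delta>: "0 < m * \<delta>" using m \<delta> by simp
    have sin\<Delta>: "m * \<delta> \<le> \<bar>sin (pi * \<Delta>)\<bar>"
      using sin_pi_ge_min[of \<Delta>] \<Delta>m \<Delta>1 m\<delta> by linarith
    have sin\<delta>: "\<delta> \<le> \<bar>sin (pi * \<delta>)\<bar>"
      using abs_le_abs_sin_pi[of \<delta>] \<delta> by simp
    have den: "m\<^sup>2 * \<delta> ^ 4 \<le> (sin (pi * \<Delta>))\<^sup>2 * (sin (pi * \<delta>))\<^sup>2"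
    proof -
      have "(m * \<delta>)\<^sup>2 * \<delta>\<^sup>2 \<le> \<bar>sin (pi * \<Delta>)\<bar>\<^sup>2 * \<bar>sin (pi * \<delta>)\<bar>\<^sup>2"
        using sin\<Delta> sin\<delta> m\<delta> \<delta> by (intro mult_mono power_mono) auto
      moreover have "(m * \<delta>)\<^sup>2 * \<delta>\<^sup>2 = m\<^sup>2 * \<delta> ^ 4"
        by (simp add: power_mult_distrib power_eq_if)
      ultimately show ?thesis by (simp only: power2_abs)
    qed
    obtain r where r: "\<Phi>' u = \<Phi>' v + \<Phi>2 v * \<delta> + r" "\<bar>r\<bar> \<le> M3 * \<delta>\<^sup>2"
    proof -
      define D where "D = (\<lambda>n::nat. if n = 0 then \<Phi>' else if n = 1 then \<Phi>2 else \<Phi>3)"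
      have "\<exists>t>v. t < u \<and> \<Phi>' u = (\<Sum>k<2. D k v / fact k * (u - v) ^ k) + D 2 t / fact 2 * (u - v) ^ 2"
        using uv d2 d3 by (intro Taylor_up[where a=v]) (auto simp: D_def less_2_cases_iff)
      then obtain t where t: "\<Phi>' u = \<Phi>' v + \<Phi>2 v * \<delta> + \<Phi>3 t / 2 * \<delta>\<^sup>2"
        by (auto simp: D_def \<delta>_def numeral_2_eq_2)
      have "\<bar>\<Phi>3 t / 2 * \<delta>\<^sup>2\<bar> \<le> M3 * \<delta>\<^sup>2"
        unfolding abs_mult using M3[of t] by (intro mult_mono) auto
      with t show ?thesis using that[of "\<Phi>3 t / 2 * \<delta>\<^sup>2"] by simp
    qed
    obtain s where s: "\<Delta> = \<Phi>' v * \<delta> + \<Phi>2 v / 2 * \<delta>\<^sup>2 + s" "\<bar>s\<bar> \<le> M3 * \<delta> ^ 3"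
    proof -
      define D where "D = (\<lambda>n::nat. if n = 0 then \<Phi> else if n = 1 then \<Phi>' else if n = 2 then \<Phi>2 else \<Phi>3)"
      have "\<exists>t>v. t < u \<and> \<Phi> u = (\<Sum>k<3. D k v / fact k * (u - v) ^ k) + D 3 t / fact 3 * (u - v) ^ 3"
      proof (rule Taylor_up[where a=v])
        show "\<forall>k t. k < 3 \<and> v \<le> t \<and> t \<le> u \<longrightarrow> (D k has_real_derivative D (Suc k) t) (at t)"
        proof (intro allI impI, elim conjE)
          fix k :: nat and t :: real assume "k < 3"
          then have "k = 0 \<or> k = 1 \<or> k = 2" by linarith
          then show "(D k has_real_derivative D (Suc k) t) (at t)"
            using d1 d2 d3 by (auto simp: D_def)
        qed
      qed (use uv in \<open>auto simp: D_def\<close>)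
      then obtain t where "\<Phi> u = \<Phi> v + \<Phi>' v * \<delta> + \<Phi>2 v / 2 * \<delta>\<^sup>2 + \<Phi>3 t / 6 * \<delta> ^ 3"
        by (auto simp: D_def \<delta>_def numeral_3_eq_3 fact_numeral power2_eq_square)
      then have t: "\<Delta> = \<Phi>' v * \<delta> + \<Phi>2 v / 2 * \<delta>\<^sup>2 + \<Phi>3 t / 6 * \<delta> ^ 3"
        by (simp add: \<Delta>_def)
      have "\<bar>\<Phi>3 t / 6 * \<delta> ^ 3\<bar> \<le> M3 * \<delta> ^ 3"
        unfolding abs_mult using M3[of t] \<delta> by (intro mult_mono) auto
      with t show ?thesis using that[of "\<Phi>3 t / 6 * \<delta> ^ 3"] by simp
    qed
    have "\<bar>\<Phi>' v\<bar> \<le> M"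
      using M[of v] circle_liftD(3)[OF L, of v] by simp
    from schwarzian_numerator_bound[OF _ _ this M2[of v] r(2) s(2)] \<delta>
    have N0: "\<bar>\<Phi>' u * \<Phi>' v * \<delta>\<^sup>2 - \<Delta>\<^sup>2\<bar> \<le> C * \<delta> ^ 4"
      unfolding r(1) s(1) C_def by simp
    \<comment> \<open>The numerator of the difference of kernels over the common denominator,
      compared below with its version without sines.\<close>
    define N where "N = \<Phi>' u * \<Phi>' v * (sin (pi * \<delta>))\<^sup>2 - (sin (pi * \<Delta>))\<^sup>2"
    have "N = pi\<^sup>2 * (\<Phi>' u * \<Phi>' v * \<delta>\<^sup>2 - \<Delta>\<^sup>2) + \<Phi>' u * \<Phi>' v * ((sin (pi * \<delta>))\<^sup>2 - (pi * \<delta>)\<^sup>2)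
        - ((sin (pi * \<Delta>))\<^sup>2 - (pi * \<Delta>)\<^sup>2)"
      by (simp add: N_def power_mult_distrib algebra_simps)
    then have "\<bar>N\<bar> \<le> \<bar>pi\<^sup>2 * (\<Phi>' u * \<Phi>' v * \<delta>\<^sup>2 - \<Delta>\<^sup>2)\<bar> + \<bar>\<Phi>' u * \<Phi>' v * ((sin (pi * \<delta>))\<^sup>2 - (pi * \<delta>)\<^sup>2)\<bar>
        + \<bar>(sin (pi * \<Delta>))\<^sup>2 - (pi * \<Delta>)\<^sup>2\<bar>" by linarith
    also have "\<dots> \<le> pi\<^sup>2 * (C * \<delta> ^ 4) + M * M * (pi ^ 4 * \<delta> ^ 4) + pi ^ 4 * (M ^ 4 * \<delta> ^ 4)"
    proof (intro add_mono)
      show "\<bar>pi\<^sup>2 * (\<Phi>' u * \<Phi>' v * \<delta>\<^sup>2 - \<Delta>\<^sup>2)\<bar> \<le> pi\<^sup>2 * (C * \<delta> ^ 4)"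
        using N0 by (simp add: abs_mult mult_left_mono)
      have p: "0 < \<Phi>' u" "0 < \<Phi>' v" using circle_liftD(3)[OF L] by auto
      have "\<bar>\<Phi>' u * \<Phi>' v\<bar> * \<bar>(sin (pi * \<delta>))\<^sup>2 - (pi * \<delta>)\<^sup>2\<bar> \<le> (M * M) * (pi * \<delta>) ^ 4"
        using sin_sq_minus_sq_le[of "pi * \<delta>"] M[of u] M[of v] M0 p
        by (intro mult_mono) (auto simp: abs_mult intro!: mult_mono)
      then show "\<bar>\<Phi>' u * \<Phi>' v * ((sin (pi * \<delta>))\<^sup>2 - (pi * \<delta>)\<^sup>2)\<bar> \<le> M * M * (pi ^ 4 * \<delta> ^ 4)"
        by (simp add: abs_mult power_mult_distrib)
      have "\<bar>(sin (pi * \<Delta>))\<^sup>2 - (pi * \<Delta>)\<^sup>2\<bar> \<le> (pi * \<Delta>) ^ 4"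
        by (rule sin_sq_minus_sq_le)
      also have "\<dots> \<le> (pi * (M * \<delta>)) ^ 4"
        using \<Delta>m m\<delta> by (intro power_mono mult_left_mono) auto
      finally show "\<bar>(sin (pi * \<Delta>))\<^sup>2 - (pi * \<Delta>)\<^sup>2\<bar> \<le> pi ^ 4 * (M ^ 4 * \<delta> ^ 4)"
        by (simp add: power_mult_distrib)
    qed
    also have "\<dots> = K * (m\<^sup>2 * \<delta> ^ 4)"
      using m(1) by (simp add: K_def field_simps)
    finally have N: "\<bar>N\<bar> \<le> K * (m\<^sup>2 * \<delta> ^ 4)" .
    have pos: "0 < m\<^sup>2 * \<delta> ^ 4" using m \<delta> by simp
    have K0: "0 \<le> K"
      using order_trans[OF abs_ge_zero N] pos by (simp add: zero_le_mult_iff)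
    have S0: "sin (pi * \<Delta>) \<noteq> 0" "sin (pi * \<delta>) \<noteq> 0"
      using sin\<Delta> sin\<delta> m\<delta> \<delta> by auto
    have "Q u v = N / ((sin (pi * \<Delta>))\<^sup>2 * (sin (pi * \<delta>))\<^sup>2)"
      using S0 by (simp add: Q_def N_def \<Delta>_def \<delta>_def field_simps)
    then have "\<bar>Q u v\<bar> = \<bar>N\<bar> / ((sin (pi * \<Delta>))\<^sup>2 * (sin (pi * \<delta>))\<^sup>2)"
      by (simp add: abs_divide abs_mult)
    also have "\<dots> \<le> K * (m\<^sup>2 * \<delta> ^ 4) / (m\<^sup>2 * \<delta> ^ 4)"
      using N den pos K0 by (intro frac_le) auto
    also have "\<dots> = K" using m(1) \<delta>(1) by simp
    finally show ?thesis .
  qed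
  have sym: "Q u v = Q v u" for u v
  proof -
    have "(sin (pi * (x - y)))\<^sup>2 = (sin (pi * (y - x)))\<^sup>2" for x y :: real
      by (metis minus_diff_eq mult_minus_right power2_minus sin_minus)
    then show ?thesis unfolding Q_def by (metis mult.commute)
  qed
  have shift: "Q (u + of_int k) v = Q u v" for u v k
  proof -
    have "\<Phi>' (u + of_int k) = \<Phi>' u"
      by (rule periodic_int) (rule circle_liftD(8)[OF L])
    moreover have "\<Phi> (u + of_int k) = \<Phi> u + of_int k"
      using periodic_int[of "\<lambda>x. \<Phi> x - x" u k] circle_liftD(4)[OF L] by (simp add: algebra_simps)
    moreover have "(sin (pi * (x + of_int k - y)))\<^sup>2 = (sin (pi * (x - y)))\<^sup>2" for x y
      using sin_sq_pi_add_int[of "x - y" k] by (simp add: algebra_simps)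
    ultimately show ?thesis by (simp add: Q_def)
  qed
  have K0: "0 \<le> K" using order_trans[OF abs_ge_zero main[of 0 "1/4"]] by simp
  have "\<bar>Q u v\<bar> \<le> K" if "sin (pi * (u - v)) \<noteq> 0" for u v
  proof -
    \<comment> \<open>Periodicity moves u to within half a period of v, and symmetry orders the two
      points. The moved point differs from v because the sine does not vanish.\<close>
    define k where "k = round (u - v)"
    define w where "w = u + of_int (- k)"
    have w: "\<bar>w - v\<bar> \<le> 1/2"
      using of_int_round_abs_le[of "u - v"] by (simp add: w_def k_def abs_minus_commute algebra_simps)
    have "w \<noteq> v"
    proof
      assume "w = v"
      then have "u - v = 0 + of_int k" by (simp add: w_def)
      then have "(sin (pi * (u - v)))\<^sup>2 = (sin (pi * 0))\<^sup>2"
        using sin_sq_pi_add_int[of 0 k] by simp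
      then show False using that by simp
    qed
    have "Q u v = Q w v"
      unfolding w_def by (rule shift[symmetric])
    moreover have "\<bar>Q w v\<bar> \<le> K"
      using main[of v w] main[of w v] sym[of w v] w \<open>w \<noteq> v\<close> by (cases "v < w") (auto simp: abs_le_iff)
    ultimately show ?thesis by simp
  qed
  with K0 that show ?thesis by (simp add: Q_def)
qed

section \<open>The quadratic form of \<open>|D|\<close>\<close>

text \<open>A Lipschitz condition for the chord distance, which is 2 |sin \<pi>(s - t)|. It is
  adapted to the kernel: the squared sine cancels against two such differences, and the integrand of
  the form stays bounded.\<close>

definition lip :: "real \<Rightarrow> (circle \<Rightarrow> complex) \<Rightarrow> bool"
  where "lip L f \<longleftrightarrow> continuous_on UNIV f \<and> (\<forall>s t. cmod (f (to_circle s) - f (to_circle t)) \<le> L * \<bar>sin (pi * (s - t))\<bar>)"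

lemma lipI:
  assumes f: "circle_Cn 1 f"
  obtains L where "lip L f"
proof -
  obtain f' where f': "circle_Cn 0 f'" "\<And>t. ((\<lambda>t. f (to_circle t)) has_vector_derivative f' (to_circle t)) (at t)"
    using circle_Cn_deriv[of 0 f] f by auto
  obtain L where L: "\<And>p. cmod (f' p) \<le> L"
    using continuous_circle_bounded[OF circle_Cn_continuous[OF f'(1)]] by blast
  have L0: "0 \<le> L" using order_trans[OF norm_ge_zero L] .
  have lin: "cmod (f (to_circle s) - f (to_circle t)) \<le> L * \<bar>s - t\<bar>" for s t
  proof -
    have "norm (f (to_circle s) - f (to_circle t)) \<le> L * norm (s - t)"
    proof (rule differentiable_bound[of UNIV])
      show "((\<lambda>t. f (to_circle t)) has_derivative (\<lambda>x. x *\<^sub>R f' (to_circle t))) (at t within UNIV)" for t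
        using f'(2)[of t] by (simp add: has_vector_derivative_def)
      show "onorm (\<lambda>x. x *\<^sub>R f' (to_circle t)) \<le> L" for t
        using L[of "to_circle t"] L0 by (intro onorm_bound) (auto simp: mult.commute[of L] mult_left_mono)
    qed auto
    then show ?thesis by simp
  qed
  have "cmod (f (to_circle s) - f (to_circle t)) \<le> L * \<bar>sin (pi * (s - t))\<bar>" for s t
  proof -
    \<comment> \<open>Both sides depend only on the class of s, so s may be taken within half a
      period of t, where the sine dominates the distance.\<close>
    define k where "k = round (s - t)"
    define r where "r = s + of_int (- k)"
    have r: "\<bar>r - t\<bar> \<le> 1/2"
      using of_int_round_abs_le[of "s - t"] by (simp add: r_def k_def abs_minus_commute algebra_simps)
    have "(sin (pi * (r - t)))\<^sup>2 = (sin (pi * (s - t)))\<^sup>2"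
      using sin_sq_pi_add_int[of "s - t" "- k"] by (simp add: r_def algebra_simps)
    then have "\<bar>sin (pi * (r - t))\<bar> = \<bar>sin (pi * (s - t))\<bar>"
      by (simp add: power2_eq_iff abs_eq_iff)
    moreover have "to_circle r = to_circle s"
      by (simp add: to_circle_eq_iff r_def)
    moreover have "L * \<bar>r - t\<bar> \<le> L * \<bar>sin (pi * (r - t))\<bar>"
      by (intro mult_left_mono abs_le_abs_sin_pi r L0)
    ultimately show ?thesis using lin[of r t] by simp
  qed
  then show ?thesis
    using that circle_Cn_continuous[OF f] by (auto simp: lip_def)
qed

section \<open>Fubini's theorem over the square of a period\<close>

abbreviation unit2 :: "(real \<times> real) measure"
  where "unit2 \<equiv> unit_measure \<Otimes>\<^sub>M unit_measure"

interpretation unit2: finite_measure unit2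
  by (rule finite_measure_pair_measure) unfold_locales

lemma measurable_unit2: "measurable unit2 borel = measurable borel borel"
proof (rule measurable_cong_sets)
  have "sets unit2 = sets (borel \<Otimes>\<^sub>M borel :: (real \<times> real) measure)"
    by (rule sets_pair_measure_cong) simp_all
  then show "sets unit2 = sets borel" by (simp only: borel_prod)
qed simp

lemma measurable_section:
  assumes "case_prod F \<in> borel_measurable (borel :: (real \<times> real) measure)"
  shows "(\<lambda>u. F u v) \<in> borel_measurable borel"
proof -
  have "continuous_on UNIV (\<lambda>u::real. (u, v))" by (intro continuous_intros)
  from measurable_compose[OF borel_measurable_continuous_onI[OF this] assms] show ?thesis by simp
qed

lemma integrable_unit2:
  fixes F :: "real \<times> real \<Rightarrow> 'a::{banach, second_countable_topology}"
  assumes "F \<in> borel_measurable borel" "\<And>z. norm (F z) \<le> C"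
  shows "integrable unit2 F"
proof (rule unit2.integrable_const_bound[of _ C])
  show "F \<in> borel_measurable unit2"
    using assms(1) by (simp only: measurable_unit2)
qed (use assms in simp)

lemma unit2_integral:
  fixes F :: "real \<Rightarrow> real \<Rightarrow> 'a::{banach, second_countable_topology}"
  assumes "case_prod F \<in> borel_measurable borel" "\<And>u v. norm (F u v) \<le> C"
  shows "(\<integral>z. case_prod F z \<partial>unit2) = (\<integral>u. \<integral>v. F u v \<partial>unit_measure \<partial>unit_measure)"
    "(\<integral>z. case_prod F z \<partial>unit2) = (\<integral>v. \<integral>u. F u v \<partial>unit_measure \<partial>unit_measure)"
proof -
  have i: "integrable unit2 (case_prod F)"
    by (rule integrable_unit2[OF assms(1), of C]) (use assms(2) in auto)
  show "(\<integral>z. case_prod F z \<partial>unit2) = (\<integral>u. \<integral>v. F u v \<partial>unit_measure \<partial>unit_measure)"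
    using unit_pair.integral_fst[OF i] by simp
  show "(\<integral>z. case_prod F z \<partial>unit2) = (\<integral>v. \<integral>u. F u v \<partial>unit_measure \<partial>unit_measure)"
    using unit_pair.integral_snd[OF i] by simp
qed

text \<open>The integrand of Douglas' formula for the H^(1/2) seminorm, without the factor \<pi>/2.
  Where the sine vanishes, both the differences and the quotient are 0, as division by zero gives
  0.\<close>

definition form_integrand :: "(circle \<Rightarrow> complex) \<Rightarrow> (circle \<Rightarrow> complex) \<Rightarrow> real \<Rightarrow> real \<Rightarrow> complex"
  where "form_integrand f g u v =
    (f (to_circle u) - f (to_circle v)) * cnj (g (to_circle u) - g (to_circle v)) / of_real ((sin (pi * (u - v)))\<^sup>2)"

definition form :: "(circle \<Rightarrow> complex) \<Rightarrow> (circle \<Rightarrow> complex) \<Rightarrow> complex"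
  where "form f g = (\<integral>z. case_prod (form_integrand f g) z \<partial>unit2)"

lemma quotient_bound:
  assumes "cmod a \<le> L * \<bar>s\<bar>" "cmod b \<le> L' * \<bar>s\<bar>"
  shows "cmod (a * cnj b / of_real (s\<^sup>2)) \<le> \<bar>L * L'\<bar>"
proof (cases "s = 0")
  case False
  have "cmod a * cmod b \<le> (L * \<bar>s\<bar>) * (L' * \<bar>s\<bar>)"
    by (intro mult_mono assms order_trans[OF norm_ge_zero assms(1)]) auto
  also have "\<dots> = L * L' * s\<^sup>2" by (simp add: power2_eq_square mult_ac)
  finally have "cmod a * cmod b / s\<^sup>2 \<le> L * L'"
    using False by (simp add: field_simps)
  then show ?thesis by (simp add: norm_mult norm_divide norm_power)
qed simp

lemma measurable_circle_proj [measurable]: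
  fixes f :: "circle \<Rightarrow> complex"
  assumes "continuous_on UNIV f"
  shows "(\<lambda>z::real \<times> real. f (to_circle (fst z))) \<in> borel_measurable borel"
    "(\<lambda>z::real \<times> real. f (to_circle (snd z))) \<in> borel_measurable borel"
proof -
  have c: "continuous_on UNIV (\<lambda>t. f (to_circle t))"
    using assms by (simp add: continuous_on_circle_iff)
  show "(\<lambda>z::real \<times> real. f (to_circle (fst z))) \<in> borel_measurable borel"
    by (intro borel_measurable_continuous_onI continuous_on_compose2[OF c] continuous_intros) auto
  show "(\<lambda>z::real \<times> real. f (to_circle (snd z))) \<in> borel_measurable borel"
    by (intro borel_measurable_continuous_onI continuous_on_compose2[OF c] continuous_intros) auto
qed

lemma measurable_sin_diff: "(\<lambda>z::real \<times> real. (sin (pi * (fst z - snd z)))\<^sup>2) \<in> borel_measurable borel"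
  by (intro borel_measurable_continuous_onI continuous_intros)

lemma form_integrand_measurable:
  assumes "continuous_on UNIV f" "continuous_on UNIV g"
  shows "case_prod (form_integrand f g) \<in> borel_measurable borel"
proof -
  note [measurable] = measurable_circle_proj[OF assms(1)] measurable_circle_proj[OF assms(2)] measurable_sin_diff
  have "case_prod (form_integrand f g) = (\<lambda>z. (f (to_circle (fst z)) - f (to_circle (snd z))) *
    cnj (g (to_circle (fst z)) - g (to_circle (snd z))) / of_real ((sin (pi * (fst z - snd z)))\<^sup>2))"
    by (auto simp: form_integrand_def)
  also have "\<dots> \<in> borel_measurable borel"
    by measurable
  finally show ?thesis .
qed

lemma form_integrand_bounded:
  assumes "lip L f" "lip L' g"
  shows "cmod (form_integrand f g u v) \<le> \<bar>L * L'\<bar>"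
  unfolding form_integrand_def by (rule quotient_bound) (use assms in \<open>auto simp: lip_def\<close>)

lemma form_integrand_integrable:
  assumes f: "lip L f" and g: "lip L' g"
  shows "integrable unit2 (case_prod (form_integrand f g))"
proof (rule integrable_unit2)
  show "case_prod (form_integrand f g) \<in> borel_measurable borel"
    using f g by (intro form_integrand_measurable) (auto simp: lip_def)
  show "cmod (case_prod (form_integrand f g) z) \<le> \<bar>L * L'\<bar>" for z
    using form_integrand_bounded[OF f g] by (cases z) simp
qed

lemma form_cnj: "form g f = cnj (form f g)"
proof -
  have "cnj (form f g) = (\<integral>z. cnj (case_prod (form_integrand f g) z) \<partial>unit2)"
    unfolding form_def by (rule Bochner_Integration.integral_cnj[symmetric])
  also have "(\<lambda>z. cnj (case_prod (form_integrand f g) z)) = case_prod (form_integrand g f)"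
    by (auto simp: form_integrand_def fun_eq_iff)
  finally show ?thesis by (simp add: form_def)
qed

definition trigf :: "int set \<Rightarrow> (int \<Rightarrow> complex) \<Rightarrow> circle \<Rightarrow> complex"
  where "trigf A c p = (\<Sum>n\<in>A. c n * ce n p)"

lemma form_trigf_right:
  assumes f: "lip L f" and ce: "\<And>n. \<exists>L'. lip L' (ce n)"
  shows "form f (trigf A c) = (\<Sum>n\<in>A. cnj (c n) * form f (ce n))"
proof -
  have i: "integrable unit2 (case_prod (form_integrand f (ce n)))" for n
    using form_integrand_integrable[OF f] ce by blast
  have "case_prod (form_integrand f (trigf A c)) = (\<lambda>z. \<Sum>n\<in>A. cnj (c n) * case_prod (form_integrand f (ce n)) z)"
  proof (intro ext)
    fix z :: "real \<times> real"
    obtain u v where z: "z = (u, v)" by (cases z)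
    have "cnj (trigf A c (to_circle u) - trigf A c (to_circle v)) = (\<Sum>n\<in>A. cnj (c n) * cnj (fexp n u - fexp n v))"
      by (simp add: trigf_def sum_subtractf[symmetric] right_diff_distrib)
    then show "case_prod (form_integrand f (trigf A c)) z = (\<Sum>n\<in>A. cnj (c n) * case_prod (form_integrand f (ce n)) z)"
      by (simp add: z form_integrand_def sum_distrib_left sum_divide_distrib mult_ac)
  qed
  then show ?thesis
    unfolding form_def using i by simp
qed

text \<open>\<open>fexp m t - 1\<close> is a geometric sum times \<open>fexp 1 t - 1\<close>, up to
  conjugation for negative m, and |\<open>fexp 1 t - 1\<close>|^2 is 4 sin^2 \<pi>t. For m \<noteq>
  0 the result is 4|m| times the Fejer kernel of order |m|.\<close>

lemma fexp_minus_1_sq: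
  assumes "0 < t" "t < 1"
  shows "(cmod (fexp m t - 1))\<^sup>2 / (sin (pi * t))\<^sup>2 = 4 * (cmod (\<Sum>j<nat \<bar>m\<bar>. fexp (int j) t))\<^sup>2"
proof -
  have s: "sin (pi * t) \<noteq> 0"
    using assms by (intro less_imp_neq[symmetric] sin_gt_zero) auto
  have "cmod (fexp m t - 1) = cmod (fexp \<bar>m\<bar> t - 1)"
  proof (cases "m \<ge> 0")
    case False
    have "cmod (fexp m t - 1) = cmod (cnj (fexp m t - 1))" by (simp only: complex_mod_cnj)
    then show ?thesis using False by (simp add: cnj_fexp)
  qed simp
  also have "fexp \<bar>m\<bar> t - 1 = fexp 1 t ^ nat \<bar>m\<bar> - 1"
  proof -
    have "fexp (int k) t = fexp 1 t ^ k" for k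
      by (induction k) (simp_all add: fexp_add)
    from this[of "nat \<bar>m\<bar>"] show ?thesis by simp
  qed
  also have "\<dots> = (fexp 1 t - 1) * (\<Sum>j<nat \<bar>m\<bar>. fexp 1 t ^ j)"
    by (rule power_diff_1_eq)
  also have "(\<Sum>j<nat \<bar>m\<bar>. fexp 1 t ^ j) = (\<Sum>j<nat \<bar>m\<bar>. fexp (int j) t)"
  proof -
    have "fexp (int k) t = fexp 1 t ^ k" for k
      by (induction k) (simp_all add: fexp_add)
    then show ?thesis by simp
  qed
  finally have "(cmod (fexp m t - 1))\<^sup>2 = (cmod (fexp 1 t - 1))\<^sup>2 * (cmod (\<Sum>j<nat \<bar>m\<bar>. fexp (int j) t))\<^sup>2"
    by (simp add: norm_mult power_mult_distrib)
  moreover have "(cmod (fexp 1 t - 1))\<^sup>2 = 4 * (sin (pi * t))\<^sup>2"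
  proof -
    define x where "x = pi * t"
    have e: "2 * pi * t = 2 * x" by (simp add: x_def)
    have "(cmod (fexp 1 t - 1))\<^sup>2 = (cos (2 * x) - 1)\<^sup>2 + (sin (2 * x))\<^sup>2"
      by (simp add: cmod_power2 fexp_def e)
    also have "\<dots> = 2 - 2 * cos (2 * x)"
      using sin_cos_squared_add[of "2 * x"] by (simp add: power2_eq_square algebra_simps)
    also have "\<dots> = 4 * (sin x)\<^sup>2"
      by (simp add: cos_double_sin)
    finally show ?thesis by (simp add: x_def)
  qed
  ultimately show ?thesis using s by simp
qed

lemma to_L2_trigf: "to_L2 (trigf A c) = trig A c"
proof -
  have "to_L2 (trigf A c) = to_L2 (\<lambda>p. \<Sum>n\<in>A. c n * ce n p)"
    by (simp add: trigf_def[abs_def])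
  also have "\<dots> = (\<Sum>n\<in>A. to_L2 (\<lambda>p. c n * ce n p))"
    by (rule to_L2_sum) (rule square_integrable_scale[OF square_integrable_ce])
  also have "\<dots> = trig A c"
    by (simp add: trig_def ee_def to_L2_scale[OF square_integrable_ce])
  finally show ?thesis .
qed

lemma continuous_trigf: "continuous_on UNIV (trigf A c)"
  unfolding trigf_def[abs_def] by (intro continuous_intros continuous_ce)

text \<open>Parseval's identity for a sum of |m| distinct characters with coefficient 1. This is
  where the modulus in |D| arises.\<close>

lemma fejer_integral:
  "(\<integral>t. (cmod (fexp m t - 1))\<^sup>2 / (sin (pi * t))\<^sup>2 \<partial>unit_measure) = 4 * \<bar>of_int m\<bar>"
proof -
  define A where "A = int ` {..<nat \<bar>m\<bar>}"
  have sum: "trigf A (\<lambda>_. 1) (to_circle t) = (\<Sum>j<nat \<bar>m\<bar>. fexp (int j) t)" for t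
    by (simp add: trigf_def A_def sum.reindex)
  have c: "continuous_on UNIV (\<lambda>t. trigf A (\<lambda>_. 1) (to_circle t))"
    using continuous_trigf continuous_on_circle_iff by blast
  note [measurable] = borel_measurable_continuous_onI[OF continuous_trigf] borel_measurable_continuous_onI[OF c]
  have "(\<integral>t. (cmod (fexp m t - 1))\<^sup>2 / (sin (pi * t))\<^sup>2 \<partial>unit_measure)
      = (\<integral>t. 4 * (cmod (trigf A (\<lambda>_. 1) (to_circle t)))\<^sup>2 \<partial>unit_measure)"
  proof (rule integral_cong_AE)
    show "AE t in unit_measure. (cmod (fexp m t - 1))\<^sup>2 / (sin (pi * t))\<^sup>2 = 4 * (cmod (trigf A (\<lambda>_. 1) (to_circle t)))\<^sup>2"
      unfolding sum using eventually_conj[OF AE_unit AE_unit_not_eq[of 0]]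
      by (rule eventually_mono) (rule fexp_minus_1_sq, auto)
  qed measurable
  also have "\<dots> = 4 * (\<integral>p. (cmod (trigf A (\<lambda>_. 1) p))\<^sup>2 \<partial>circle_measure)"
    by (subst circle_integral) auto
  also have "(\<integral>p. (cmod (trigf A (\<lambda>_. 1) p))\<^sup>2 \<partial>circle_measure) = (norm (trig A (\<lambda>_. 1)))\<^sup>2"
    using norm_to_L2[OF square_integrable_continuous[OF continuous_trigf], of A "\<lambda>_. 1"] by (simp add: to_L2_trigf)
  also have "\<dots> = \<bar>of_int m\<bar>"
    by (subst norm_trig) (auto simp: A_def card_image)
  finally show ?thesis .
qed

lemma circle_Cn_ce: "circle_Cn n (ce m)"
proof -
  have "Cn n (\<lambda>t. c * fexp m t)" for c
  proof (induction n arbitrary: c)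
    case 0
    then show ?case by (auto intro!: continuous_intros)
  next
    case (Suc n)
    have "((\<lambda>t. c * fexp m t) has_vector_derivative (c * (2 * pi * \<i> * of_int m)) * fexp m t) (at t)" for t
      using has_vector_derivative_mult_right[OF fexp_has_vector_derivative, of c m t UNIV] by (simp add: mult.assoc)
    then show ?case
      unfolding Cn.simps using Suc[of "c * (2 * pi * \<i> * of_int m)"]
      by (intro exI[of _ "\<lambda>t. c * (2 * pi * \<i> * of_int m) * fexp m t"] conjI allI)
  qed
  from this[of 1] show ?thesis by (simp add: circle_Cn_def)
qed

lemma lip_ce: "\<exists>L. lip L (ce n)"
  using lipI[OF circle_Cn_ce] by metis

lemma integral_unit_shift:
  fixes f :: "real \<Rightarrow> 'a::{banach, second_countable_topology}"
  assumes "f \<in> borel_measurable borel" "\<And>t. f (t + 1) = f t"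
  shows "(\<integral>t. f (t + c) \<partial>unit_measure) = (\<integral>t. f t \<partial>unit_measure)"
  using integral_circle_lift[OF circle_lift_translation[of c] assms] by simp

lemma form_integrand_periodic:
  "form_integrand f g (u + 1) v = form_integrand f g u v" "form_integrand f g u (v + 1) = form_integrand f g u v"
proof -
  have "(sin (pi * (u + 1 - v)))\<^sup>2 = (sin (pi * (u - v)))\<^sup>2"
    using sin_sq_pi_add_int[of "u - v" 1] by (simp add: algebra_simps)
  moreover have "(sin (pi * (u - (v + 1))))\<^sup>2 = (sin (pi * (u - v)))\<^sup>2"
    using sin_sq_pi_add_int[of "u - v" "-1"] by (simp add: algebra_simps)
  ultimately show "form_integrand f g (u + 1) v = form_integrand f g u v" "form_integrand f g u (v + 1) = form_integrand f g u v"
    by (simp_all only: form_integrand_def to_circle_add_int)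
qed

text \<open>Substituting \<open>u = v + t\<close>, the inner integral over \<open>v\<close> is the Fourier coefficient times
  \<open>fexp m t - 1\<close>.\<close>

lemma form_ce:
  assumes f: "lip L f"
  shows "form f (ce m) = of_real (4 * \<bar>of_int m\<bar>) * fc (to_L2 f) m"
proof -
  obtain L' where g: "lip L' (ce m)" using lip_ce by blast
  have cf: "continuous_on UNIV f" using f by (simp add: lip_def)
  have cf': "continuous_on UNIV (\<lambda>t. f (to_circle t))" using cf by (simp add: continuous_on_circle_iff)
  have meas: "case_prod (form_integrand f (ce m)) \<in> borel_measurable borel"
    by (rule form_integrand_measurable[OF cf continuous_ce])
  note meas1 = measurable_section[OF meas]
  define S where "S t v = (f (to_circle (t + v)) - f (to_circle v)) * cnj (fexp m v) * (cnj (fexp m t - 1) / of_real ((sin (pi * t))\<^sup>2))" for t v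
  have S_eq: "form_integrand f (ce m) (t + v) v = S t v" for t v
  proof -
    have "cnj (ce m (to_circle (t + v)) - ce m (to_circle v)) = cnj (fexp m v) * cnj (fexp m t - 1)"
      by (simp add: fexp_add_right algebra_simps)
    then show ?thesis by (simp add: form_integrand_def S_def)
  qed
  have S_le: "cmod (S t v) \<le> \<bar>L * L'\<bar>" for t v
    unfolding S_eq[symmetric] by (rule form_integrand_bounded[OF f g])
  have S_meas: "case_prod S \<in> borel_measurable borel"
  proof -
    have "case_prod S = (\<lambda>z. case_prod (form_integrand f (ce m)) (fst z + snd z, snd z))"
      by (auto simp: S_eq fun_eq_iff)
    also have "\<dots> \<in> borel_measurable borel"
      by (rule measurable_compose[OF borel_measurable_continuous_onI meas]) (intro continuous_intros)
    finally show ?thesis .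
  qed
  have "form f (ce m) = (\<integral>v. \<integral>u. form_integrand f (ce m) u v \<partial>unit_measure \<partial>unit_measure)"
    unfolding form_def by (rule unit2_integral(2)[OF meas form_integrand_bounded[OF f g]])
  also have "\<dots> = (\<integral>v. \<integral>t. S t v \<partial>unit_measure \<partial>unit_measure)"
    unfolding S_eq[symmetric]
    by (intro Bochner_Integration.integral_cong refl integral_unit_shift[symmetric] meas1 form_integrand_periodic)
  also have "\<dots> = (\<integral>t. \<integral>v. S t v \<partial>unit_measure \<partial>unit_measure)"
    using unit2_integral[OF S_meas S_le] by simp
  also have "\<dots> = (\<integral>t. fc (to_L2 f) m * of_real ((cmod (fexp m t - 1))\<^sup>2 / (sin (pi * t))\<^sup>2) \<partial>unit_measure)"
  proof (rule Bochner_Integration.integral_cong[OF refl])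
    fix t
    have fcm: "(\<integral>v. f (to_circle v) * cnj (fexp m v) \<partial>unit_measure) = fc (to_L2 f) m"
      by (simp add: fc_to_L2[OF square_integrable_continuous[OF cf]] cnj_fexp)
    have i1: "integrable unit_measure (\<lambda>v. f (to_circle v) * cnj (fexp m v))"
      by (intro integrable_unit_continuous continuous_intros cf')
    have i2: "integrable unit_measure (\<lambda>v. f (to_circle (t + v)) * cnj (fexp m v))"
      by (intro integrable_unit_continuous continuous_intros continuous_on_compose2[OF cf']) auto
    have "(\<integral>v. f (to_circle (t + v)) * cnj (fexp m v) \<partial>unit_measure)
        = (\<integral>v. fexp m t * (f (to_circle (v + t)) * cnj (fexp m (v + t))) \<partial>unit_measure)"
    proof (rule Bochner_Integration.integral_cong[OF refl])
      fix v
      have "fexp m t * cnj (fexp m t) = 1"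
        by (simp add: complex_norm_square[symmetric])
      then have "fexp m t * cnj (fexp m (v + t)) = cnj (fexp m v)"
        by (simp add: fexp_add_right algebra_simps)
      then show "f (to_circle (t + v)) * cnj (fexp m v) = fexp m t * (f (to_circle (v + t)) * cnj (fexp m (v + t)))"
        by (metis add.commute mult.left_commute)
    qed
    also have "\<dots> = fexp m t * (\<integral>v. f (to_circle (v + t)) * cnj (fexp m (v + t)) \<partial>unit_measure)"
      by (rule integral_mult_right_zero)
    also have "(\<integral>v. f (to_circle (v + t)) * cnj (fexp m (v + t)) \<partial>unit_measure) = fc (to_L2 f) m"
      unfolding fcm[symmetric]
      by (rule integral_unit_shift) (auto simp: fexp_periodic intro!: borel_measurable_continuous_onI continuous_intros cf')
    \<comment> \<open>Translating f by t multiplies its m-th coefficient by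
      \<open>fexp m t\<close>.\<close>
    finally have sh: "(\<integral>v. f (to_circle (t + v)) * cnj (fexp m v) \<partial>unit_measure) = fexp m t * fc (to_L2 f) m" .
    have "(\<integral>v. S t v \<partial>unit_measure) = (\<integral>v. f (to_circle (t + v)) * cnj (fexp m v) - f (to_circle v) * cnj (fexp m v) \<partial>unit_measure)
        * (cnj (fexp m t - 1) / of_real ((sin (pi * t))\<^sup>2))"
      unfolding S_def by (subst integral_mult_left_zero[symmetric]) (simp only: left_diff_distrib)
    also have "(\<integral>v. f (to_circle (t + v)) * cnj (fexp m v) - f (to_circle v) * cnj (fexp m v) \<partial>unit_measure)
        = (fexp m t - 1) * fc (to_L2 f) m"
      by (subst Bochner_Integration.integral_diff[OF i2 i1]) (simp only: sh fcm left_diff_distrib mult_1)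
    also have "(fexp m t - 1) * fc (to_L2 f) m * (cnj (fexp m t - 1) / of_real ((sin (pi * t))\<^sup>2))
        = fc (to_L2 f) m * of_real ((cmod (fexp m t - 1))\<^sup>2 / (sin (pi * t))\<^sup>2)"
      unfolding of_real_divide complex_norm_square by (simp add: mult_ac)
    finally show "(\<integral>v. S t v \<partial>unit_measure) = fc (to_L2 f) m * of_real ((cmod (fexp m t - 1))\<^sup>2 / (sin (pi * t))\<^sup>2)" .
  qed
  also have "\<dots> = fc (to_L2 f) m * of_real (\<integral>t. (cmod (fexp m t - 1))\<^sup>2 / (sin (pi * t))\<^sup>2 \<partial>unit_measure)"
    by (subst integral_mult_right_zero, subst integral_complex_of_real) (rule refl)
  also have "\<dots> = of_real (4 * \<bar>of_int m\<bar>) * fc (to_L2 f) m"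
    unfolding fejer_integral by simp
  finally show ?thesis .
qed

lemma form_trigf:
  assumes f: "lip L f"
  shows "form f (trigf A c) = (\<Sum>n\<in>A. cnj (c n) * (of_real (4 * \<bar>of_int n\<bar>) * fc (to_L2 f) n))"
  using form_trigf_right[OF f lip_ce] by (simp add: form_ce[OF f])

section \<open>Commutators of \<open>|D|\<close> with composition operators\<close>

text \<open>The one-variable substitution is applied to u and then to v between two uses of Fubini's
  theorem; the integrand is periodic in each variable.\<close>

lemma form_change_of_variables:
  assumes L: "lifts_to \<phi> \<Phi> \<Phi>'" and f: "lip Lf f" and g: "lip Lg g"
  shows "form f g = (\<integral>z. case_prod (\<lambda>u v. (\<Phi>' v * \<Phi>' u) *\<^sub>R form_integrand f g (\<Phi> u) (\<Phi> v)) z \<partial>unit2)"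
proof -
  note CL = lifts_toD(1)[OF L]
  note [measurable] = circle_liftD(6,7)[OF CL]
  obtain m M where M: "0 < m" "\<And>t. m \<le> \<Phi>' t" "\<And>t. \<Phi>' t \<le> M"
    using circle_lift_bounds[OF CL] by metis
  define F where "F = form_integrand f g"
  have meas: "case_prod F \<in> borel_measurable borel"
    unfolding F_def using f g by (intro form_integrand_measurable) (auto simp: lip_def)
  have F_le: "cmod (F u v) \<le> \<bar>Lf * Lg\<bar>" for u v
    unfolding F_def by (rule form_integrand_bounded[OF f g])
  have per: "F (u + 1) v = F u v" "F u (v + 1) = F u v" for u v
    unfolding F_def by (rule form_integrand_periodic)+
  note meas1 = measurable_section[OF meas]
  define G where "G v = (\<integral>u. F u v \<partial>unit_measure)" for v
  have G_meas: "G \<in> borel_measurable borel"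
  proof -
    have "continuous_on UNIV (\<lambda>z::real \<times> real. (snd z, fst z))" by (intro continuous_intros)
    from measurable_compose[OF borel_measurable_continuous_onI[OF this] meas]
    have "case_prod (\<lambda>v u. F u v) \<in> borel_measurable unit2"
      unfolding measurable_unit2 by (simp add: case_prod_unfold)
    from unit.borel_measurable_lebesgue_integral[OF this]
    have "G \<in> borel_measurable unit_measure" by (simp add: G_def[abs_def])
    then show ?thesis by (simp only: measurable_cong_sets[OF sets_unit_measure refl])
  qed
  have meas2: "case_prod (\<lambda>u v. (\<Phi>' v * \<Phi>' u) *\<^sub>R F (\<Phi> u) (\<Phi> v)) \<in> borel_measurable borel"
  proof -
    have "continuous_on UNIV (\<lambda>z::real \<times> real. (\<Phi> (fst z), \<Phi> (snd z)))"
      by (intro continuous_intros continuous_on_compose2[OF circle_liftD(5)[OF CL]]) auto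
    from measurable_compose[OF borel_measurable_continuous_onI[OF this] meas]
    have [measurable]: "(\<lambda>z. F (\<Phi> (fst z)) (\<Phi> (snd z))) \<in> borel_measurable borel" by simp
    have [measurable]: "(\<lambda>z::real \<times> real. \<Phi>' (snd z) * \<Phi>' (fst z)) \<in> borel_measurable borel"
      by (intro borel_measurable_continuous_onI continuous_intros continuous_on_compose2[OF circle_liftD(2)[OF CL]]) auto
    show ?thesis unfolding case_prod_unfold by measurable
  qed
  have le2: "cmod ((\<Phi>' v * \<Phi>' u) *\<^sub>R F (\<Phi> u) (\<Phi> v)) \<le> (M * M) * \<bar>Lf * Lg\<bar>" for u v
  proof -
    have "\<bar>\<Phi>' v * \<Phi>' u\<bar> \<le> M * M"
      unfolding abs_mult using M(1) M(2,3)[of u] M(2,3)[of v] by (intro mult_mono) auto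
    moreover have "0 \<le> M * M" by simp
    ultimately show ?thesis
      unfolding norm_scaleR by (intro mult_mono F_le) auto
  qed
  have "form f g = (\<integral>v. G v \<partial>unit_measure)"
    unfolding form_def G_def using unit2_integral(2)[OF meas F_le] by (simp add: F_def)
  also have "\<dots> = (\<integral>v. \<Phi>' v *\<^sub>R G (\<Phi> v) \<partial>unit_measure)"
    by (rule integral_circle_lift[OF CL G_meas, symmetric]) (simp add: G_def per)
  also have "\<dots> = (\<integral>v. \<integral>u. (\<Phi>' v * \<Phi>' u) *\<^sub>R F (\<Phi> u) (\<Phi> v) \<partial>unit_measure \<partial>unit_measure)"
  proof (rule Bochner_Integration.integral_cong[OF refl])
    fix v
    have "G (\<Phi> v) = (\<integral>u. \<Phi>' u *\<^sub>R F (\<Phi> u) (\<Phi> v) \<partial>unit_measure)"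
      unfolding G_def by (rule integral_circle_lift[OF CL meas1, symmetric]) (rule per)
    then show "\<Phi>' v *\<^sub>R G (\<Phi> v) = (\<integral>u. (\<Phi>' v * \<Phi>' u) *\<^sub>R F (\<Phi> u) (\<Phi> v) \<partial>unit_measure)"
      by (simp only: integral_scaleR_right[symmetric] scaleR_scaleR)
  qed
  also have "\<dots> = (\<integral>z. case_prod (\<lambda>u v. (\<Phi>' v * \<Phi>' u) *\<^sub>R F (\<Phi> u) (\<Phi> v)) z \<partial>unit2)"
    by (rule unit2_integral(2)[OF meas2 le2, symmetric])
  finally show ?thesis by (simp add: F_def)
qed

text \<open>By the triangle inequality the product is at most (|a(u)| + |a(v)|)(|b(u)| + |b(v)|).
  Each of the four terms integrates to at most the product of the norms, the mixed ones because L^1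
  norms are bounded by L^2 norms. This turns a bounded kernel into an L^2 estimate.\<close>

lemma integral_difference_products_le:
  assumes a: "continuous_on UNIV a" and b: "continuous_on UNIV b"
  defines "R \<equiv> (\<lambda>u v. cmod (a (to_circle u) - a (to_circle v)) * cmod (b (to_circle u) - b (to_circle v)))"
  shows "integrable unit2 (case_prod R)" "(\<integral>z. case_prod R z \<partial>unit2) \<le> 4 * (norm (to_L2 a) * norm (to_L2 b))"
proof -
  note [measurable] = measurable_circle_proj[OF a] measurable_circle_proj[OF b]
  obtain Ca where Ca: "\<And>p. cmod (a p) \<le> Ca" using continuous_circle_bounded[OF a] by blast
  obtain Cb where Cb: "\<And>p. cmod (b p) \<le> Cb" using continuous_circle_bounded[OF b] by blast
  define \<alpha> where "\<alpha> t = cmod (a (to_circle t))" for t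
  define \<beta> where "\<beta> t = cmod (b (to_circle t))" for t
  define S where "S u v = (\<alpha> u + \<alpha> v) * (\<beta> u + \<beta> v)" for u v
  have R_le: "R u v \<le> S u v" for u v
    unfolding R_def S_def \<alpha>_def \<beta>_def by (intro mult_mono norm_triangle_ineq4) auto
  have R_ge: "0 \<le> R u v" for u v by (simp add: R_def)
  have S_bd: "\<bar>S u v\<bar> \<le> (Ca + Ca) * (Cb + Cb)" for u v
  proof -
    have "\<alpha> u + \<alpha> v \<le> Ca + Ca" "\<beta> u + \<beta> v \<le> Cb + Cb" "0 \<le> \<alpha> u + \<alpha> v" "0 \<le> \<beta> u + \<beta> v"
      unfolding \<alpha>_def \<beta>_def by (intro add_mono Ca Cb add_nonneg_nonneg norm_ge_zero)+
    then show ?thesis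
      unfolding S_def abs_mult by (intro mult_mono) auto
  qed
  have S_meas: "case_prod S \<in> borel_measurable borel"
    unfolding S_def \<alpha>_def \<beta>_def case_prod_unfold by measurable
  have R_meas: "case_prod R \<in> borel_measurable borel"
    unfolding R_def case_prod_unfold by measurable
  show iR: "integrable unit2 (case_prod R)"
  proof (rule integrable_unit2[OF R_meas])
    show "norm (case_prod R z) \<le> (Ca + Ca) * (Cb + Cb)" for z
    proof (cases z)
      case (Pair u v)
      then show ?thesis
        using order_trans[OF R_le order_trans[OF abs_ge_self S_bd], of u v] R_ge[of u v] by simp
    qed
  qed
  have iS: "integrable unit2 (case_prod S)"
    by (rule integrable_unit2[OF S_meas, of "(Ca + Ca) * (Cb + Cb)"]) (use S_bd in auto)
  have ca: "continuous_on UNIV (\<lambda>t. a (to_circle t))" and cb: "continuous_on UNIV (\<lambda>t. b (to_circle t))"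
    using a b by (simp_all add: continuous_on_circle_iff)
  have i\<alpha>: "integrable unit_measure \<alpha>"
    unfolding \<alpha>_def by (intro integrable_norm integrable_unit_continuous ca)
  have i\<beta>: "integrable unit_measure \<beta>"
    unfolding \<beta>_def by (intro integrable_norm integrable_unit_continuous cb)
  have i\<alpha>\<beta>: "integrable unit_measure (\<lambda>t. \<alpha> t * \<beta> t)"
    unfolding \<alpha>_def \<beta>_def norm_mult[symmetric] by (intro integrable_norm integrable_unit_continuous continuous_intros ca cb)
  define A where "A = (\<integral>t. \<alpha> t \<partial>unit_measure)"
  define B where "B = (\<integral>t. \<beta> t \<partial>unit_measure)"
  define AB where "AB = (\<integral>t. \<alpha> t * \<beta> t \<partial>unit_measure)"
  have inner: "(\<integral>u. S u v \<partial>unit_measure) = AB + \<beta> v * A + \<alpha> v * B + \<alpha> v * \<beta> v" for v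
  proof -
    have "S u v = \<alpha> u * \<beta> u + \<beta> v * \<alpha> u + \<alpha> v * \<beta> u + \<alpha> v * \<beta> v" for u
      by (simp add: S_def algebra_simps)
    then show ?thesis
      using i\<alpha> i\<beta> i\<alpha>\<beta> by (simp add: A_def B_def AB_def)
  qed
  note sa = square_integrable_continuous[OF a] and sb = square_integrable_continuous[OF b]
  note [measurable] = square_integrableD[OF sa] square_integrableD[OF sb]
  have "A = (\<integral>p. cmod (a p) \<partial>circle_measure)"
    unfolding A_def \<alpha>_def by (rule circle_integral[symmetric]) measurable
  then have A: "A \<le> norm (to_L2 a)" "0 \<le> A"
    using integral_cmod_le_norm(2)[OF sa] by (auto simp: A_def \<alpha>_def)
  have "B = (\<integral>p. cmod (b p) \<partial>circle_measure)"
    unfolding B_def \<beta>_def by (rule circle_integral[symmetric]) measurable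
  then have B: "B \<le> norm (to_L2 b)" "0 \<le> B"
    using integral_cmod_le_norm(2)[OF sb] by (auto simp: B_def \<beta>_def)
  have "AB = (\<integral>p. cmod (a p) * cmod (b p) \<partial>circle_measure)"
    unfolding AB_def \<alpha>_def \<beta>_def by (rule circle_integral[symmetric]) measurable
  then have AB: "AB \<le> norm (to_L2 a) * norm (to_L2 b)"
    using integral_cmod_mult_le[OF sa sb] by simp
  have "(\<integral>z. case_prod R z \<partial>unit2) \<le> (\<integral>z. case_prod S z \<partial>unit2)"
    by (rule integral_mono[OF iR iS]) (use R_le in auto)
  also have "\<dots> = (\<integral>v. \<integral>u. S u v \<partial>unit_measure \<partial>unit_measure)"
    by (rule unit2_integral(2)[OF S_meas, of "(Ca + Ca) * (Cb + Cb)"]) (use S_bd in auto)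
  also have "\<dots> = 2 * AB + 2 * (A * B)"
    unfolding inner using i\<alpha> i\<beta> i\<alpha>\<beta> by (simp add: A_def[symmetric] B_def[symmetric] AB_def[symmetric])
  also have "\<dots> \<le> 2 * (norm (to_L2 a) * norm (to_L2 b)) + 2 * (norm (to_L2 a) * norm (to_L2 b))"
    using A B AB by (intro add_mono mult_left_mono mult_mono) auto
  finally show "(\<integral>z. case_prod R z \<partial>unit2) \<le> 4 * (norm (to_L2 a) * norm (to_L2 b))" by simp
qed

text \<open>g' stands for g \<circ> \<phi>^-1. After substituting \<phi> into the second form, both
  integrands have the same product of differences as numerator, and only the kernels differ, by at
  most K.\<close>

lemma form_invariance_defect:
  assumes L: "lifts_to \<phi> \<Phi> \<Phi>'" and C2: "Cn 2 \<Phi>'"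
  obtains K where "K \<ge> 0"
    "\<And>f g g' Lf L\<phi> Lg Lg'. lip Lf f \<Longrightarrow> lip L\<phi> (\<lambda>p. f (\<phi> p)) \<Longrightarrow> lip Lg g \<Longrightarrow> lip Lg' g' \<Longrightarrow> (\<And>p. g' (\<phi> p) = g p) \<Longrightarrow>
      cmod (form (\<lambda>p. f (\<phi> p)) g - form f g') \<le> K * (norm (to_L2 (\<lambda>p. f (\<phi> p))) * norm (to_L2 g))"
proof -
  note CL = lifts_toD(1)[OF L]
  obtain K where K: "K \<ge> 0" "\<And>u v. sin (pi * (u - v)) \<noteq> 0 \<Longrightarrow>
    \<bar>\<Phi>' u * \<Phi>' v / (sin (pi * (\<Phi> u - \<Phi> v)))\<^sup>2 - 1 / (sin (pi * (u - v)))\<^sup>2\<bar> \<le> K"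
    using kernel_bound[OF CL C2] by blast
  obtain m M where M: "0 < m" "\<And>t. m \<le> \<Phi>' t" "\<And>t. \<Phi>' t \<le> M"
    using circle_lift_bounds[OF CL] by metis
  have "cmod (form (\<lambda>p. f (\<phi> p)) g - form f g') \<le> (4 * K) * (norm (to_L2 (\<lambda>p. f (\<phi> p))) * norm (to_L2 g))"
    if f: "lip Lf f" and f\<phi>: "lip L\<phi> (\<lambda>p. f (\<phi> p))" and g: "lip Lg g" and g': "lip Lg' g'"
      and gg': "\<And>p. g' (\<phi> p) = g p" for f g g' Lf L\<phi> Lg Lg'
  proof -
    define a where "a p = f (\<phi> p)" for p
    have a: "lip L\<phi> a" using f\<phi> by (simp add: a_def[abs_def])
    have cont: "continuous_on UNIV a" "continuous_on UNIV g" "continuous_on UNIV f" "continuous_on UNIV g'"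
      using a g f g' by (auto simp: lip_def)
    define F1 where "F1 u v = form_integrand a g u v" for u v
    define F2 where "F2 u v = (\<Phi>' v * \<Phi>' u) *\<^sub>R form_integrand f g' (\<Phi> u) (\<Phi> v)" for u v
    define R where "R u v = cmod (a (to_circle u) - a (to_circle v)) * cmod (g (to_circle u) - g (to_circle v))" for u v
    have i1: "integrable unit2 (case_prod F1)"
      using form_integrand_integrable[OF a g] by (simp add: F1_def[abs_def])
    have i2: "integrable unit2 (case_prod F2)"
    proof (rule integrable_unit2)
      have "continuous_on UNIV (\<lambda>z::real \<times> real. (\<Phi> (fst z), \<Phi> (snd z)))"
        by (intro continuous_intros continuous_on_compose2[OF circle_liftD(5)[OF CL]]) auto
      from measurable_compose[OF borel_measurable_continuous_onI[OF this] form_integrand_measurable[OF cont(3,4)]]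
      have [measurable]: "(\<lambda>z. form_integrand f g' (\<Phi> (fst z)) (\<Phi> (snd z))) \<in> borel_measurable borel" by simp
      have [measurable]: "(\<lambda>z::real \<times> real. \<Phi>' (snd z) * \<Phi>' (fst z)) \<in> borel_measurable borel"
        by (intro borel_measurable_continuous_onI continuous_intros continuous_on_compose2[OF circle_liftD(2)[OF CL]]) auto
      show "case_prod F2 \<in> borel_measurable borel" unfolding F2_def case_prod_unfold by measurable
      show "cmod (case_prod F2 z) \<le> (M * M) * \<bar>Lf * Lg'\<bar>" for z
      proof (cases z)
        case (Pair u v)
        have "\<bar>\<Phi>' v * \<Phi>' u\<bar> \<le> M * M"
          unfolding abs_mult using M(1) M(2,3)[of u] M(2,3)[of v] by (intro mult_mono) auto
        then show ?thesis
          unfolding Pair F2_def prod.case norm_scaleR by (intro mult_mono form_integrand_bounded[OF f g']) auto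
      qed
    qed
    note R = integral_difference_products_le[OF cont(1,2)]
    have "cmod (F1 u v - F2 u v) \<le> K * R u v" for u v
    proof (cases "sin (pi * (u - v)) = 0")
      \<comment> \<open>The kernel estimate says nothing here, but u and v represent the same point
        of the circle as far as \<open>a\<close> can tell, so both integrands vanish.\<close>
      case True
      have "cmod (a (to_circle u) - a (to_circle v)) \<le> 0"
        using a True unfolding lip_def by (metis abs_zero mult_zero_right)
      then have "a (to_circle u) = a (to_circle v)" by simp
      then have "F1 u v = 0" "F2 u v = 0"
        by (simp_all add: F1_def F2_def form_integrand_def a_def lifts_toD(2)[OF L])
      then show ?thesis using K(1) by (simp add: R_def)
    next
      case False
      define q where "q = (a (to_circle u) - a (to_circle v)) * cnj (g (to_circle u) - g (to_circle v))"
      have e1: "F1 u v = q * of_real (1 / (sin (pi * (u - v)))\<^sup>2)"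
        by (simp add: F1_def form_integrand_def q_def)
      have gq: "g' (to_circle (\<Phi> t)) = g (to_circle t)" "f (to_circle (\<Phi> t)) = a (to_circle t)" for t
        using gg'[of "to_circle t"] by (simp_all add: a_def lifts_toD(2)[OF L])
      have e2: "F2 u v = q * of_real (\<Phi>' u * \<Phi>' v / (sin (pi * (\<Phi> u - \<Phi> v)))\<^sup>2)"
        by (simp add: F2_def form_integrand_def q_def gq scaleR_conv_of_real mult_ac)
      have "F1 u v - F2 u v = q * of_real (1 / (sin (pi * (u - v)))\<^sup>2 - \<Phi>' u * \<Phi>' v / (sin (pi * (\<Phi> u - \<Phi> v)))\<^sup>2)"
        unfolding e1 e2 by (simp only: of_real_diff right_diff_distrib)
      then have "cmod (F1 u v - F2 u v) = cmod q * \<bar>1 / (sin (pi * (u - v)))\<^sup>2 - \<Phi>' u * \<Phi>' v / (sin (pi * (\<Phi> u - \<Phi> v)))\<^sup>2\<bar>"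
        by (simp only: norm_mult norm_of_real)
      also have "\<dots> \<le> cmod q * K"
        using K(2)[OF False] by (intro mult_left_mono) (simp_all only: abs_minus_commute norm_ge_zero)
      also have "cmod q = R u v"
        unfolding q_def R_def norm_mult complex_mod_cnj ..
      finally show ?thesis by (simp add: mult.commute)
    qed
    then have le: "cmod (case_prod F1 z - case_prod F2 z) \<le> K * case_prod R z" for z
      by (cases z) simp
    have "form a g - form f g' = (\<integral>z. case_prod F1 z - case_prod F2 z \<partial>unit2)"
      unfolding form_change_of_variables[OF L f g']
      using Bochner_Integration.integral_diff[OF i1 i2] by (simp add: form_def F1_def[abs_def] F2_def[abs_def])
    then have "cmod (form a g - form f g') \<le> (\<integral>z. cmod (case_prod F1 z - case_prod F2 z) \<partial>unit2)"
      by (simp only: integral_norm_bound)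
    also have "\<dots> \<le> (\<integral>z. K * case_prod R z \<partial>unit2)"
      using i1 i2 R(1) le unfolding R_def[abs_def]
      by (intro integral_mono integrable_norm Bochner_Integration.integrable_diff integrable_mult_right) auto
    also have "\<dots> = K * (\<integral>z. case_prod R z \<partial>unit2)"
      by (rule integral_mult_right_zero)
    also have "\<dots> \<le> K * (4 * (norm (to_L2 a) * norm (to_L2 g)))"
      using R(2) by (intro mult_left_mono K(1)) (simp add: R_def[abs_def])
    finally show ?thesis by (simp add: a_def[abs_def])
  qed
  then show ?thesis using that[of "4 * K"] K(1) by simp
qed

lemma circle_Cn_trigf_compose:
  assumes \<psi>: "\<And>t. \<psi> (to_circle t) = to_circle (\<Psi> t)" and C: "Cn 1 \<Psi>"
  shows "circle_Cn 1 (\<lambda>p. trigf A c (\<psi> p))"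
proof -
  obtain \<Psi>' where d: "\<And>t. (\<Psi> has_vector_derivative \<Psi>' t) (at t)" and c: "continuous_on UNIV \<Psi>'"
    using C by auto
  have c\<Psi>: "continuous_on UNIV \<Psi>" using Cn_imp_continuous[OF C] .
  have "((\<lambda>t. \<Sum>n\<in>A. c n * fexp n (\<Psi> t)) has_vector_derivative
      (\<Sum>n\<in>A. c n * (\<Psi>' t *\<^sub>R (2 * pi * \<i> * of_int n * fexp n (\<Psi> t))))) (at t)" for t
  proof (intro has_vector_derivative_sum has_vector_derivative_mult_right)
    fix n
    show "((\<lambda>t. fexp n (\<Psi> t)) has_vector_derivative \<Psi>' t *\<^sub>R (2 * pi * \<i> * of_int n * fexp n (\<Psi> t))) (at t)"
      using vector_diff_chain_at[OF d fexp_has_vector_derivative] by (simp add: o_def)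
  qed
  moreover have "continuous_on UNIV (\<lambda>t. \<Sum>n\<in>A. c n * (\<Psi>' t *\<^sub>R (2 * pi * \<i> * of_int n * fexp n (\<Psi> t))))"
    by (intro continuous_intros c c\<Psi>)
  ultimately have "Cn 1 (\<lambda>t. \<Sum>n\<in>A. c n * fexp n (\<Psi> t))"
    by (auto intro!: exI)
  then show ?thesis by (simp add: circle_Cn_def trigf_def \<psi>)
qed

lemma lip_trigf: "\<exists>L. lip L (trigf A c)"
proof -
  have "Cn 1 (\<lambda>t::real. t)"
    by (auto intro!: exI[of _ "\<lambda>_. 1"] derivative_eq_intros)
  then have "circle_Cn 1 (\<lambda>p. trigf A c p)"
    using circle_Cn_trigf_compose[of "\<lambda>p. p" "\<lambda>t. t"] by simp
  then show ?thesis using lipI by metis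
qed

text \<open>Tested against trigonometric polynomials, both terms of the twisted commutator are values of
  the quadratic form of \<open>|D|\<close>, which is invariant under \<open>\<phi>\<close> up to a bounded kernel.\<close>

lemma composition_abs_commutator:
  assumes L: "lifts_to \<phi> \<Phi> \<Phi>'" and C2: "Cn 2 \<Phi>'"
    and \<psi>: "\<And>t. \<psi> (to_circle t) = to_circle (\<Psi> t)" "Cn 1 \<Psi>" and inv: "\<And>p. \<psi> (\<phi> p) = p"
    and \<delta>: "\<And>t. \<delta> (to_circle t) = of_real (\<Phi>' t)"
  obtains M where "M \<ge> 0" "\<And>A c \<eta>. finite A \<Longrightarrow>
    (wcomp (\<lambda>_. 1) \<phi> (trig A c), \<eta>) \<in> mult_op (\<lambda>n. 2 * pi * \<bar>of_int n\<bar>) \<Longrightarrow>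
    norm (\<eta> - wcomp \<delta> \<phi> (trig A (\<lambda>n. of_real (2 * pi * \<bar>of_int n\<bar>) * c n))) \<le> M * norm (trig A c)"
proof -
  note CL = lifts_toD(1)[OF L]
  obtain K where K: "K \<ge> 0"
    "\<And>f g g' Lf L\<phi> Lg Lg'. lip Lf f \<Longrightarrow> lip L\<phi> (\<lambda>p. f (\<phi> p)) \<Longrightarrow> lip Lg g \<Longrightarrow> lip Lg' g' \<Longrightarrow> (\<And>p. g' (\<phi> p) = g p) \<Longrightarrow>
      cmod (form (\<lambda>p. f (\<phi> p)) g - form f g') \<le> K * (norm (to_L2 (\<lambda>p. f (\<phi> p))) * norm (to_L2 g))"
    using form_invariance_defect[OF L C2] by blast
  have c1: "continuous_on UNIV (\<lambda>_::circle. 1 :: complex)" by simp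
  obtain C where C: "C \<ge> 0" "\<And>\<xi>. norm (wcomp (\<lambda>_. 1) \<phi> \<xi>) \<le> C * norm \<xi>"
    using wcomp_bounded[OF L c1] by blast
  have c\<delta>: "continuous_on UNIV \<delta>"
    unfolding continuous_on_circle_iff \<delta> by (intro continuous_intros circle_liftD(2)[OF CL])
  \<comment> \<open>The factor \<pi>/2 normalises the form, \<open>K\<close> is the kernel defect,
    and \<open>C\<close> bounds the norm of p \<circ> \<phi> by that of p.\<close>
  have "norm (\<eta> - wcomp \<delta> \<phi> (trig A (\<lambda>n. of_real (2 * pi * \<bar>of_int n\<bar>) * c n))) \<le> (pi / 2 * K * C) * norm (trig A c)"
    if A: "finite A" and \<eta>: "(wcomp (\<lambda>_. 1) \<phi> (trig A c), \<eta>) \<in> mult_op (\<lambda>n. 2 * pi * \<bar>of_int n\<bar>)" for A c \<eta>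
  proof -
    define p where "p = trigf A c"
    define d where "d n = of_real (2 * pi * \<bar>of_int n\<bar>) * c n" for n
    define \<alpha> where "\<alpha> = \<eta> - wcomp \<delta> \<phi> (trig A d)"
    have cp: "continuous_on UNIV p" unfolding p_def by (rule continuous_trigf)
    have p\<phi>: "wcomp (\<lambda>_. 1) \<phi> (trig A c) = to_L2 (\<lambda>x. p (\<phi> x))"
      unfolding p_def to_L2_trigf[symmetric]
      by (subst wcomp_to_L2[OF L c1 square_integrable_continuous[OF continuous_trigf]]) simp
    have "Cn 1 \<Phi>"
      using circle_liftD(1,2)[OF CL] by (auto simp: has_real_derivative_iff_has_vector_derivative)
    obtain Lp where lp: "lip Lp p" using lip_trigf p_def by metis
    obtain L\<phi> where lp\<phi>: "lip L\<phi> (\<lambda>x. p (\<phi> x))"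
      using lipI[OF circle_Cn_trigf_compose[OF lifts_toD(2)[OF L] \<open>Cn 1 \<Phi>\<close>]] unfolding p_def by metis
    have bound: "cmod (cinner \<alpha> (trig B b)) \<le> (pi / 2 * K * C * norm (trig A c)) * norm (trig B b)" if B: "finite B" for B b
    proof -
      define q where "q = trigf B b"
      define q' where "q' x = q (\<psi> x)" for x
      have cq: "continuous_on UNIV q" unfolding q_def by (rule continuous_trigf)
      obtain Lq where lq: "lip Lq q" using lip_trigf q_def by metis
      obtain Lq' where lq': "lip Lq' q'"
        using lipI[OF circle_Cn_trigf_compose[OF \<psi>]] unfolding q'_def q_def by metis
      have cq': "continuous_on UNIV q'" using lq' by (simp add: lip_def)
      have q'\<phi>: "q' (\<phi> x) = q x" for x by (simp add: q'_def inv)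
      \<comment> \<open>The eigenvalue 2\<pi>|n| is written as \<pi>/2 times 4|n| to match the value
        of the form on characters.\<close>
      have "cinner \<eta> (trig B b) = (\<Sum>n\<in>B. of_real (pi / 2) * (cnj (b n) * (of_real (4 * \<bar>of_int n\<bar>) * fc (to_L2 (\<lambda>x. p (\<phi> x))) n)))"
        unfolding cinner_trig_right using \<eta> by (intro sum.cong) (auto simp: mult_op_iff p\<phi>)
      also have "\<dots> = of_real (pi / 2) * form (\<lambda>x. p (\<phi> x)) q"
        unfolding q_def form_trigf[OF lp\<phi>] sum_distrib_left ..
      finally have 1: "cinner \<eta> (trig B b) = of_real (pi / 2) * form (\<lambda>x. p (\<phi> x)) q" .
      \<comment> \<open>The weight \<delta> is the Jacobian of \<phi>, so the substitution moves
        \<phi> from |D|p, whose coefficients are \<open>d\<close>, to the test function, where it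
        appears as the inverse in \<open>q'\<close>.\<close>
      have "cinner (wcomp \<delta> \<phi> (trig A d)) (trig B b) = cinner (trig A d) (to_L2 q')"
      proof -
        have cd: "continuous_on UNIV (trigf A d)" by (rule continuous_trigf)
        note sd = square_integrable_continuous[OF cd] and sq = square_integrable_continuous[OF cq]
          and sq' = square_integrable_continuous[OF cq']
        have "cinner (wcomp \<delta> \<phi> (trig A d)) (trig B b) = cinner (to_L2 (\<lambda>x. \<delta> x * trigf A d (\<phi> x))) (to_L2 q)"
          unfolding q_def to_L2_trigf[symmetric] wcomp_to_L2[OF L c\<delta> sd] ..
        also have "\<dots> = (\<integral>t. \<delta> (to_circle t) * trigf A d (\<phi> (to_circle t)) * cnj (q (to_circle t)) \<partial>unit_measure)"
          by (rule cinner_to_L2_unit[OF square_integrable_wcomp[OF L c\<delta> sd] sq])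
        also have "\<dots> = (\<integral>t. \<Phi>' t *\<^sub>R (trigf A d (to_circle (\<Phi> t)) * cnj (q' (to_circle (\<Phi> t)))) \<partial>unit_measure)"
        proof (rule Bochner_Integration.integral_cong[OF refl])
          fix t
          have "q' (to_circle (\<Phi> t)) = q (to_circle t)"
            using q'\<phi>[of "to_circle t"] by (simp add: lifts_toD(2)[OF L])
          then show "\<delta> (to_circle t) * trigf A d (\<phi> (to_circle t)) * cnj (q (to_circle t))
              = \<Phi>' t *\<^sub>R (trigf A d (to_circle (\<Phi> t)) * cnj (q' (to_circle (\<Phi> t))))"
            by (simp add: \<delta> lifts_toD(2)[OF L] scaleR_conv_of_real)
        qed
        also have "\<dots> = (\<integral>t. trigf A d (to_circle t) * cnj (q' (to_circle t)) \<partial>unit_measure)"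
        proof (rule integral_circle_lift[OF CL])
          have "continuous_on UNIV (\<lambda>t. trigf A d (to_circle t) * cnj (q' (to_circle t)))"
            using cd cq' by (intro continuous_intros) (simp_all add: continuous_on_circle_iff)
          then show "(\<lambda>t. trigf A d (to_circle t) * cnj (q' (to_circle t))) \<in> borel_measurable borel"
            by (rule borel_measurable_continuous_onI)
        qed simp
        also have "\<dots> = cinner (trig A d) (to_L2 q')"
          unfolding to_L2_trigf[symmetric] by (rule cinner_to_L2_unit[OF sd sq', symmetric])
        finally show ?thesis .
      qed
      \<comment> \<open>\<open>form_trigf\<close> evaluates the form with a trigonometric polynomial
        in the second place. Here \<open>p\<close> is the polynomial while \<open>q'\<close> is not
        one, so the form is conjugated before and after.\<close>
      also have "\<dots> = cnj (cinner (to_L2 q') (trig A d))"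
        by (rule cinner_commute)
      also have "cinner (to_L2 q') (trig A d) = (\<Sum>n\<in>A. of_real (pi / 2) * (cnj (c n) * (of_real (4 * \<bar>of_int n\<bar>) * fc (to_L2 q') n)))"
        unfolding cinner_trig_right by (intro sum.cong) (auto simp: d_def)
      also have "\<dots> = of_real (pi / 2) * form q' p"
        unfolding p_def form_trigf[OF lq'] sum_distrib_left ..
      also have "cnj (of_real (pi / 2) * form q' p) = of_real (pi / 2) * form p q'"
        using form_cnj[of p q'] by simp
      finally have 2: "cinner (wcomp \<delta> \<phi> (trig A d)) (trig B b) = of_real (pi / 2) * form p q'" .
      have "cinner \<alpha> (trig B b) = of_real (pi / 2) * (form (\<lambda>x. p (\<phi> x)) q - form p q')"
        unfolding \<alpha>_def cinner_diff_left 1 2 by (simp only: right_diff_distrib)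
      then have "cmod (cinner \<alpha> (trig B b)) = \<bar>pi / 2\<bar> * cmod (form (\<lambda>x. p (\<phi> x)) q - form p q')"
        by (simp only: norm_mult norm_of_real)
      also have "\<bar>pi / 2\<bar> = pi / 2" by simp
      also have "pi / 2 * cmod (form (\<lambda>x. p (\<phi> x)) q - form p q') \<le> pi / 2 * (K * (norm (to_L2 (\<lambda>x. p (\<phi> x))) * norm (to_L2 q)))"
        using K(2)[OF lp lp\<phi> lq lq' q'\<phi>] by (intro mult_left_mono) auto
      also have "\<dots> \<le> pi / 2 * (K * ((C * norm (trig A c)) * norm (to_L2 q)))"
        unfolding p\<phi>[symmetric] using C by (intro mult_left_mono mult_right_mono K(1)) auto
      also have "to_L2 q = trig B b" unfolding q_def by (rule to_L2_trigf)
      finally show ?thesis by (simp add: mult_ac)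
    qed
    have "norm \<alpha> \<le> \<bar>pi / 2 * K * C * norm (trig A c)\<bar>"
      by (rule norm_le_if_tested, rule bound) simp
    also have "\<dots> = (pi / 2 * K * C) * norm (trig A c)"
      using K(1) C(1) by simp
    finally show ?thesis by (simp add: \<alpha>_def d_def[abs_def])
  qed
  then show ?thesis using that[of "pi / 2 * K * C"] K(1) C(1) by simp
qed

section \<open>Twisted commutators\<close>

definition bounded_clinear :: "(L2_circle \<Rightarrow> L2_circle) \<Rightarrow> bool"
  where "bounded_clinear T \<longleftrightarrow> (\<forall>\<xi> \<eta>. T (\<xi> + \<eta>) = T \<xi> + T \<eta>) \<and> (\<forall>c \<xi>. T (c *\<^sub>C \<xi>) = c *\<^sub>C T \<xi>) \<and>
    (\<exists>C. \<forall>\<xi>. norm (T \<xi>) \<le> C * norm \<xi>)"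

lemma bounded_clinear_diff: "bounded_clinear T \<Longrightarrow> T (\<xi> - \<eta>) = T \<xi> - T \<eta>"
  by (simp add: bounded_clinear_def minus_eq_scaleC)

lemma bounded_clinear_bounded_linear: "bounded_clinear T \<Longrightarrow> bounded_linear T"
proof -
  assume T: "bounded_clinear T"
  then obtain C where C: "\<And>\<xi>. norm (T \<xi>) \<le> C * norm \<xi>"
    by (auto simp: bounded_clinear_def)
  show "bounded_linear T"
    by (rule bounded_linear_intro[of _ C])
       (use T C in \<open>auto simp: bounded_clinear_def scaleR_eq_scaleC mult.commute\<close>)
qed

lemma bounded_clinear_tendsto:
  assumes "bounded_clinear T" "(X \<longlongrightarrow> \<xi>) F"
  shows "((\<lambda>k. T (X k)) \<longlongrightarrow> T \<xi>) F"
  using bounded_linear.tendsto[OF bounded_clinear_bounded_linear[OF assms(1)] assms(2)] .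

lemma bounded_clinear_zero: "bounded_clinear (\<lambda>_. 0)"
  by (auto simp: bounded_clinear_def intro!: exI[of _ 0])

lemma bounded_clinear_add:
  assumes "bounded_clinear S" "bounded_clinear T"
  shows "bounded_clinear (\<lambda>\<xi>. S \<xi> + T \<xi>)"
proof -
  obtain C D where "\<And>\<xi>. norm (S \<xi>) \<le> C * norm \<xi>" "\<And>\<xi>. norm (T \<xi>) \<le> D * norm \<xi>"
    using assms by (auto simp: bounded_clinear_def)
  then have "norm (S \<xi> + T \<xi>) \<le> (C + D) * norm \<xi>" for \<xi>
    unfolding distrib_right by (rule norm_triangle_mono)
  with assms show ?thesis
    by (auto simp: bounded_clinear_def scaleC_add_right add_ac)
qed

lemma bounded_clinear_wcomp:
  assumes "lifts_to \<phi> \<Phi> \<Phi>'" "continuous_on UNIV w"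
  shows "bounded_clinear (wcomp w \<phi>)"
  using wcomp_add[OF assms] wcomp_scaleC[OF assms] wcomp_bounded[OF assms]
  unfolding bounded_clinear_def by metis

text \<open>Only trigonometric polynomials are tested, since the form argument applies to them.
  Values of |D| enter as second components of its graph, so that the domain question is kept apart
  from the estimate.\<close>

definition abs_commutator_bounded :: "(int \<Rightarrow> real) \<Rightarrow> (L2_circle \<Rightarrow> L2_circle) \<Rightarrow> (L2_circle \<Rightarrow> L2_circle) \<Rightarrow> bool"
  where "abs_commutator_bounded \<kappa> A A' \<longleftrightarrow> (\<exists>M\<ge>0. \<forall>J c \<zeta> \<eta>. finite J \<longrightarrow>
    (trig J c, \<zeta>) \<in> mult_op (\<lambda>n. \<bar>\<kappa> n\<bar>) \<longrightarrow> (A (trig J c), \<eta>) \<in> mult_op (\<lambda>n. \<bar>\<kappa> n\<bar>) \<longrightarrow>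
    norm (\<eta> - A' \<zeta>) \<le> M * norm (trig J c))"

text \<open>A package stable under the finite sums that make up \<pi>(a). The clause with U is the
  Leibniz rule: it bounds the commutator with D and, at the same time, shows that A preserves the
  domain, on which the treatment of |D| relies.\<close>

definition twisted_pair :: "(int \<Rightarrow> real) \<Rightarrow> (L2_circle \<Rightarrow> L2_circle) \<Rightarrow> (L2_circle \<Rightarrow> L2_circle) \<Rightarrow> bool"
  where "twisted_pair \<kappa> A A' \<longleftrightarrow> bounded_clinear A \<and> bounded_clinear A' \<and>
    (\<exists>U. bounded_clinear U \<and> (\<forall>\<xi> \<zeta>. (\<xi>, \<zeta>) \<in> mult_op \<kappa> \<longrightarrow> (A \<xi>, A' \<zeta> + U \<xi>) \<in> mult_op \<kappa>)) \<and>
    abs_commutator_bounded \<kappa> A A'"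

section \<open>Equality of the domains of D and |D|, and finite sums of twisted pairs\<close>

lemma Domain_mult_op_abs: "Domain (mult_op (\<lambda>n. \<bar>\<kappa> n\<bar>)) = Domain (mult_op \<kappa>)"
proof -
  have *: "Domain (mult_op \<kappa>) \<subseteq> Domain (mult_op \<mu>)" if eq: "\<And>n. \<bar>\<kappa> n\<bar> = \<bar>\<mu> n\<bar>" for \<kappa> \<mu> :: "int \<Rightarrow> real"
  proof
    fix \<xi> assume "\<xi> \<in> Domain (mult_op \<kappa>)"
    then obtain \<zeta> where "(\<xi>, \<zeta>) \<in> mult_op \<kappa>" by blast
    then have "cmod (of_real (\<mu> n) * fc \<xi> n) \<le> 1 * cmod (fc \<zeta> n)" for n
      using eq[of n] by (simp add: mult_op_iff norm_mult)
    then obtain \<eta> where "fc \<eta> = (\<lambda>n. of_real (\<mu> n) * fc \<xi> n)"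
      by (rule multiplier_exists)
    then have "(\<xi>, \<eta>) \<in> mult_op \<mu>" by (simp add: mult_op_iff)
    then show "\<xi> \<in> Domain (mult_op \<mu>)" by blast
  qed
  show ?thesis
    by (intro equalityI *) simp_all
qed

lemma norm_mult_op_abs:
  assumes "(\<xi>, \<zeta>) \<in> mult_op \<kappa>" "(\<xi>, \<eta>) \<in> mult_op (\<lambda>n. \<bar>\<kappa> n\<bar>)"
  shows "norm \<eta> \<le> norm \<zeta>"
  using norm_le_if_fc_le[of \<eta> 1 \<zeta>] assms by (simp add: mult_op_iff norm_mult)

lemma twisted_pair_zero: "twisted_pair \<kappa> (\<lambda>_. 0) (\<lambda>_. 0)"
proof -
  have "\<eta> = 0" if "(0, \<eta>) \<in> mult_op (\<lambda>n. \<bar>\<kappa> n\<bar>)" for \<eta>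
    using mult_op_unique[OF that mult_op_zero] .
  then show ?thesis
    unfolding twisted_pair_def abs_commutator_bounded_def
    by (intro conjI exI[of _ "\<lambda>_. 0"] exI[of _ 0] bounded_clinear_zero) (auto simp: mult_op_zero)
qed

lemma twisted_pair_add:
  assumes A: "twisted_pair \<kappa> A A'" and B: "twisted_pair \<kappa> B B'"
  shows "twisted_pair \<kappa> (\<lambda>\<xi>. A \<xi> + B \<xi>) (\<lambda>\<xi>. A' \<xi> + B' \<xi>)"
proof -
  let ?P = "mult_op (\<lambda>n. \<bar>\<kappa> n\<bar>)"
  obtain U where U: "bounded_clinear U" "\<And>\<xi> \<zeta>. (\<xi>, \<zeta>) \<in> mult_op \<kappa> \<Longrightarrow> (A \<xi>, A' \<zeta> + U \<xi>) \<in> mult_op \<kappa>"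
    using A by (auto simp: twisted_pair_def)
  obtain V where V: "bounded_clinear V" "\<And>\<xi> \<zeta>. (\<xi>, \<zeta>) \<in> mult_op \<kappa> \<Longrightarrow> (B \<xi>, B' \<zeta> + V \<xi>) \<in> mult_op \<kappa>"
    using B by (auto simp: twisted_pair_def)
  obtain M where M: "M \<ge> 0" "\<And>J c \<zeta> \<eta>. finite J \<Longrightarrow> (trig J c, \<zeta>) \<in> ?P \<Longrightarrow> (A (trig J c), \<eta>) \<in> ?P \<Longrightarrow>
      norm (\<eta> - A' \<zeta>) \<le> M * norm (trig J c)"
    using A unfolding twisted_pair_def abs_commutator_bounded_def by blast
  obtain N where N: "N \<ge> 0" "\<And>J c \<zeta> \<eta>. finite J \<Longrightarrow> (trig J c, \<zeta>) \<in> ?P \<Longrightarrow> (B (trig J c), \<eta>) \<in> ?P \<Longrightarrow>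
      norm (\<eta> - B' \<zeta>) \<le> N * norm (trig J c)"
    using B unfolding twisted_pair_def abs_commutator_bounded_def by blast
  have 1: "(A \<xi> + B \<xi>, (A' \<zeta> + B' \<zeta>) + (U \<xi> + V \<xi>)) \<in> mult_op \<kappa>" if "(\<xi>, \<zeta>) \<in> mult_op \<kappa>" for \<xi> \<zeta>
    using mult_op_add[OF U(2)[OF that] V(2)[OF that]] by (simp add: add_ac)
  have 2: "norm (\<eta> - (A' \<zeta> + B' \<zeta>)) \<le> (M + N) * norm (trig J c)"
    if J: "finite J" and \<zeta>: "(trig J c, \<zeta>) \<in> ?P" and \<eta>: "(A (trig J c) + B (trig J c), \<eta>) \<in> ?P" for J c \<zeta> \<eta>
  proof -
    \<comment> \<open>That the sum of the two images lies in the domain of |D| does not place either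
      of them there. The Leibniz clause for A does so for the first, and the difference takes care
      of the second.\<close>
    have "trig J c \<in> Domain (mult_op \<kappa>)"
      using mult_op_trig[OF J, of c \<kappa>] by blast
    then have "A (trig J c) \<in> Domain ?P"
      unfolding Domain_mult_op_abs using U(2) by blast
    then obtain \<eta>1 where \<eta>1: "(A (trig J c), \<eta>1) \<in> ?P" by blast
    have \<eta>2: "(B (trig J c), \<eta> - \<eta>1) \<in> ?P"
      using mult_op_diff[OF \<eta> \<eta>1] by simp
    have "norm ((\<eta>1 - A' \<zeta>) + ((\<eta> - \<eta>1) - B' \<zeta>)) \<le> M * norm (trig J c) + N * norm (trig J c)"
      by (intro norm_triangle_mono M(2)[OF J \<zeta> \<eta>1] N(2)[OF J \<zeta> \<eta>2])
    then show ?thesis by (simp add: algebra_simps)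
  qed
  show ?thesis
    unfolding twisted_pair_def abs_commutator_bounded_def
  proof (intro conjI)
    show "bounded_clinear (\<lambda>\<xi>. A \<xi> + B \<xi>)" "bounded_clinear (\<lambda>\<xi>. A' \<xi> + B' \<xi>)"
      using A B by (auto simp: twisted_pair_def intro: bounded_clinear_add)
    show "\<exists>W. bounded_clinear W \<and> (\<forall>\<xi> \<zeta>. (\<xi>, \<zeta>) \<in> mult_op \<kappa> \<longrightarrow> (A \<xi> + B \<xi>, A' \<zeta> + B' \<zeta> + W \<xi>) \<in> mult_op \<kappa>)"
      using 1 by (intro exI[of _ "\<lambda>\<xi>. U \<xi> + V \<xi>"] conjI bounded_clinear_add U V) auto
    show "\<exists>K\<ge>0. \<forall>J c \<zeta> \<eta>. finite J \<longrightarrow> (trig J c, \<zeta>) \<in> ?P \<longrightarrow> (A (trig J c) + B (trig J c), \<eta>) \<in> ?P \<longrightarrow>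
        norm (\<eta> - (A' \<zeta> + B' \<zeta>)) \<le> K * norm (trig J c)"
      using 2 M(1) N(1) by (intro exI[of _ "M + N"] conjI allI impI) auto
  qed
qed

lemma twisted_pair_sum:
  assumes "\<And>i. i \<in> I \<Longrightarrow> twisted_pair \<kappa> (A i) (A' i)"
  shows "twisted_pair \<kappa> (\<lambda>\<xi>. \<Sum>i\<in>I. A i \<xi>) (\<lambda>\<xi>. \<Sum>i\<in>I. A' i \<xi>)"
  using assms
  by (induction I rule: infinite_finite_induct) (simp_all add: twisted_pair_zero twisted_pair_add)

lemma trig_diff_is_trig:
  assumes "finite J" "finite J'"
  obtains e where "trig J c - trig J' c' = trig (J \<union> J') e"
proof
  show "trig J c - trig J' c' = trig (J \<union> J') (\<lambda>n. (if n \<in> J then c n else 0) - (if n \<in> J' then c' n else 0))"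
    using assms by (intro fc_eqI) (simp add: fc_diff fc_trig)
qed

lemma trig_add: "trig J (\<lambda>n. c n + d n) = trig J c + trig J d"
  by (simp add: trig_def scaleC_add_left sum.distrib)

lemma trig_scaleC: "trig J (\<lambda>n. k * c n) = k *\<^sub>C trig J c"
  by (simp add: trig_def scaleC_sum)

lemma twisted_commutator_bounded:
  assumes pair: "twisted_pair \<kappa> A A'"
  shows "bounded_from (Domain (mult_op \<kappa>)) (twisted_commutator (mult_op \<kappa>) A A')"
proof -
  obtain U where U: "bounded_clinear U" "\<And>\<xi> \<zeta>. (\<xi>, \<zeta>) \<in> mult_op \<kappa> \<Longrightarrow> (A \<xi>, A' \<zeta> + U \<xi>) \<in> mult_op \<kappa>"
    using pair by (auto simp: twisted_pair_def)
  show ?thesis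
    unfolding bounded_from_def
  proof
    show "Domain (mult_op \<kappa>) \<subseteq> Domain (twisted_commutator (mult_op \<kappa>) A A')"
      using U(2) unfolding twisted_commutator_def by blast
    have "U \<xi> = \<eta> - A' \<zeta>" if "(A \<xi>, \<eta>) \<in> mult_op \<kappa>" "(\<xi>, \<zeta>) \<in> mult_op \<kappa>" for \<xi> \<eta> \<zeta>
      using mult_op_unique[OF that(1) U(2)[OF that(2)]] by simp
    then show "\<exists>B. bounded_linear B \<and> (\<forall>c \<xi>. B (c *\<^sub>C \<xi>) = c *\<^sub>C B \<xi>) \<and>
        (\<forall>(\<xi>, \<eta>)\<in>twisted_commutator (mult_op \<kappa>) A A'. B \<xi> = \<eta>)"
      using U(1) bounded_clinear_bounded_linear[OF U(1)]
      by (intro exI[of _ U]) (auto simp: twisted_commutator_def bounded_clinear_def)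
  qed
qed

text \<open>The commutator is bounded on trigonometric polynomials, and these are a core of \<open>D\<close>; the
  bounded extension is its limit along the Fourier partial sums.\<close>

lemma twisted_abs_commutator_bounded:
  assumes pair: "twisted_pair \<kappa> A A'"
  shows "bounded_from (Domain (mult_op \<kappa>)) (twisted_commutator (mult_op (\<lambda>n. \<bar>\<kappa> n\<bar>)) A A')"
proof -
  define P where "P = mult_op (\<lambda>n. \<bar>\<kappa> n\<bar>)"
  have A: "bounded_clinear A" "bounded_clinear A'"
    using pair by (auto simp: twisted_pair_def)
  obtain U where U: "bounded_clinear U" "\<And>\<xi> \<zeta>. (\<xi>, \<zeta>) \<in> mult_op \<kappa> \<Longrightarrow> (A \<xi>, A' \<zeta> + U \<xi>) \<in> mult_op \<kappa>"
    using pair by (auto simp: twisted_pair_def)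
  obtain M where M: "M \<ge> 0" "\<And>J c \<zeta> \<eta>. finite J \<Longrightarrow> (trig J c, \<zeta>) \<in> P \<Longrightarrow> (A (trig J c), \<eta>) \<in> P \<Longrightarrow>
      norm (\<eta> - A' \<zeta>) \<le> M * norm (trig J c)"
    using pair unfolding twisted_pair_def abs_commutator_bounded_def P_def by blast
  define TC where "TC = twisted_commutator P A A'"
  have dom: "Domain (mult_op \<kappa>) \<subseteq> Domain TC"
  proof
    fix \<xi> assume \<xi>: "\<xi> \<in> Domain (mult_op \<kappa>)"
    then have "A \<xi> \<in> Domain (mult_op \<kappa>)" using U(2) by blast
    with \<xi> show "\<xi> \<in> Domain TC"
      unfolding Domain_mult_op_abs[symmetric, of \<kappa>] TC_def twisted_commutator_def P_def by blast
  qed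
  have TC_unique: "\<tau> = \<tau>'" if "(\<xi>, \<tau>) \<in> TC" "(\<xi>, \<tau>') \<in> TC" for \<xi> \<tau> \<tau>'
    using that unfolding TC_def twisted_commutator_def P_def by (auto dest: mult_op_unique)
  have TC_lin: "(\<xi> + c *\<^sub>C \<xi>', \<tau> + c *\<^sub>C \<tau>') \<in> TC" if t1: "(\<xi>, \<tau>) \<in> TC" and t2: "(\<xi>', \<tau>') \<in> TC" for \<xi> \<tau> \<xi>' \<tau>' c
  proof -
    obtain \<eta> \<zeta> where 1: "\<tau> = \<eta> - A' \<zeta>" "(A \<xi>, \<eta>) \<in> P" "(\<xi>, \<zeta>) \<in> P"
      using t1 by (auto simp: TC_def twisted_commutator_def)
    obtain \<eta>' \<zeta>' where 2: "\<tau>' = \<eta>' - A' \<zeta>'" "(A \<xi>', \<eta>') \<in> P" "(\<xi>', \<zeta>') \<in> P"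
      using t2 by (auto simp: TC_def twisted_commutator_def)
    have "(A (\<xi> + c *\<^sub>C \<xi>'), \<eta> + c *\<^sub>C \<eta>') \<in> P" "(\<xi> + c *\<^sub>C \<xi>', \<zeta> + c *\<^sub>C \<zeta>') \<in> P"
      using 1 2 A(1) unfolding P_def bounded_clinear_def by (auto intro!: mult_op_add mult_op_scaleC)
    moreover have "\<tau> + c *\<^sub>C \<tau>' = (\<eta> + c *\<^sub>C \<eta>') - A' (\<zeta> + c *\<^sub>C \<zeta>')"
      using A(2) unfolding 1 2 bounded_clinear_def by (simp add: scaleC_diff_right)
    ultimately show ?thesis
      unfolding TC_def twisted_commutator_def by blast
  qed
  \<comment> \<open>A value of the commutator; it is single valued, so the choice is determined on
    the domain of D, the only place where \<open>T\<close> is used.\<close>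
  define T where "T \<xi> = (SOME \<tau>. (\<xi>, \<tau>) \<in> TC)" for \<xi>
  have T: "(\<xi>, T \<xi>) \<in> TC" if "\<xi> \<in> Domain (mult_op \<kappa>)" for \<xi>
    unfolding T_def using dom that by (metis DomainE someI_ex subsetD)
  have trig_dom: "trig J c \<in> Domain (mult_op \<kappa>)" if "finite J" for J c
    using mult_op_trig[OF that, of c \<kappa>] by blast
  have T_bound: "norm (T (trig J c)) \<le> M * norm (trig J c)" if "finite J" for J c
    using T[OF trig_dom[OF that, of c]] M(2)[OF that, of c] by (auto simp: TC_def twisted_commutator_def)
  have T_lin: "T (\<xi> + c *\<^sub>C \<xi>') = T \<xi> + c *\<^sub>C T \<xi>'"
    if "\<xi> \<in> Domain (mult_op \<kappa>)" "\<xi>' \<in> Domain (mult_op \<kappa>)" for \<xi> \<xi>' c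
  proof -
    have "\<xi> + c *\<^sub>C \<xi>' \<in> Domain (mult_op \<kappa>)"
      using that by (auto intro: mult_op_add mult_op_scaleC)
    from TC_unique[OF T[OF this] TC_lin[OF T[OF that(1)] T[OF that(2)]]] show ?thesis .
  qed
  define S where "S N \<xi> = trig (symm N) (fc \<xi>)" for N \<xi>
  have S_dom: "S N \<xi> \<in> Domain (mult_op \<kappa>)" for N \<xi>
    unfolding S_def by (rule trig_dom) simp
  have S_lim: "(\<lambda>N. S N \<xi>) \<longlonglongrightarrow> \<xi>" for \<xi>
    unfolding S_def by (rule fourier_series)
  have S_lin: "S N (\<xi> + c *\<^sub>C \<xi>') = S N \<xi> + c *\<^sub>C S N \<xi>'" for N c \<xi> \<xi>'
    unfolding S_def trig_add[symmetric] trig_scaleC[symmetric]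
    by (rule arg_cong[of _ _ "trig (symm N)"]) (simp add: fun_eq_iff fc_add fc_scaleC)
  have T_dist: "norm (T (S m \<xi>) - T (S n \<xi>)) \<le> M * norm (S m \<xi> - S n \<xi>)" for m n \<xi>
  proof -
    obtain e where e: "S m \<xi> - S n \<xi> = trig (symm m \<union> symm n) e"
      unfolding S_def by (rule trig_diff_is_trig[of "symm m" "symm n"]) simp_all
    have "T (S m \<xi>) - T (S n \<xi>) = T (S m \<xi> - S n \<xi>)"
      unfolding minus_eq_scaleC by (rule T_lin[OF S_dom S_dom, symmetric])
    then show ?thesis unfolding e using T_bound[of "symm m \<union> symm n" e] by simp
  qed
  have "convergent (\<lambda>N. T (S N \<xi>))" for \<xi>
  proof (rule Cauchy_convergent, rule CauchyI)
    fix e :: real assume "e > 0"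
    then have "e / (M + 1) > 0" using M(1) by simp
    then obtain N where N: "\<And>m n. m \<ge> N \<Longrightarrow> n \<ge> N \<Longrightarrow> norm (S m \<xi> - S n \<xi>) < e / (M + 1)"
      using CauchyD[OF LIMSEQ_imp_Cauchy[OF S_lim[of \<xi>]]] by blast
    have "norm (T (S m \<xi>) - T (S n \<xi>)) < e" if "m \<ge> N" "n \<ge> N" for m n
    proof -
      have "norm (T (S m \<xi>) - T (S n \<xi>)) \<le> (M + 1) * norm (S m \<xi> - S n \<xi>)"
        using T_dist[of m \<xi> n] by (simp add: distrib_right add_increasing2)
      also have "\<dots> < e"
        using N[OF that] M(1) by (simp add: pos_less_divide_eq mult.commute)
      finally show ?thesis .
    qed
    then show "\<exists>N. \<forall>m\<ge>N. \<forall>n\<ge>N. norm (T (S m \<xi>) - T (S n \<xi>)) < e" by blast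
  qed
  then have "\<exists>\<beta>. (\<lambda>N. T (S N \<xi>)) \<longlonglongrightarrow> \<beta>" for \<xi>
    by (simp add: convergent_def)
  then obtain B where B: "\<And>\<xi>. (\<lambda>N. T (S N \<xi>)) \<longlonglongrightarrow> B \<xi>" by metis
  have tendsto_scaleC: "(\<lambda>N. c *\<^sub>C X N) \<longlonglongrightarrow> c *\<^sub>C \<xi>" if "X \<longlonglongrightarrow> \<xi>" for c X \<xi>
    by (rule tendsto_bounded_additive[where C="cmod c"]) (simp_all add: scaleC_diff_right that)
  have B_lin: "B (\<xi> + c *\<^sub>C \<xi>') = B \<xi> + c *\<^sub>C B \<xi>'" for \<xi> \<xi>' c
  proof (rule LIMSEQ_unique[OF B])
    have "(\<lambda>N. T (S N \<xi>) + c *\<^sub>C T (S N \<xi>')) \<longlonglongrightarrow> B \<xi> + c *\<^sub>C B \<xi>'"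
      by (intro tendsto_add tendsto_scaleC B)
    then show "(\<lambda>N. T (S N (\<xi> + c *\<^sub>C \<xi>'))) \<longlonglongrightarrow> B \<xi> + c *\<^sub>C B \<xi>'"
      by (simp add: S_lin T_lin S_dom)
  qed
  have B0: "B 0 = 0"
    using B_lin[of 0 1 0] by simp
  have "bounded_clinear B"
    unfolding bounded_clinear_def
  proof (intro conjI allI exI[of _ M])
    show "B (\<xi> + \<eta>) = B \<xi> + B \<eta>" for \<xi> \<eta> using B_lin[of \<xi> 1 \<eta>] by simp
    show "B (c *\<^sub>C \<xi>) = c *\<^sub>C B \<xi>" for c \<xi> using B_lin[of 0 c \<xi>] B0 by simp
    fix \<xi>
    show "norm (B \<xi>) \<le> M * norm \<xi>"
    proof (rule LIMSEQ_le_const2[OF tendsto_norm[OF B]], intro exI allI impI)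
      fix N
      have "norm (T (S N \<xi>)) \<le> M * norm (S N \<xi>)"
        unfolding S_def by (rule T_bound) simp
      also have "\<dots> \<le> M * norm \<xi>"
        unfolding S_def by (intro mult_left_mono norm_trig_fc_le M(1)) simp
      finally show "norm (T (S N \<xi>)) \<le> M * norm \<xi>" .
    qed
  qed
  moreover have "B \<xi> = \<tau>" if \<tau>: "(\<xi>, \<tau>) \<in> TC" for \<xi> \<tau>
  proof (rule LIMSEQ_unique[OF B])
    obtain \<eta> \<zeta> where \<eta>: "\<tau> = \<eta> - A' \<zeta>" "(A \<xi>, \<eta>) \<in> P" "(\<xi>, \<zeta>) \<in> P"
      using \<tau> by (auto simp: TC_def twisted_commutator_def)
    \<comment> \<open>\<theta> is D\<xi>, which exists because \<xi> lies in the common domain of D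
      and |D|.\<close>
    then obtain \<theta> where \<theta>: "(\<xi>, \<theta>) \<in> mult_op \<kappa>"
      unfolding P_def using Domain_mult_op_abs[of \<kappa>] by blast
    have SP: "(S N \<xi>, S N \<zeta>) \<in> P" for N
      using \<eta>(3) by (simp add: S_def P_def mult_op_iff fc_trig)
    have SD: "(S N \<xi>, S N \<theta>) \<in> mult_op \<kappa>" for N
      using \<theta> by (simp add: S_def mult_op_iff fc_trig)
    have "\<exists>e. (A (S N \<xi>), e) \<in> P" for N
      unfolding P_def using U(2)[OF SD] Domain_mult_op_abs[of \<kappa>] by blast
    then obtain e where e: "\<And>N. (A (S N \<xi>), e N) \<in> P" by metis
    have TS: "T (S N \<xi>) = e N - A' (S N \<zeta>)" for N
      using TC_unique[OF T[OF S_dom]] e[of N] SP[of N] unfolding TC_def twisted_commutator_def by blast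
    \<comment> \<open>Convergence of |D|A along the partial sums cannot be read off from |D|
      directly. But |D|A and DA have equal norms on a vector, and DA is expressed by the bounded
      operators A' and U applied to D\<xi> and \<xi>.\<close>
    have le: "norm (e N - \<eta>) \<le> norm (A' (S N \<theta> - \<theta>) + U (S N \<xi> - \<xi>))" for N
    proof (rule norm_mult_op_abs)
      show "(A (S N \<xi> - \<xi>), A' (S N \<theta> - \<theta>) + U (S N \<xi> - \<xi>)) \<in> mult_op \<kappa>"
        by (rule U(2)[OF mult_op_diff[OF SD \<theta>]])
      show "(A (S N \<xi> - \<xi>), e N - \<eta>) \<in> mult_op (\<lambda>n. \<bar>\<kappa> n\<bar>)"
        using mult_op_diff[OF e[unfolded P_def] \<eta>(2)[unfolded P_def]] by (simp add: bounded_clinear_diff[OF A(1)])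
    qed
    have "(\<lambda>N. A' (S N \<theta> - \<theta>) + U (S N \<xi> - \<xi>)) \<longlonglongrightarrow> A' (\<theta> - \<theta>) + U (\<xi> - \<xi>)"
      by (intro tendsto_add bounded_clinear_tendsto[OF A(2)] bounded_clinear_tendsto[OF U(1)] tendsto_diff S_lim tendsto_const)
    also have "A' (\<theta> - \<theta>) + U (\<xi> - \<xi>) = 0"
      unfolding bounded_clinear_diff[OF A(2)] bounded_clinear_diff[OF U(1)] by simp
    finally have "(\<lambda>N. norm (A' (S N \<theta> - \<theta>) + U (S N \<xi> - \<xi>))) \<longlonglongrightarrow> 0"
      by (rule tendsto_norm_zero)
    then have "(\<lambda>N. e N - \<eta>) \<longlonglongrightarrow> 0"
      by (rule Lim_null_comparison[OF always_eventually[OF allI[OF le]]])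
    then have "e \<longlonglongrightarrow> \<eta>" by (rule LIM_zero_cancel)
    then show "(\<lambda>N. T (S N \<xi>)) \<longlonglongrightarrow> \<tau>"
      unfolding TS \<eta>(1) by (intro tendsto_diff bounded_clinear_tendsto[OF A(2)] S_lim)
  qed
  ultimately show ?thesis
    using dom bounded_clinear_bounded_linear[of B] unfolding bounded_from_def TC_def P_def
    by (intro conjI exI[of _ B]) (auto simp: bounded_clinear_def)
qed

text \<open>The case of a single term g \<open>U\<^sup>*\<^sub>\<phi>\<close>, where multiplication
  and composition are treated apart and recombined through \<open>wcomp_factor\<close>. Continuity
  of the weights and the existence of a lift are exported for splitting the representation into its
  terms.\<close>

lemma monomial_twisted_pair:
  assumes \<phi>: "\<phi> \<in> diff_plus" and g: "g \<in> smooth_circle"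
  defines "w \<equiv> \<lambda>p. g p * complex_of_real (sqrt (circle_deriv \<phi> p))"
  shows "continuous_on UNIV w" "continuous_on UNIV (\<lambda>p. of_real (circle_deriv \<phi> p) * w p)"
    "\<exists>\<Phi> \<Phi>'. lifts_to \<phi> \<Phi> \<Phi>'"
    "twisted_pair (\<lambda>n. 2 * pi * of_int n) (wcomp w \<phi>) (wcomp (\<lambda>p. of_real (circle_deriv \<phi> p) * w p) \<phi>)"
proof -
  obtain \<Phi> \<Psi> where \<Phi>: "smooth_lift \<phi> \<Phi>" and \<Psi>: "smooth_lift (inv_into UNIV \<phi>) \<Psi>"
    using \<phi> by (auto simp: diff_plus_def)
  define \<Phi>' where "\<Phi>' = deriv \<Phi>"
  have L: "lifts_to \<phi> \<Phi> \<Phi>'"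
    unfolding \<Phi>'_def by (rule diff_plus_lifts_to[OF \<phi> \<Phi>])
  note CL = lifts_toD(1)[OF L]
  have \<Phi>': "circle_deriv \<phi> (to_circle t) = \<Phi>' t" for t
    unfolding \<Phi>'_def by (rule circle_deriv_lift[OF \<Phi>])
  have CnPhi: "Cn n \<Phi>'" for n
  proof -
    have "Cn (Suc n) \<Phi>"
      using \<Phi> by (intro smooth_imp_Cn) (simp add: smooth_lift_def)
    then obtain F where F: "\<And>x. (\<Phi> has_vector_derivative F x) (at x)" "Cn n F" by auto
    have "F = \<Phi>'"
      using F(1) circle_liftD(1)[OF CL]
      by (intro ext) (metis DERIV_unique has_real_derivative_iff_has_vector_derivative)
    with F show ?thesis by simp
  qed
  define \<delta> where "\<delta> p = complex_of_real (circle_deriv \<phi> p)" for p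
  have \<delta>: "\<delta> (to_circle t) = of_real (\<Phi>' t)" for t
    by (simp add: \<delta>_def \<Phi>')
  have c\<delta>: "continuous_on UNIV \<delta>"
    unfolding continuous_on_circle_iff \<delta> by (intro continuous_intros circle_liftD(2)[OF CL])
  \<comment> \<open>Positivity of \<phi>' is what keeps the square root in w differentiable; three
    derivatives are those consumed by the summability of the coefficients.\<close>
  have w3: "circle_Cn 3 w"
  proof -
    have "Cn 3 (\<lambda>t. g (to_circle t))"
      using g by (intro smooth_imp_Cn) (simp add: smooth_circle_def)
    then have "Cn 3 (\<lambda>t. g (to_circle t) * complex_of_real (sqrt (\<Phi>' t)))"
      by (intro Cn_mult Cn_of_real Cn_sqrt CnPhi circle_liftD(3)[OF CL])
    then show ?thesis by (simp add: circle_Cn_def w_def \<Phi>')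
  qed
  show cw: "continuous_on UNIV w" by (rule circle_Cn_continuous[OF w3])
  show cdw: "continuous_on UNIV (\<lambda>p. of_real (circle_deriv \<phi> p) * w p)"
    using continuous_on_mult[OF c\<delta> cw] by (simp add: \<delta>_def)
  show "\<exists>\<Phi> \<Phi>'. lifts_to \<phi> \<Phi> \<Phi>'" using L by blast
  define A' where "A' = wcomp (\<lambda>p. \<delta> p * w p) \<phi>"
  let ?D = "mult_op (\<lambda>n. 2 * pi * of_int n)" and ?P = "mult_op (\<lambda>n. \<bar>2 * pi * of_int n\<bar>)"
  have P: "?P = mult_op (\<lambda>n. 2 * pi * \<bar>of_int n\<bar>)" by (simp add: abs_mult)
  have c1: "continuous_on UNIV (\<lambda>_::circle. 1 :: complex)" by simp
  note bc = bounded_clinear_wcomp[OF L]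
  obtain w' where w': "circle_Cn (Suc (Suc 0)) w'" "\<And>t. ((\<lambda>t. w (to_circle t)) has_vector_derivative w' (to_circle t)) (at t)"
    using w3 circle_Cn_deriv[of "Suc (Suc 0)" w] by (auto simp: numeral_3_eq_3)
  have cw': "continuous_on UNIV w'" by (rule circle_Cn_continuous[OF w'(1)])
  have cw'i: "continuous_on UNIV (\<lambda>p. w' p / \<i>)" by (intro continuous_intros cw') simp
  have D: "(wcomp w \<phi> \<xi>, A' \<zeta> + wcomp (\<lambda>p. w' p / \<i>) \<phi> \<xi>) \<in> ?D" if "(\<xi>, \<zeta>) \<in> ?D" for \<xi> \<zeta>
    using wcomp_dirac[OF L cw' \<delta> w'(2)] that unfolding dirac_eq_mult_op A'_def by blast
  \<comment> \<open>The Leibniz rule with the constant weight 1, whose derivative is 0: C preserves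
    the domain, so the intermediate vector |D|C\<xi> used below exists.\<close>
  have D1: "wcomp (\<lambda>_. 1) \<phi> \<xi> \<in> Domain ?P" if "\<xi> \<in> Domain ?D" for \<xi>
  proof -
    obtain \<zeta> where "(\<xi>, \<zeta>) \<in> dirac" using \<open>\<xi> \<in> Domain ?D\<close> by (auto simp: dirac_eq_mult_op)
    then have "(wcomp (\<lambda>_. 1) \<phi> \<xi>, wcomp (\<lambda>p. \<delta> p * 1) \<phi> \<zeta> + wcomp (\<lambda>p. 0 / \<i>) \<phi> \<xi>) \<in> dirac"
      by (intro wcomp_dirac[OF L _ \<delta>, where w'="\<lambda>_. 0"]) (auto intro: has_vector_derivative_const)
    then show ?thesis
      unfolding dirac_eq_mult_op Domain_mult_op_abs by blast
  qed
  have inv: "inv_into UNIV \<phi> (\<phi> p) = p" for p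
    using \<phi> by (simp add: diff_plus_def bij_is_inj)
  have \<psi>: "inv_into UNIV \<phi> (to_circle t) = to_circle (\<Psi> t)" for t
    using \<Psi> by (simp add: smooth_lift_def)
  have \<Psi>1: "Cn 1 \<Psi>"
    using \<Psi> by (intro smooth_imp_Cn) (simp add: smooth_lift_def)
  obtain M1 where M1: "M1 \<ge> 0" "\<And>J c \<eta>. finite J \<Longrightarrow> (wcomp (\<lambda>_. 1) \<phi> (trig J c), \<eta>) \<in> ?P \<Longrightarrow>
    norm (\<eta> - wcomp \<delta> \<phi> (trig J (\<lambda>n. of_real (2 * pi * \<bar>of_int n\<bar>) * c n))) \<le> M1 * norm (trig J c)"
    unfolding P using composition_abs_commutator[OF L CnPhi \<psi> \<Psi>1 inv \<delta>] by blast
  obtain M2 where M2: "M2 \<ge> 0" "\<And>\<xi> \<eta> \<eta>'. (\<xi>, \<eta>) \<in> ?P \<Longrightarrow> (wcomp w id \<xi>, \<eta>') \<in> ?P \<Longrightarrow>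
      norm (\<eta>' - wcomp w id \<eta>) \<le> M2 * norm \<xi>"
    unfolding P using multiplication_abs_commutator[OF w3] by blast
  obtain C1 where C1: "C1 \<ge> 0" "\<And>\<xi>. norm (wcomp (\<lambda>_. 1) \<phi> \<xi>) \<le> C1 * norm \<xi>"
    using wcomp_bounded[OF L c1] by blast
  obtain C2 where C2: "C2 \<ge> 0" "\<And>\<xi>. norm (wcomp w id \<xi>) \<le> C2 * norm \<xi>"
    using wcomp_bounded[OF lifts_to_id cw] by blast
  \<comment> \<open>\<open>M2 * C1\<close> bounds the commutator of |D| with w, applied after C;
    \<open>C2 * M1\<close> bounds w applied to the defect of C.\<close>
  have main: "norm (\<eta> - A' \<zeta>) \<le> (M2 * C1 + C2 * M1) * norm (trig J c)"
    if J: "finite J" and \<zeta>: "(trig J c, \<zeta>) \<in> ?P" and \<eta>: "(wcomp w \<phi> (trig J c), \<eta>) \<in> ?P" for J c \<zeta> \<eta>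
  proof -
    have \<zeta>_eq: "\<zeta> = trig J (\<lambda>n. of_real (2 * pi * \<bar>of_int n\<bar>) * c n)"
      using mult_op_unique[OF \<zeta>[unfolded P] mult_op_trig[OF J]] .
    have "trig J c \<in> Domain ?D"
      using mult_op_trig[OF J] by blast
    then obtain \<eta>1 where \<eta>1: "(wcomp (\<lambda>_. 1) \<phi> (trig J c), \<eta>1) \<in> ?P"
      using D1 by blast
    have "wcomp w \<phi> \<xi> = wcomp w id (wcomp (\<lambda>_. 1) \<phi> \<xi>)" for \<xi>
      using wcomp_factor[OF L cw c1] by simp
    then have "norm (\<eta> - wcomp w id \<eta>1) \<le> M2 * norm (wcomp (\<lambda>_. 1) \<phi> (trig J c))"
      using M2(2)[OF \<eta>1] \<eta> by simp
    also have "\<dots> \<le> M2 * (C1 * norm (trig J c))"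
      by (intro mult_left_mono C1 M2)
    finally have 1: "norm (\<eta> - wcomp w id \<eta>1) \<le> M2 * (C1 * norm (trig J c))" .
    have A'_eq: "A' \<zeta> = wcomp w id (wcomp \<delta> \<phi> \<zeta>)"
      unfolding A'_def using wcomp_factor[OF L cw c\<delta>, of \<zeta>] by (simp add: mult.commute)
    have "norm (wcomp w id \<eta>1 - A' \<zeta>) = norm (wcomp w id (\<eta>1 - wcomp \<delta> \<phi> \<zeta>))"
      unfolding A'_eq wcomp_diff[OF lifts_to_id cw] ..
    also have "\<dots> \<le> C2 * norm (\<eta>1 - wcomp \<delta> \<phi> \<zeta>)" by (rule C2)
    also have "\<dots> \<le> C2 * (M1 * norm (trig J c))"
      unfolding \<zeta>_eq by (intro mult_left_mono M1(2)[OF J \<eta>1] C2)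
    finally have 2: "norm (wcomp w id \<eta>1 - A' \<zeta>) \<le> C2 * (M1 * norm (trig J c))" .
    have "norm ((\<eta> - wcomp w id \<eta>1) + (wcomp w id \<eta>1 - A' \<zeta>)) \<le> M2 * (C1 * norm (trig J c)) + C2 * (M1 * norm (trig J c))"
      by (rule norm_triangle_mono[OF 1 2])
    then show ?thesis by (simp add: algebra_simps)
  qed
  have cdw': "continuous_on UNIV (\<lambda>p. \<delta> p * w p)"
    by (rule continuous_on_mult[OF c\<delta> cw])
  have "twisted_pair (\<lambda>n. 2 * pi * of_int n) (wcomp w \<phi>) A'"
    unfolding twisted_pair_def abs_commutator_bounded_def
  proof (intro conjI)
    show "bounded_clinear (wcomp w \<phi>)" "bounded_clinear A'"
      unfolding A'_def by (rule bc[OF cw] bc[OF cdw'])+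
    show "\<exists>U. bounded_clinear U \<and> (\<forall>\<xi> \<zeta>. (\<xi>, \<zeta>) \<in> ?D \<longrightarrow> (wcomp w \<phi> \<xi>, A' \<zeta> + U \<xi>) \<in> ?D)"
      using bc[OF cw'i] D by blast
    show "\<exists>M\<ge>0. \<forall>J c \<zeta> \<eta>. finite J \<longrightarrow> (trig J c, \<zeta>) \<in> ?P \<longrightarrow> (wcomp w \<phi> (trig J c), \<eta>) \<in> ?P \<longrightarrow>
        norm (\<eta> - A' \<zeta>) \<le> M * norm (trig J c)"
      using main M1(1) M2(1) C1(1) C2(1) by (intro exI[of _ "M2 * C1 + C2 * M1"] conjI allI impI) auto
  qed
  then show "twisted_pair (\<lambda>n. 2 * pi * of_int n) (wcomp w \<phi>) (wcomp (\<lambda>p. of_real (circle_deriv \<phi> p) * w p) \<phi>)"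
    by (simp add: A'_def \<delta>_def)
qed

theorem lemma2p2:
  fixes \<Gamma> :: "(circle \<Rightarrow> circle) set" and a :: crossed
  assumes "subgroup \<Gamma> (BijGroup UNIV)" and "\<Gamma> \<subseteq> diff_plus"
    and "a \<in> carrier (crossed_product \<Gamma>)"
  shows "bounded_from (Domain dirac) (twisted_commutator dirac (rep_pi a) (rep_pi (twist a))) \<and>
    bounded_from (Domain dirac) (twisted_commutator (abs_op dirac) (rep_pi a) (rep_pi (twist a)))"
proof -
  have supp: "finite (supp a)" "supp a \<subseteq> diff_plus" "\<And>\<phi>. a \<phi> \<in> smooth_circle"
    using assms by (auto simp: crossed_product_def)
  define w where "w \<phi> = (\<lambda>p. a \<phi> p * complex_of_real (sqrt (circle_deriv \<phi> p)))" for \<phi>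
  define w' where "w' \<phi> = (\<lambda>p. of_real (circle_deriv \<phi> p) * w \<phi> p)" for \<phi>
  have mono: "continuous_on UNIV (w \<phi>)" "continuous_on UNIV (w' \<phi>)" "\<exists>\<Phi> \<Phi>'. lifts_to \<phi> \<Phi> \<Phi>'"
    "twisted_pair (\<lambda>n. 2 * pi * of_int n) (wcomp (w \<phi>) \<phi>) (wcomp (w' \<phi>) \<phi>)" if "\<phi> \<in> supp a" for \<phi>
    using monomial_twisted_pair[OF subsetD[OF supp(2) that] supp(3)[of \<phi>]] unfolding w_def w'_def by blast+
  \<comment> \<open>Stated for a general element with the support of \<open>a\<close>, so that it
    applies both to \<open>a\<close> and to its twist. Positivity of \<phi>' keeps the two supports
    equal, and both sums then have the same index set and can be paired term by term.\<close>
  have rep: "rep_pi b = (\<lambda>\<xi>. \<Sum>\<phi>\<in>supp a. wcomp (v \<phi>) \<phi> \<xi>)"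
    if b: "supp b = supp a" "\<And>\<phi> p. b \<phi> p * complex_of_real (sqrt (circle_deriv \<phi> p)) = v \<phi> p"
      and v: "\<And>\<phi>. \<phi> \<in> supp a \<Longrightarrow> continuous_on UNIV (v \<phi>)" for b v
  proof
    fix \<xi>
    have "rep_pi b \<xi> = to_L2 (\<lambda>p. \<Sum>\<phi>\<in>supp a. v \<phi> p * rep_L2 \<xi> (\<phi> p))"
      by (simp add: rep_pi_def b)
    also have "\<dots> = (\<Sum>\<phi>\<in>supp a. wcomp (v \<phi>) \<phi> \<xi>)"
      unfolding wcomp_def
    proof (rule to_L2_sum)
      fix \<phi> assume \<phi>: "\<phi> \<in> supp a"
      then obtain \<Phi> \<Phi>' where "lifts_to \<phi> \<Phi> \<Phi>'"
        using mono(3) by blast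
      then show "square_integrable (\<lambda>p. v \<phi> p * rep_L2 \<xi> (\<phi> p))"
        by (rule square_integrable_wcomp) (rule v[OF \<phi>] square_integrable_rep)+
    qed
    finally show "rep_pi b \<xi> = (\<Sum>\<phi>\<in>supp a. wcomp (v \<phi>) \<phi> \<xi>)" .
  qed
  have "rep_pi a = (\<lambda>\<xi>. \<Sum>\<phi>\<in>supp a. wcomp (w \<phi>) \<phi> \<xi>)"
    using mono(1) by (intro rep) (auto simp: w_def)
  moreover have "rep_pi (twist a) = (\<lambda>\<xi>. \<Sum>\<phi>\<in>supp a. wcomp (w' \<phi>) \<phi> \<xi>)"
    using mono(2) by (intro rep supp_twist supp) (auto simp: w'_def w_def twist_def mult_ac)
  moreover have "twisted_pair (\<lambda>n. 2 * pi * of_int n)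
      (\<lambda>\<xi>. \<Sum>\<phi>\<in>supp a. wcomp (w \<phi>) \<phi> \<xi>) (\<lambda>\<xi>. \<Sum>\<phi>\<in>supp a. wcomp (w' \<phi>) \<phi> \<xi>)"
    by (rule twisted_pair_sum[where A="\<lambda>\<phi>. wcomp (w \<phi>) \<phi>" and A'="\<lambda>\<phi>. wcomp (w' \<phi>) \<phi>"])
       (rule mono(4))
  ultimately have "twisted_pair (\<lambda>n. 2 * pi * of_int n) (rep_pi a) (rep_pi (twist a))"
    by simp
  then show ?thesis
    unfolding dirac_eq_mult_op abs_mult_op
    by (intro conjI twisted_commutator_bounded twisted_abs_commutator_bounded)
qed

end
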